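(* Let $\sigma>0$, let $F=(F_1,\dots,F_d):\mathbb{R}^d\to\mathbb{R}^d$ be of class $C^\infty$, and let $x_0\in\mathbb{R}^d$ with $F(x_0)=0$. Let $H$ be the RKHS on $\mathbb{R}^d$ of either the exponential kernel $k(x,y)=e^{(x-x_0)^\top(y-x_0)/\sigma^2}$ or the Gaussian kernel $k(x,y)=e^{-\|x-y\|^2/2\sigma^2}$, and assume $V_{x_0}\subset D(A_F)$. Let $x_1,x_2,\dots$ be i.i.d. random variables whose distribution has a compactly supported density $\rho$ such that $\operatorname{ess\,inf}_{x\in U}\rho(x)>0$ for some nonempty open $U\subset\mathbb{R}^d$, and let $y_i=F(x_i)$. Let $\widehat F_{m,n,N}:\mathbb{R}^d\to\mathbb{R}^d$ be the output of the reconstruction algorithm described in the context, for $1\le m\le n$ and $N\ge\binom{n+d}{d}$. Then for every compact set $K\subset\mathbb{R}^d$, almost surely, $$\lim_{m\to\infty}\lim_{n\to\infty}\lim_{N\to\infty}\ \sup_{y\in K}\big\|F(y)-\widehat F_{m,n,N}(y)\big\|=0 .$$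
   Context: $V_{x_0}:=\mathrm{span}\{\partial_x^\alpha k(x,\cdot)|_{x=x_0}:\alpha\in\mathbb{Z}_{\ge0}^d\}\subset H$. $A_Fh:=\sum_{i=1}^dF_i\,\partial_{x_i}h$ with domain $D(A_F)=\{h\in H:\sum_iF_i\partial_{x_i}h\in H\}$. Reconstruction algorithm. Fix an enumeration $\{\alpha^{(i)}\}_{i\ge1}$ of $\mathbb{Z}_{\ge0}^d$ with $|\alpha^{(i)}|\le|\alpha^{(j)}|$ for $i\le j$, and with $\alpha^{(1)}=0$, $\alpha^{(i+1)}=e_i$ (standard unit vector) for $i=1,\dots,d$. Let $r_n:=\binom{n+d}{d}$. Let $v_i(x):=\sigma^{-|\alpha^{(i)}|}(x-x_0)^{\alpha^{(i)}}$ for the exponential kernel, and $v_i(x):=\sigma^{-|\alpha^{(i)}|}(x-x_0)^{\alpha^{(i)}}e^{-\|x-x_0\|^2/2\sigma^2}$ for the Gaussian kernel. Put $\mathbf{v}_n(x):=(v_i(x))_{i=1}^{r_n}$ and $\mathbf{G}_m:=\mathrm{diag}(\alpha^{(1)}!,\dots,\alpha^{(r_m)}!)$. Writing $y_j=(y_{1j},\dots,y_{dj})=F(x_j)$, form $$\mathbf{V}_n^X:=(\mathbf{v}_n(x_1),\dots,\mathbf{v}_n(x_N)),\qquad\mathbf{W}_m^{X,Y}:=\sum_{i=1}^d\big(y_{i1}\partial_{x_i}\mathbf{v}_m(x_1),\dots,y_{iN}\partial_{x_i}\mathbf{v}_m(x_N)\big),$$ and let $\widehat{\mathbf{A}}\in\mathbb{R}^{r_m\times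 r_m}$ be the matrix formed by the first $r_m$ columns of $\mathbf{W}_m^{X,Y}(\mathbf{V}_n^X)^\dagger$ ($\dagger$ = Moore–Penrose pseudo-inverse). The output is $\widehat F_{m,n,N}=(\widehat F_1,\dots,\widehat F_d)$, where: for the exponential kernel, $\widehat F_i(x)$ is the $(i+1)$-th component of $\sigma\,\widehat{\mathbf{A}}\,\mathbf{v}_m(x)$; for the Gaussian kernel, $\widehat F_i(x):=\sigma^2\,(\partial_{x_i}\mathbf{v}_m(x))^\top\mathbf{G}_m^{-1}\widehat{\mathbf{A}}\,\mathbf{v}_m(x)$. *)

theory Defs
  imports
    "HOL-Probability.Probability"
    "Jordan_Normal_Form.Gauss_Jordan_Elimination"
begin

text \<open>Points of Euclidean space have type \<open>real ^ 'n\<close> and are indexed with \<open>$\<close>; the vectors and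
  matrices of the algorithm, whose sizes vary, are those of Jordan_Normal_Form.\<close>

no_notation Matrix.vec_index (infixl \<open>$\<close> 100)

section \<open>Partial derivatives\<close>

definition partial_deriv :: "'n::finite \<Rightarrow> (real ^ 'n \<Rightarrow> real) \<Rightarrow> real ^ 'n \<Rightarrow> real" where
  "partial_deriv l f x = deriv (\<lambda>t. f (x + t *\<^sub>R axis l 1)) 0"

definition iter_partial :: "'n::finite list \<Rightarrow> (real ^ 'n \<Rightarrow> real) \<Rightarrow> real ^ 'n \<Rightarrow> real" where
  "iter_partial ls f = foldr partial_deriv ls f"

text \<open>The multi-index derivative applies the partial derivatives in the order of the coordinates
  given by the numbering \<open>c\<close>; for the smooth functions to which it is applied this order is
  immaterial.\<close>

definition multi_deriv ::
    "(nat \<Rightarrow> 'n::finite) \<Rightarrow> ('n \<Rightarrow> nat) \<Rightarrow> (real ^ 'n \<Rightarrow> real) \<Rightarrow> real ^ 'n \<Rightarrow> real" where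
  "multi_deriv c a f =
     iter_partial (concat (map (\<lambda>i. replicate (a (c i)) (c i)) [0..<CARD('n)])) f"

text \<open>Partial derivatives of all orders exist and are continuous.\<close>

definition C_infinity :: "(real ^ 'n::finite \<Rightarrow> real) \<Rightarrow> bool" where
  "C_infinity f \<longleftrightarrow>
     (\<forall>ls. continuous_on UNIV (iter_partial ls f) \<and>
       (\<forall>l x. (\<lambda>t. iter_partial ls f (x + t *\<^sub>R axis l 1)) differentiable (at 0)))"

section \<open>Reproducing kernel Hilbert spaces\<close>

text \<open>\<open>H\<close> with inner product \<open>ip\<close> is a Hilbert space of real functions containing all the
  \<open>k x\<close>, and evaluation at \<open>x\<close> is the inner product with \<open>k x\<close>. By Moore--Aronszajn, \<open>H\<close> and the
  restriction of \<open>ip\<close> to \<open>H\<close> are determined by \<open>k\<close>.\<close>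

locale rkhs =
  fixes k :: "'x \<Rightarrow> 'x \<Rightarrow> real"
    and H :: "('x \<Rightarrow> real) set"
    and ip :: "('x \<Rightarrow> real) \<Rightarrow> ('x \<Rightarrow> real) \<Rightarrow> real"
  assumes zero_mem: "(\<lambda>_. 0) \<in> H"
    and add_mem: "f \<in> H \<Longrightarrow> g \<in> H \<Longrightarrow> (\<lambda>x. f x + g x) \<in> H"
    and scale_mem: "f \<in> H \<Longrightarrow> (\<lambda>x. a * f x) \<in> H"
    and ip_commute: "f \<in> H \<Longrightarrow> g \<in> H \<Longrightarrow> ip f g = ip g f"
    and ip_add_left: "f \<in> H \<Longrightarrow> g \<in> H \<Longrightarrow> h \<in> H \<Longrightarrow> ip (\<lambda>x. f x + g x) h = ip f h + ip g h"
    and ip_scale_left: "f \<in> H \<Longrightarrow> h \<in> H \<Longrightarrow> ip (\<lambda>x. a * f x) h = a * ip f h"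
    and ip_nonneg: "f \<in> H \<Longrightarrow> 0 \<le> ip f f"
    and ip_definite: "f \<in> H \<Longrightarrow> ip f f = 0 \<Longrightarrow> f = (\<lambda>_. 0)"
    and complete:
      "(\<forall>n::nat. s n \<in> H) \<Longrightarrow>
       (\<forall>e>0. \<exists>n0. \<forall>m\<ge>n0. \<forall>n\<ge>n0. sqrt (ip (\<lambda>x. s m x - s n x) (\<lambda>x. s m x - s n x)) < e) \<Longrightarrow>
       \<exists>f\<in>H. (\<lambda>n. sqrt (ip (\<lambda>x. s n x - f x) (\<lambda>x. s n x - f x))) \<longlonglongrightarrow> 0"
    and kernel_mem: "k x \<in> H"
    and reproducing: "f \<in> H \<Longrightarrow> ip f (k x) = f x"

datatype kernel_kind = Exponential | Gaussian

fun kernel_fun :: "kernel_kind \<Rightarrow> real \<Rightarrow> real ^ 'n::finite \<Rightarrow> real ^ 'n \<Rightarrow> real ^ 'n \<Rightarrow> real" where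
  "kernel_fun Exponential \<sigma> x0 x y = exp (inner (x - x0) (y - x0) / \<sigma>\<^sup>2)"
| "kernel_fun Gaussian \<sigma> x0 x y = exp (- (norm (x - y))\<^sup>2 / (2 * \<sigma>\<^sup>2))"

text \<open>The space \<open>V\<close> at \<open>x0\<close>: finite linear combinations of the functions
  \<open>y \<mapsto> \<partial>\<^sub>x\<^sup>a k(x, y)\<close> evaluated at \<open>x = x0\<close>.\<close>

definition jet_span ::
    "(nat \<Rightarrow> 'n::finite) \<Rightarrow> (real ^ 'n \<Rightarrow> real ^ 'n \<Rightarrow> real) \<Rightarrow> real ^ 'n \<Rightarrow> (real ^ 'n \<Rightarrow> real) set"
where
  "jet_span c k x0 =
     {(\<lambda>y. \<Sum>a\<in>S. u a * multi_deriv c a (\<lambda>x. k x y) x0) | (S :: ('n \<Rightarrow> nat) set) u. finite S}"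

text \<open>The domain of \<open>A\<^sub>F h = \<Sum>\<^sub>l F\<^sub>l \<partial>\<^sub>l h\<close> in \<open>H\<close>.\<close>

definition A_op :: "(real ^ 'n::finite \<Rightarrow> real ^ 'n) \<Rightarrow> (real ^ 'n \<Rightarrow> real) \<Rightarrow> real ^ 'n \<Rightarrow> real" where
  "A_op F h x = (\<Sum>l\<in>UNIV. F x $ l * partial_deriv l h x)"

definition A_dom ::
    "(real ^ 'n::finite \<Rightarrow> real) set \<Rightarrow> (real ^ 'n \<Rightarrow> real ^ 'n) \<Rightarrow> (real ^ 'n \<Rightarrow> real) set" where
  "A_dom H F = {h \<in> H. A_op F h \<in> H}"

section \<open>Moore--Penrose pseudo-inverse\<close>

definition is_pinv :: "real mat \<Rightarrow> real mat \<Rightarrow> bool" where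
  "is_pinv A B \<longleftrightarrow>
     B \<in> carrier_mat (dim_col A) (dim_row A) \<and>
     A * B * A = A \<and> B * A * B = B \<and>
     transpose_mat (A * B) = A * B \<and> transpose_mat (B * A) = B * A"

definition pinv :: "real mat \<Rightarrow> real mat" where
  "pinv A = (THE B. is_pinv A B)"

lemma is_pinv_unique:
  assumes "is_pinv A B" "is_pinv A C"
  shows "B = C"
proof -
  define n m where "n = dim_row A" and "m = dim_col A"
  have A: "A \<in> carrier_mat n m" by (auto simp: n_def m_def)
  have B: "B \<in> carrier_mat m n" and C: "C \<in> carrier_mat m n"
    using assms by (auto simp: is_pinv_def n_def m_def)
  have AB: "A * B \<in> carrier_mat n n" and AC: "A * C \<in> carrier_mat n n"
    and BA: "B * A \<in> carrier_mat m m" and CA: "C * A \<in> carrier_mat m m"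
    using A B C by auto
  have b: "A * B * A = A" "B * A * B = B" "transpose_mat (A * B) = A * B"
      "transpose_mat (B * A) = B * A"
    and c: "A * C * A = A" "C * A * C = C" "transpose_mat (A * C) = A * C"
      "transpose_mat (C * A) = C * A"
    using assms by (auto simp: is_pinv_def)
  have "A * B = (A * C * A) * B" using c by simp
  also have "\<dots> = (A * C) * (A * B)" by (rule assoc_mult_mat[OF AC A B])
  also have "\<dots> = transpose_mat ((A * B) * (A * C))"
    by (subst transpose_mult[OF AB AC]) (simp only: b c)
  also have "(A * B) * (A * C) = (A * B * A) * C"
    by (rule assoc_mult_mat[OF AB A C, symmetric])
  also have "transpose_mat \<dots> = A * C" using b c by simp
  finally have 1: "A * B = A * C" .
  have "B * A = B * (A * C * A)" using c by simp
  also have "\<dots> = (B * A) * (C * A)"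
    using A B C CA by (metis assoc_mult_mat)
  also have "\<dots> = transpose_mat ((C * A) * (B * A))"
    by (subst transpose_mult[OF CA BA]) (simp only: b c)
  also have "(C * A) * (B * A) = C * (A * B * A)"
    using A B C BA by (metis assoc_mult_mat)
  also have "transpose_mat \<dots> = C * A" using b c by simp
  finally have 2: "B * A = C * A" .
  have "B = B * A * B" using b by simp
  also have "\<dots> = B * (A * B)" by (rule assoc_mult_mat[OF B A B])
  also have "\<dots> = B * A * C" unfolding 1 by (rule assoc_mult_mat[OF B A C, symmetric])
  also have "\<dots> = C" using 2 c by simp
  finally show ?thesis .
qed

lemma pinv_eqI: "is_pinv A B \<Longrightarrow> pinv A = B"
  unfolding pinv_def using is_pinv_unique by blast

section \<open>The reconstruction algorithm\<close>

text \<open>All numberings start at 0, so that an index \<open>i\<close> here is \<open>i + 1\<close> in the usual 1-based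
  numbering. The coordinates are numbered by \<open>c\<close>, a bijection from \<open>{..<CARD('n)}\<close> to the index
  type, and the multi-indices by \<open>\<alpha>\<close>: first the zero multi-index, then the unit multi-indices.\<close>

definition graded_enumeration ::
    "(nat \<Rightarrow> 'n::finite) \<Rightarrow> (nat \<Rightarrow> 'n \<Rightarrow> nat) \<Rightarrow> bool" where
  "graded_enumeration c \<alpha> \<longleftrightarrow>
     bij_betw \<alpha> UNIV UNIV \<and>
     (\<forall>i j. i \<le> j \<longrightarrow> sum (\<alpha> i) UNIV \<le> sum (\<alpha> j) UNIV) \<and>
     \<alpha> 0 = (\<lambda>_. 0) \<and>
     (\<forall>i<CARD('n). \<alpha> (Suc i) = (\<lambda>l. if l = c i then 1 else 0))"

definition multi_fact :: "('n::finite \<Rightarrow> nat) \<Rightarrow> real" where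
  "multi_fact a = (\<Prod>l\<in>UNIV. fact (a l))"

definition scaled_monomial ::
    "real \<Rightarrow> real ^ 'n::finite \<Rightarrow> ('n \<Rightarrow> nat) \<Rightarrow> real ^ 'n \<Rightarrow> real" where
  "scaled_monomial \<sigma> x0 a x = (1 / \<sigma> ^ sum a UNIV) * (\<Prod>l\<in>UNIV. ((x - x0) $ l) ^ a l)"

fun feature ::
    "kernel_kind \<Rightarrow> real \<Rightarrow> real ^ 'n::finite \<Rightarrow> ('n \<Rightarrow> nat) \<Rightarrow> real ^ 'n \<Rightarrow> real" where
  "feature Exponential \<sigma> x0 a x = scaled_monomial \<sigma> x0 a x"
| "feature Gaussian \<sigma> x0 a x =
     scaled_monomial \<sigma> x0 a x * exp (- (norm (x - x0))\<^sup>2 / (2 * \<sigma>\<^sup>2))"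

definition r_dim :: "nat \<Rightarrow> nat \<Rightarrow> nat" where
  "r_dim d n = (n + d) choose d"

context
  fixes \<kappa> :: kernel_kind and \<sigma> :: real and x0 :: "real ^ 'n::finite"
    and c :: "nat \<Rightarrow> 'n" and \<alpha> :: "nat \<Rightarrow> 'n \<Rightarrow> nat"
begin

definition feature_vec :: "nat \<Rightarrow> real ^ 'n \<Rightarrow> real Matrix.vec" where
  "feature_vec n x = Matrix.vec (r_dim CARD('n) n) (\<lambda>i. feature \<kappa> \<sigma> x0 (\<alpha> i) x)"

definition feature_vec_deriv :: "'n \<Rightarrow> nat \<Rightarrow> real ^ 'n \<Rightarrow> real Matrix.vec" where
  "feature_vec_deriv l n x =
     Matrix.vec (r_dim CARD('n) n) (\<lambda>i. partial_deriv l (feature \<kappa> \<sigma> x0 (\<alpha> i)) x)"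

definition V_mat :: "nat \<Rightarrow> nat \<Rightarrow> (nat \<Rightarrow> real ^ 'n) \<Rightarrow> real mat" where
  "V_mat n N xs =
     Matrix.mat (r_dim CARD('n) n) N (\<lambda>(i, j). vec_index (feature_vec n (xs j)) i)"

definition W_mat :: "nat \<Rightarrow> nat \<Rightarrow> (nat \<Rightarrow> real ^ 'n) \<Rightarrow> (nat \<Rightarrow> real ^ 'n) \<Rightarrow> real mat" where
  "W_mat m N xs ys =
     Matrix.mat (r_dim CARD('n) m) N
       (\<lambda>(i, j). \<Sum>l\<in>UNIV. ys j $ l * vec_index (feature_vec_deriv l m (xs j)) i)"

definition G_mat :: "nat \<Rightarrow> real mat" where
  "G_mat m = mat_diag (r_dim CARD('n) m) (\<lambda>i. multi_fact (\<alpha> i))"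

definition A_hat ::
    "nat \<Rightarrow> nat \<Rightarrow> nat \<Rightarrow> (nat \<Rightarrow> real ^ 'n) \<Rightarrow> (nat \<Rightarrow> real ^ 'n) \<Rightarrow> real mat" where
  "A_hat m n N xs ys =
     Matrix.mat (r_dim CARD('n) m) (r_dim CARD('n) m)
       (\<lambda>(i, j). (W_mat m N xs ys * pinv (V_mat n N xs)) $$ (i, j))"

text \<open>\<open>mat_inverse\<close> returns an option; \<open>G_mat m\<close> is invertible.\<close>

definition F_hat ::
    "nat \<Rightarrow> nat \<Rightarrow> nat \<Rightarrow> (nat \<Rightarrow> real ^ 'n) \<Rightarrow> (nat \<Rightarrow> real ^ 'n) \<Rightarrow> real ^ 'n \<Rightarrow> real ^ 'n" where
  "F_hat m n N xs ys x =
     (case \<kappa> of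
        Exponential \<Rightarrow>
          (\<chi> l. vec_index (\<sigma> \<cdot>\<^sub>v (A_hat m n N xs ys *\<^sub>v feature_vec m x))
                  (Suc (the_inv_into {..<CARD('n)} c l)))
      | Gaussian \<Rightarrow>
          (\<chi> l. \<sigma>\<^sup>2 * scalar_prod (feature_vec_deriv l m x)
                  (the (mat_inverse (G_mat m)) *\<^sub>v (A_hat m n N xs ys *\<^sub>v feature_vec m x))))"

end

section \<open>Essential infimum and uniform error\<close>

definition ess_inf_on :: "'a::euclidean_space set \<Rightarrow> ('a \<Rightarrow> real) \<Rightarrow> ereal" where
  "ess_inf_on U f = - esssup (restrict_space lborel U) (\<lambda>x. - ereal (f x))"

text \<open>Taken in \<open>ennreal\<close>, so that the supremum over the empty set is 0.\<close>

definition sup_dist_on :: "'a set \<Rightarrow> ('a \<Rightarrow> 'b::real_normed_vector) \<Rightarrow> ('a \<Rightarrow> 'b) \<Rightarrow> ennreal" where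
  "sup_dist_on K f g = (SUP y\<in>K. ennreal (norm (f y - g y)))"

end

theory Submission
  imports Defs "Jordan_Normal_Form.Determinant"
begin

text \<open>The jets of order at most one lie in the domain of \<open>A\<^sub>F\<close>, and all functions of \<open>H\<close> are, up to the
  common weight, entire. Hence the components of \<open>F\<close> are entire and each \<open>A\<^sub>F v\<^sub>p\<close> is the weight times
  an everywhere convergent power series. By the law of large numbers, as \<open>N \<rightarrow> \<infinity>\<close> the rows of the
  regression matrix become the coefficients of the \<open>L\<^sup>2(\<rho>)\<close>-projections of the \<open>A\<^sub>F v\<^sub>p\<close> onto the features
  of degree at most \<open>n\<close>. A Bernstein type inequality bounds the coefficients of a polynomial of degree
  \<open>n\<close> by \<open>C\<^sup>n\<close> times its \<open>L\<^sup>1\<close>-norm on a cube; Taylor tails of entire functions beat \<open>C\<^sup>n\<close>, so as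
  \<open>n \<rightarrow> \<infinity>\<close> the projection coefficients converge to the Taylor coefficients. The remaining limit
  \<open>m \<rightarrow> \<infinity>\<close> is that of an absolutely and uniformly convergent double series with sum \<open>F\<close>.\<close>

no_notation Matrix.vec_index (infixl \<open>$\<close> 100)

section \<open>Exact differentiation formulas on grids\<close>

text \<open>The density is bounded below only on some cube, which may lie far from
  \<open>x0\<close>, while the target is a family of Taylor coefficients at \<open>x0\<close>.
  Recovering them from that cube is extrapolation, and a loss exponential in the degree is accepted.
  It is harmless for the following reason: the Taylor tail from degree D on, taken at radius R and
  multiplied by \<open>C ^ D\<close>, is at most the tail at radius \<open>C * R\<close>, and for an
  entire function this tends to 0 whatever C is. Hence every expansion below is kept with control at
  all radii, and no constant has to be small. The differentiation formulas serve twice. Inside the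
  Hilbert space they approximate coordinate functionals by combinations of kernel sections, which
  yields the expansions of its members; on the sample side, averaged over translations, they yield
  the coefficient bound. The Gaussian output adds a requirement: it sums over all rows
  \<open>p\<close> of the regression matrix, so the size of the coefficients of
  \<open>A_op F\<close> applied to the feature \<open>p\<close> must be controlled in
  \<open>p\<close> as well. A bound geometric in the degree of \<open>p\<close> suffices, since the
  output divides by the factorial of \<open>p\<close>.\<close>

lemma abs_coeff_prod_linear_le:
  fixes t :: "'a \<Rightarrow> real"
  assumes "finite A"
  shows "\<bar>poly.coeff (\<Prod>j\<in>A. [:- t j, 1:]) k\<bar> \<le> (\<Prod>j\<in>A. 1 + \<bar>t j\<bar>)"
  using assms
proof (induction A arbitrary: k rule: finite_induct)
  case empty
  then show ?case by (simp add: coeff_1)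
next
  case (insert a A)
  define p where "p = (\<Prod>j\<in>A. [:- t j, 1:])"
  define B where "B = (\<Prod>j\<in>A. 1 + \<bar>t j\<bar>)"
  have IH: "\<bar>poly.coeff p k\<bar> \<le> B" for k using insert.IH by (simp add: p_def B_def)
  have B0: "0 \<le> B" unfolding B_def by (intro prod_nonneg) auto
  have "\<bar>poly.coeff ([:- t a, 1:] * p) k\<bar> \<le> \<bar>t a\<bar> * B + B"
  proof (cases k)
    case 0
    have "\<bar>t a\<bar> * \<bar>poly.coeff p 0\<bar> \<le> \<bar>t a\<bar> * B" by (intro mult_left_mono IH) auto
    then show ?thesis using 0 B0 by (simp add: abs_mult)
  next
    case (Suc k')
    have "\<bar>- t a * poly.coeff p (Suc k') + poly.coeff p k'\<bar>
        \<le> \<bar>t a\<bar> * \<bar>poly.coeff p (Suc k')\<bar> + \<bar>poly.coeff p k'\<bar>"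
      by (metis abs_minus_cancel abs_mult abs_triangle_ineq)
    also have "\<dots> \<le> \<bar>t a\<bar> * B + B" by (intro add_mono mult_left_mono IH) auto
    finally show ?thesis using Suc by simp
  qed
  then show ?case using insert.hyps by (simp add: p_def B_def algebra_simps)
qed

section \<open>Coefficient functionals of Lagrange interpolation\<close>

definition lagrange_basis :: "nat \<Rightarrow> (nat \<Rightarrow> real) \<Rightarrow> nat \<Rightarrow> real poly" where
  "lagrange_basis n t i =
     Polynomial.smult (1 / (\<Prod>j\<in>{..n} - {i}. t i - t j)) (\<Prod>j\<in>{..n} - {i}. [:- t j, 1:])"

lemma poly_lagrange_basis:
  assumes "inj_on t {..n}" "i \<le> n" "i' \<le> n"
  shows "poly (lagrange_basis n t i) (t i') = (if i = i' then 1 else 0)"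
proof -
  have "(\<Prod>j\<in>{..n} - {i}. t i - t j) \<noteq> 0"
    using assms by (auto simp: inj_on_def)
  moreover have "i \<noteq> i' \<Longrightarrow> (\<Prod>j\<in>{..n} - {i}. t i' - t j) = 0"
    using assms by (intro prod_zero) auto
  ultimately show ?thesis by (auto simp: lagrange_basis_def poly_prod)
qed

lemma degree_lagrange_basis: "i \<le> n \<Longrightarrow> degree (lagrange_basis n t i) \<le> n"
proof -
  assume i: "i \<le> n"
  have "degree (\<Prod>j\<in>{..n} - {i}. [:- t j, 1:]) \<le> sum (degree \<circ> (\<lambda>j. [:- t j, 1:])) ({..n} - {i})"
    by (rule degree_prod_sum_le) simp
  also have "\<dots> = n" using i by simp
  finally show ?thesis
    unfolding lagrange_basis_def using degree_smult_le order_trans by blast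
qed

text \<open>Interpolation at n + 1 distinct nodes reproduces monomials of degree at most n, so the
  k-th coefficients of the basis polynomials are the weights of a rule that computes the k-th
  coefficient from values. The index k is unrestricted: beyond n both sides are 0.\<close>

lemma sum_coeff_lagrange_basis:
  assumes t: "inj_on t {..n}" and jk: "j \<le> n"
  shows "(\<Sum>i\<le>n. poly.coeff (lagrange_basis n t i) k * t i ^ j) = (if j = k then 1 else 0)"
proof -
  define p where "p = (\<Sum>i\<le>n. Polynomial.smult (t i ^ j) (lagrange_basis n t i))"
  have "degree p \<le> n"
    unfolding p_def
    by (intro degree_sum_le order_trans[OF degree_smult_le] degree_lagrange_basis) auto
  moreover have "degree (monom (1::real) j) \<le> n" using jk by (simp add: degree_monom_eq)
  moreover have "card (t ` {..n}) = Suc n" using t by (simp add: card_image)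
  moreover have "poly p x = poly (monom 1 j) x" if x: "x \<in> t ` {..n}" for x
  proof -
    obtain i' where i': "i' \<le> n" "x = t i'" using x by auto
    have "poly p x = (\<Sum>i\<le>n. t i ^ j * poly (lagrange_basis n t i) (t i'))"
      by (simp add: p_def poly_sum i')
    also have "\<dots> = (\<Sum>i\<le>n. if i = i' then t i ^ j else 0)"
      by (intro sum.cong) (use i' t in \<open>auto simp: poly_lagrange_basis\<close>)
    also have "\<dots> = t i' ^ j" using i' by simp
    finally show ?thesis by (simp add: poly_monom i')
  qed
  ultimately have "p = monom 1 j"
    by (intro poly_eqI_degree[of "t ` {..n}"]) auto
  then have "poly.coeff p k = (if j = k then 1 else 0)" by simp
  then show ?thesis by (simp add: p_def coeff_sum mult.commute)
qed

text \<open>The single term of index n of the exponential series at n is at most the whole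
  sum.\<close>

lemma power_self_le_exp_fact: "real n ^ n \<le> exp 1 ^ n * fact n"
proof -
  have "real n ^ n /\<^sub>R fact n \<le> exp (real n)"
    unfolding exp_def using sum_le_suminf[OF summable_exp_generic[of "real n"], of "{n}"] by simp
  moreover have "exp (real n) = exp 1 ^ n" by (simp flip: exp_of_nat_mult)
  ultimately show ?thesis by (simp add: field_simps)
qed

lemma prod_abs_diff_nat:
  assumes "i \<le> n"
  shows "(\<Prod>j\<in>{..n} - {i}. \<bar>real i - real j\<bar>) = fact i * fact (n - i)"
proof -
  have "(\<Prod>j\<in>{..n} - {i}. \<bar>real i - real j\<bar>)
      = (\<Prod>j\<in>{..<i}. \<bar>real i - real j\<bar>) * (\<Prod>j\<in>{i<..n}. \<bar>real i - real j\<bar>)"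
    by (subst prod.union_disjoint[symmetric]) (use assms in \<open>auto intro!: prod.cong\<close>)
  also have "(\<Prod>j\<in>{..<i}. \<bar>real i - real j\<bar>) = (\<Prod>j\<in>{1..i}. real j)"
    by (rule prod.reindex_bij_witness[of _ "\<lambda>j. i - j" "\<lambda>j. i - j"]) (auto simp: of_nat_diff)
  also have "\<dots> = fact i" by (simp add: fact_prod)
  also have "(\<Prod>j\<in>{i<..n}. \<bar>real i - real j\<bar>) = (\<Prod>j\<in>{1..n-i}. real j)"
    by (rule prod.reindex_bij_witness[of _ "\<lambda>j. i + j" "\<lambda>j. j - i"]) (auto simp: of_nat_diff)
  also have "\<dots> = fact (n - i)" by (simp add: fact_prod)
  finally show ?thesis .
qed

text \<open>The weights are coefficients of the Lagrange basis. The node differences multiply to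
  \<open>(l / n) ^ n * (fact i * fact (n - i))\<close>; with
  \<open>fact n \<le> fact i * fact (n - i) * 2 ^ n\<close> and the previous Stirling-type bound the
  reciprocal is at most \<open>(2 * exp 1 / l) ^ n\<close>. The numerators contribute
  \<open>(1 + R + l) ^ n\<close>, all nodes having modulus at most \<open>R + l\<close>. For n = 0
  division by zero leaves the single node \<open>s\<close>.\<close>

lemma grid_weights_1d:
  assumes l: "0 < l" and s: "\<bar>s\<bar> \<le> R"
  shows "\<exists>w. (\<forall>k j. j \<le> n \<longrightarrow> (\<Sum>i\<le>n. w k i * (s + real i * l / real n) ^ j) = (if j = k then 1 else 0)) \<and>
             (\<forall>k. \<forall>i\<le>n. \<bar>w k i\<bar> \<le> ((1 + R + l) * (2 * exp 1 / l)) ^ n)"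
proof -
  define t where "t = (\<lambda>i. s + real i * l / real n)"
  have t: "inj_on t {..n}" using l by (auto simp: t_def inj_on_def)
  have t_le: "\<bar>t i\<bar> \<le> R + l" if "i \<le> n" for i
  proof -
    have "real i * l / real n \<le> l"
      using that l by (cases "n = 0") (auto simp: field_simps)
    moreover have "0 \<le> real i * l / real n" using l by simp
    ultimately show ?thesis using s by (simp add: t_def)
  qed
  have bd: "\<bar>poly.coeff (lagrange_basis n t i) k\<bar> \<le> ((1 + R + l) * (2 * exp 1 / l)) ^ n" if i: "i \<le> n" for i k
  proof -
    define den where "den = (\<Prod>j\<in>{..n} - {i}. t i - t j)"
    have "\<bar>den\<bar> = (\<Prod>j\<in>{..n} - {i}. l / real n * \<bar>real i - real j\<bar>)"
      unfolding den_def abs_prod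
    proof (intro prod.cong refl)
      fix j
      have "t i - t j = l / real n * (real i - real j)" by (simp add: t_def diff_divide_distrib algebra_simps)
      then show "\<bar>t i - t j\<bar> = l / real n * \<bar>real i - real j\<bar>" using l by (simp add: abs_mult)
    qed
    also have "\<dots> = (l / real n) ^ n * (fact i * fact (n - i))"
      using i by (simp add: prod.distrib prod_abs_diff_nat del: times_divide_eq_left)
    finally have den: "\<bar>den\<bar> = (l / real n) ^ n * (fact i * fact (n - i))" .
    have "real (n choose i) \<le> 2 ^ n"
      by (metis binomial_le_pow2 of_nat_le_iff of_nat_numeral of_nat_power)
    moreover have "fact n = fact i * fact (n - i) * real (n choose i)"
      using binomial_fact_lemma[OF i] by (metis of_nat_fact of_nat_mult)
    ultimately have "fact n \<le> (fact i * fact (n - i) :: real) * 2 ^ n" by simp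
    then have "real n ^ n \<le> exp 1 ^ n * ((fact i * fact (n - i)) * 2 ^ n)"
      using power_self_le_exp_fact[of n] by (meson mult_left_mono order_trans zero_le_power exp_ge_zero)
    then have "l ^ n * real n ^ n \<le> l ^ n * (exp 1 ^ n * ((fact i * fact (n - i)) * 2 ^ n))"
      using l by (intro mult_left_mono) auto
    then have "l ^ n \<le> (2 * exp 1) ^ n * \<bar>den\<bar>"
      unfolding den by (cases "n = 0") (auto simp: field_simps power_mult_distrib power_divide)
    moreover have d0: "\<bar>den\<bar> > 0" using t i by (auto simp: den_def inj_on_def)
    ultimately have inv: "1 / \<bar>den\<bar> \<le> (2 * exp 1 / l) ^ n"
      using l by (simp add: field_simps power_divide)
    have "\<bar>poly.coeff (\<Prod>j\<in>{..n} - {i}. [:- t j, 1:]) k\<bar> \<le> (\<Prod>j\<in>{..n} - {i}. 1 + \<bar>t j\<bar>)"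
      by (rule abs_coeff_prod_linear_le) simp
    also have "\<dots> \<le> (\<Prod>j\<in>{..n} - {i}. 1 + R + l)"
      by (intro prod_mono) (use t_le in fastforce)
    also have "\<dots> = (1 + R + l) ^ n" using i by simp
    finally have num: "\<bar>poly.coeff (\<Prod>j\<in>{..n} - {i}. [:- t j, 1:]) k\<bar> \<le> (1 + R + l) ^ n" .
    have "\<bar>poly.coeff (lagrange_basis n t i) k\<bar>
        = \<bar>poly.coeff (\<Prod>j\<in>{..n} - {i}. [:- t j, 1:]) k\<bar> * (1 / \<bar>den\<bar>)"
      by (simp add: lagrange_basis_def den_def abs_mult)
    also have "\<dots> \<le> (1 + R + l) ^ n * (2 * exp 1 / l) ^ n"
      by (intro mult_mono num inv) (use s l in auto)
    finally show ?thesis by (simp only: power_mult_distrib)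
  qed
  show ?thesis
    using sum_coeff_lagrange_basis[OF t] bd
    by (intro exI[of _ "\<lambda>k i. poly.coeff (lagrange_basis n t i) k"]) (auto simp: t_def)
qed

section \<open>Differentiation formulas on product grids\<close>

abbreviation grid :: "nat \<Rightarrow> ('n \<Rightarrow> nat) set" where
  "grid D \<equiv> PiE UNIV (\<lambda>_. {..D})"

lemma finite_grid: "finite (grid D :: ('n::finite \<Rightarrow> nat) set)"
  by (intro finite_PiE) auto

text \<open>The rules are tensor products of one-dimensional ones, so that exactness and the sum of
  the absolute weights both factor over the coordinates. The constant depends on \<open>R\<close>,
  \<open>l\<close> and the dimension but not on the base point \<open>s\<close>, which leaves the
  grid free to be translated. The D + 1 nodes per axis are paid for by \<open>2 ^ D\<close>.\<close>

lemma grid_weights: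
  fixes R l :: real
  assumes l: "0 < l"
  shows "\<exists>C\<ge>1. \<forall>D (s :: 'n::finite \<Rightarrow> real) \<beta>. (\<forall>i. \<bar>s i\<bar> \<le> R) \<longrightarrow>
    (\<exists>w. (\<forall>\<gamma>\<in>grid D. (\<Sum>\<iota>\<in>grid D. w \<iota> * (\<Prod>i\<in>UNIV. (s i + real (\<iota> i) * l / real D) ^ \<gamma> i))
                 = (if \<gamma> = \<beta> then 1 else 0)) \<and>
         (\<Sum>\<iota>\<in>grid D. \<bar>w \<iota>\<bar>) \<le> C ^ D)"
proof -
  define C1 where "C1 = (1 + \<bar>R\<bar> + l) * (2 * exp 1 / l)"
  \<comment> \<open>The maximum with 1 makes the final constant at least 1, so that its powers
    increase with the degree.\<close>
  define C2 where "C2 = max 1 C1"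
  have C1: "0 \<le> C1" using l by (simp add: C1_def)
  have C2: "1 \<le> C2" "C1 \<le> C2" by (auto simp: C2_def)
  show ?thesis
  proof (intro exI[of _ "(2 * C2) ^ CARD('n)"] conjI allI impI)
    show "1 \<le> (2 * C2) ^ CARD('n)" using C2 by (intro one_le_power) auto
  next
    fix D :: nat and s :: "'n \<Rightarrow> real" and \<beta> :: "'n \<Rightarrow> nat"
    assume s: "\<forall>i. \<bar>s i\<bar> \<le> R"
    have "\<forall>a. \<exists>w. (\<forall>k j. j \<le> D \<longrightarrow> (\<Sum>i\<le>D. w k i * (s a + real i * l / real D) ^ j) = (if j = k then 1 else 0)) \<and>
             (\<forall>k. \<forall>i\<le>D. \<bar>w k i\<bar> \<le> C1 ^ D)"
    proof
      fix a
      have "\<bar>s a\<bar> \<le> \<bar>R\<bar>" using spec[OF s, of a] by linarith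
      then show "\<exists>w. (\<forall>k j. j \<le> D \<longrightarrow> (\<Sum>i\<le>D. w k i * (s a + real i * l / real D) ^ j) = (if j = k then 1 else 0)) \<and>
             (\<forall>k. \<forall>i\<le>D. \<bar>w k i\<bar> \<le> C1 ^ D)"
        unfolding C1_def by (rule grid_weights_1d[OF l])
    qed
    from choice[OF this] obtain w where
      w: "\<And>a k j. j \<le> D \<Longrightarrow> (\<Sum>i\<le>D. w a k i * (s a + real i * l / real D) ^ j) = (if j = k then 1 else 0)"
      and wb: "\<And>a k i. i \<le> D \<Longrightarrow> \<bar>w a k i\<bar> \<le> C1 ^ D"
      by blast
    define W where "W = (\<lambda>\<iota>::'n \<Rightarrow> nat. \<Prod>a\<in>UNIV. w a (\<beta> a) (\<iota> a))"
    have "(\<Sum>\<iota>\<in>grid D. W \<iota> * (\<Prod>i\<in>UNIV. (s i + real (\<iota> i) * l / real D) ^ \<gamma> i)) = (if \<gamma> = \<beta> then 1 else 0)"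
      if g: "\<gamma> \<in> grid D" for \<gamma>
    proof -
      have "(\<Sum>\<iota>\<in>grid D. W \<iota> * (\<Prod>i\<in>UNIV. (s i + real (\<iota> i) * l / real D) ^ \<gamma> i))
        = (\<Sum>\<iota>\<in>grid D. \<Prod>a\<in>UNIV. w a (\<beta> a) (\<iota> a) * (s a + real (\<iota> a) * l / real D) ^ \<gamma> a)"
        by (simp add: W_def prod.distrib)
      also have "\<dots> = (\<Prod>a\<in>UNIV. \<Sum>i\<le>D. w a (\<beta> a) i * (s a + real i * l / real D) ^ \<gamma> a)"
        by (rule prod_sum_PiE[symmetric]) auto
      also have "\<dots> = (\<Prod>a\<in>UNIV. if \<gamma> a = \<beta> a then 1 else 0)"
        using g by (intro prod.cong w refl) auto
      also have "\<dots> = (if \<gamma> = \<beta> then 1 else 0)"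
        by (auto simp: fun_eq_iff)
      finally show ?thesis .
    qed
    moreover have "(\<Sum>\<iota>\<in>grid D. \<bar>W \<iota>\<bar>) \<le> ((2 * C2) ^ CARD('n)) ^ D"
    proof -
      have "(\<Sum>\<iota>\<in>grid D. \<bar>W \<iota>\<bar>) = (\<Prod>a\<in>UNIV. \<Sum>i\<le>D. \<bar>w a (\<beta> a) i\<bar>)"
        unfolding W_def abs_prod by (rule prod_sum_PiE[symmetric]) auto
      also have "\<dots> \<le> (\<Prod>a\<in>(UNIV :: 'n set). (2 * C2) ^ D)"
      proof (intro prod_mono conjI sum_nonneg)
        fix a
        have "(\<Sum>i\<le>D. \<bar>w a (\<beta> a) i\<bar>) \<le> (\<Sum>i\<le>D. C1 ^ D)"
          by (intro sum_mono wb) auto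
        also have "\<dots> = real (Suc D) * C1 ^ D" by simp
        also have "\<dots> \<le> 2 ^ D * C2 ^ D"
        proof (intro mult_mono power_mono)
          have "Suc D \<le> 2 ^ D" by (simp add: Suc_leI)
          then show "real (Suc D) \<le> 2 ^ D"
            by (metis of_nat_le_iff of_nat_numeral of_nat_power)
        qed (use C1 C2 in auto)
        finally show "(\<Sum>i\<le>D. \<bar>w a (\<beta> a) i\<bar>) \<le> (2 * C2) ^ D" by (simp only: power_mult_distrib)
      qed auto
      also have "\<dots> = ((2 * C2) ^ CARD('n)) ^ D"
        by (simp only: prod_constant power_mult[symmetric] mult.commute[of D])
      finally show ?thesis .
    qed
    ultimately show "\<exists>w. (\<forall>\<gamma>\<in>grid D. (\<Sum>\<iota>\<in>grid D. w \<iota> * (\<Prod>i\<in>UNIV. (s i + real (\<iota> i) * l / real D) ^ \<gamma> i))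
                 = (if \<gamma> = \<beta> then 1 else 0)) \<and>
         (\<Sum>\<iota>\<in>grid D. \<bar>w \<iota>\<bar>) \<le> ((2 * C2) ^ CARD('n)) ^ D"
      by blast
  qed
qed

section \<open>Feature expansions in reproducing kernel Hilbert spaces\<close>

context rkhs
begin

lemma ip_add_right: "f \<in> H \<Longrightarrow> g \<in> H \<Longrightarrow> h \<in> H \<Longrightarrow> ip h (\<lambda>x. f x + g x) = ip h f + ip h g"
  using ip_add_left[of f g h] ip_commute add_mem by metis

lemma ip_scale_right: "f \<in> H \<Longrightarrow> h \<in> H \<Longrightarrow> ip h (\<lambda>x. a * f x) = a * ip h f"
  using ip_scale_left[of f h a] ip_commute scale_mem by metis

lemma ip_zero_left: "f \<in> H \<Longrightarrow> ip (\<lambda>_. 0) f = 0"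
  using ip_scale_left[OF zero_mem, of f 0] by simp

lemma ip_Cauchy_Schwarz:
  assumes f: "f \<in> H" and g: "g \<in> H"
  shows "(ip f g)\<^sup>2 \<le> ip f f * ip g g"
proof (cases "ip g g = 0")
  case True
  then have "g = (\<lambda>_. 0)" by (rule ip_definite[OF g])
  then show ?thesis using ip_zero_left[OF f] ip_commute[OF f g] ip_nonneg[OF f] ip_nonneg[OF g] by simp
next
  case False
  then have pos: "ip g g > 0" using ip_nonneg[OF g] by simp
  define t where "t = - (ip f g / ip g g)"
  have tg: "(\<lambda>x. t * g x) \<in> H" by (rule scale_mem[OF g])
  have "0 \<le> ip (\<lambda>x. f x + t * g x) (\<lambda>x. f x + t * g x)"
    by (intro ip_nonneg add_mem f tg)
  also have "\<dots> = ip f f + 2 * t * ip f g + t\<^sup>2 * ip g g"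
    using f g tg add_mem[OF f tg] ip_commute[OF f g]
    by (simp add: ip_add_left ip_add_right ip_scale_left ip_scale_right power2_eq_square algebra_simps)
  finally have "0 \<le> ip f f + 2 * t * ip f g + t\<^sup>2 * ip g g" .
  moreover have "t * ip g g = - ip f g" using pos by (simp add: t_def)
  then have "t\<^sup>2 * ip g g = - t * ip f g" by (simp add: power2_eq_square mult.assoc)
  moreover have "t * ip f g * ip g g = - (ip f g)\<^sup>2"
    using pos by (simp add: t_def power2_eq_square)
  ultimately show ?thesis
    using mult_right_mono[of 0 "ip f f + t * ip f g" "ip g g"] pos by (simp add: algebra_simps)
qed

end

text \<open>A finite combination \<open>\<Sum>a\<^sub>j k(x\<^sub>j, \<cdot>)\<close> together with its coordinates
  \<open>\<Sum>a\<^sub>j \<phi>\<^sub>i(x\<^sub>j)\<close> in a feature expansion \<open>k(x, y) = \<Sum>\<^sub>i \<phi>\<^sub>i(x) \<phi>\<^sub>i(y)\<close>.\<close>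

inductive kcomb :: "('x \<Rightarrow> 'x \<Rightarrow> real) \<Rightarrow> ('i \<Rightarrow> 'x \<Rightarrow> real) \<Rightarrow> ('x \<Rightarrow> real) \<Rightarrow> ('i \<Rightarrow> real) \<Rightarrow> bool"
  for k \<phi> where
  zero: "kcomb k \<phi> (\<lambda>_. 0) (\<lambda>_. 0)"
| base: "kcomb k \<phi> (k x) (\<lambda>i. \<phi> i x)"
| add: "kcomb k \<phi> e u \<Longrightarrow> kcomb k \<phi> e' u' \<Longrightarrow> kcomb k \<phi> (\<lambda>y. e y + e' y) (\<lambda>i. u i + u' i)"
| scale: "kcomb k \<phi> e u \<Longrightarrow> kcomb k \<phi> (\<lambda>y. a * e y) (\<lambda>i. a * u i)"

lemma kcomb_sum:
  assumes "finite S" "\<And>s. s \<in> S \<Longrightarrow> kcomb k \<phi> (e s) (u s)"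
  shows "kcomb k \<phi> (\<lambda>y. \<Sum>s\<in>S. c s * e s y) (\<lambda>i. \<Sum>s\<in>S. c s * u s i)"
  using assms
proof (induction S rule: finite_induct)
  case (insert s S)
  then show ?case using kcomb.add[OF kcomb.scale[of k \<phi> "e s" "u s" "c s"]] by simp
qed (simp add: kcomb.zero)

lemma kcomb_diff:
  assumes "kcomb k \<phi> e u" "kcomb k \<phi> e' u'"
  shows "kcomb k \<phi> (\<lambda>y. e y - e' y) (\<lambda>i. u i - u' i)"
  using kcomb.add[OF assms(1) kcomb.scale[OF assms(2), of "-1"]] by simp

context rkhs
begin

context
  fixes \<phi> :: "'i \<Rightarrow> 'x \<Rightarrow> real"
  assumes features: "\<And>x y. ((\<lambda>i. \<phi> i x * \<phi> i y) has_sum k x y) UNIV"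
begin

lemma kcomb_mem: "kcomb k \<phi> e u \<Longrightarrow> e \<in> H"
  by (induction rule: kcomb.induct) (auto intro: zero_mem kernel_mem add_mem scale_mem)

lemma kcomb_eval: "kcomb k \<phi> e u \<Longrightarrow> ((\<lambda>i. u i * \<phi> i y) has_sum e y) UNIV"
proof (induction rule: kcomb.induct)
  case (scale e u a)
  then show ?case using has_sum_cmult_right[OF scale.IH, of a] by (simp add: mult.assoc)
next
  case (add e u e' u')
  then show ?case using has_sum_add[OF add.IH] by (simp add: algebra_simps)
qed (auto intro: features)

text \<open>By induction on the first combination: for a kernel section the reproducing property
  turns the inner product into an evaluation of the second combination, whose series is known.
  Coordinates thus carry the inner product of square summable families.\<close>

lemma kcomb_ip:
  assumes "kcomb k \<phi> e u" and e': "kcomb k \<phi> e' u'"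
  shows "((\<lambda>i. u i * u' i) has_sum ip e e') UNIV"
  using assms(1)
proof (induction rule: kcomb.induct)
  case zero
  then show ?case using ip_zero_left[OF kcomb_mem[OF e']] by simp
next
  case (base x)
  have "ip (k x) e' = e' x"
    using ip_commute[OF kernel_mem kcomb_mem[OF e']] reproducing[OF kcomb_mem[OF e']] by simp
  then show ?case using kcomb_eval[OF e', of x] by (simp add: mult.commute)
next
  case (add e u e2 u2)
  then show ?case
    using has_sum_add[OF add.IH] ip_add_left[of e e2 e'] kcomb_mem e' by (simp add: algebra_simps)
next
  case (scale e u a)
  then show ?case
    using has_sum_cmult_right[OF scale.IH, of a] ip_scale_left[of e e' a] kcomb_mem e'
    by (simp add: mult.assoc)
qed

lemma kcomb_ip_le:
  assumes h: "h \<in> H" and e: "kcomb k \<phi> e u"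
  shows "(ip h e)\<^sup>2 \<le> ip h h * (\<Sum>\<^sub>\<infinity>i. (u i)\<^sup>2)" and "(\<lambda>i. (u i)\<^sup>2) summable_on UNIV"
proof -
  have s: "((\<lambda>i. (u i)\<^sup>2) has_sum ip e e) UNIV"
    using kcomb_ip[OF e e] by (simp add: power2_eq_square)
  then have "(\<Sum>\<^sub>\<infinity>i. (u i)\<^sup>2) = ip e e" by (rule infsumI)
  then show "(ip h e)\<^sup>2 \<le> ip h h * (\<Sum>\<^sub>\<infinity>i. (u i)\<^sup>2)"
    using ip_Cauchy_Schwarz[OF h kcomb_mem[OF e]] by simp
  show "(\<lambda>i. (u i)\<^sup>2) summable_on UNIV" using s by (rule has_sum_imp_summable)
qed

lemma ip_sum_right:
  assumes "finite S" "\<And>s. s \<in> S \<Longrightarrow> e s \<in> H" "h \<in> H"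
  shows "(\<lambda>y. \<Sum>s\<in>S. c s * e s y) \<in> H \<and> ip h (\<lambda>y. \<Sum>s\<in>S. c s * e s y) = (\<Sum>s\<in>S. c s * ip h (e s))"
  using assms
proof (induction S rule: finite_induct)
  case empty
  then show ?case using ip_commute[OF \<open>h \<in> H\<close> zero_mem] ip_zero_left[of h] zero_mem by simp
next
  case (insert s S)
  then show ?case
    using ip_add_right[of "\<lambda>y. c s * e s y" "\<lambda>y. \<Sum>s\<in>S. c s * e s y" h]
      ip_scale_right[of "e s" h "c s"] scale_mem[of "e s" "c s"] add_mem by simp
qed

end

end

lemma has_sum_sum:
  fixes f :: "'a \<Rightarrow> 'b \<Rightarrow> 'c::topological_comm_monoid_add"
  assumes "finite S" "\<And>s. s \<in> S \<Longrightarrow> (f s has_sum t s) A"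
  shows "((\<lambda>x. \<Sum>s\<in>S. f s x) has_sum (\<Sum>s\<in>S. t s)) A"
  using assms by (induction S rule: finite_induct) (auto intro: has_sum_add)

lemma square_add_le: "(a + b)\<^sup>2 \<le> 2 * a\<^sup>2 + 2 * (b::real)\<^sup>2"
  using sum_squares_ge_zero[of "a - b" 0] by (simp add: power2_eq_square algebra_simps)

text \<open>All tail estimates below are used in this form and then composed with a concrete
  exhausting family: grids, initial segments of the enumeration, or squares of index pairs.\<close>

lemma infsum_Compl_tendsto_0:
  fixes f :: "'a \<Rightarrow> real"
  assumes f: "f summable_on UNIV"
  shows "((\<lambda>S. infsum f (- S)) \<longlongrightarrow> 0) (finite_subsets_at_top UNIV)"
proof -
  have "((\<lambda>S. infsum f UNIV - sum f S) \<longlongrightarrow> infsum f UNIV - infsum f UNIV) (finite_subsets_at_top UNIV)"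
    by (intro tendsto_diff tendsto_const infsum_tendsto f)
  moreover have "infsum f (- S) = infsum f UNIV - sum f S" if "finite S" for S
  proof -
    have "infsum f (S \<union> - S) = infsum f S + infsum f (- S)"
      using that summable_on_subset[OF f] by (intro infsum_Un_disjoint) auto
    then show ?thesis using that by simp
  qed
  then have "\<forall>\<^sub>F S in finite_subsets_at_top UNIV. infsum f UNIV - sum f S = infsum f (- S)"
    by (intro eventually_finite_subsets_at_top_weakI) auto
  ultimately show ?thesis by (simp add: tendsto_cong)
qed

context rkhs
begin

text \<open>By Cauchy--Schwarz, \<open>\<ell>\<^sup>2\<close>-convergence of the coordinates of finite combinations of kernel
  sections gives convergence of their inner products with \<open>h\<close>; hence the features themselves need not
  be shown to lie in \<open>H\<close>.\<close>

lemma feature_expansion: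
  fixes \<phi> :: "'i \<Rightarrow> 'x \<Rightarrow> real"
  assumes features: "\<And>x y. ((\<lambda>i. \<phi> i x * \<phi> i y) has_sum k x y) UNIV"
  assumes approx: "\<And>i. \<exists>e u. (\<forall>n::nat. kcomb k \<phi> (e n) (u n)) \<and>
      (\<lambda>n. \<Sum>\<^sub>\<infinity>j. (u n j - (if j = i then 1 else 0))\<^sup>2) \<longlonglongrightarrow> 0"
  assumes h: "h \<in> H"
  shows "\<exists>a B. (\<forall>i. \<bar>a i\<bar> \<le> B) \<and> (\<forall>x. ((\<lambda>i. a i * \<phi> i x) has_sum h x) UNIV)"
proof -
  define \<delta> :: "'i \<Rightarrow> 'i \<Rightarrow> real" where "\<delta> = (\<lambda>i j. if j = i then 1 else 0)"
  have "\<forall>i. \<exists>p. (\<forall>n::nat. kcomb k \<phi> (fst p n) (snd p n)) \<and>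
      (\<lambda>n. \<Sum>\<^sub>\<infinity>j. (snd p n j - \<delta> i j)\<^sup>2) \<longlonglongrightarrow> 0"
    using approx unfolding \<delta>_def split_paired_Ex fst_conv snd_conv by blast
  from choice[OF this] obtain p where
    p: "\<And>i n. kcomb k \<phi> (fst (p i) n) (snd (p i) n)"
      "\<And>i. (\<lambda>n. \<Sum>\<^sub>\<infinity>j. (snd (p i) n j - \<delta> i j)\<^sup>2) \<longlonglongrightarrow> 0" by blast
  define e where "e = (\<lambda>i. fst (p i))"
  define u where "u = (\<lambda>i. snd (p i))"
  have e: "kcomb k \<phi> (e i n) (u i n)" and u: "(\<lambda>n. \<Sum>\<^sub>\<infinity>j. (u i n j - \<delta> i j)\<^sup>2) \<longlonglongrightarrow> 0" for i n
    using p by (simp_all add: e_def u_def)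
  define \<tau> where "\<tau> = (\<lambda>i n. \<Sum>\<^sub>\<infinity>j. (u i n j - \<delta> i j)\<^sup>2)"
  define N where "N = ip h h"
  have N: "0 \<le> N" using ip_nonneg[OF h] by (simp add: N_def)
  have \<delta>s: "((\<lambda>j. (\<delta> i j)\<^sup>2) has_sum 1) UNIV" for i
    using has_sum_finite_neutralI[of "{i}" UNIV "\<lambda>j. (\<delta> i j)\<^sup>2" 1] by (auto simp: \<delta>_def)
  have us: "(\<lambda>j. (u i n j)\<^sup>2) summable_on UNIV" for i n
    using kcomb_ip_le(2)[OF features h e] .
  have ds: "(\<lambda>j. (u i n j - \<delta> i j)\<^sup>2) summable_on UNIV" for i n
  proof (rule summable_on_comparison_test)
    show "(\<lambda>j. 2 * (u i n j)\<^sup>2 + 2 * (\<delta> i j)\<^sup>2) summable_on UNIV"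
      by (intro summable_on_add summable_on_cmult_right us has_sum_imp_summable[OF \<delta>s])
    show "(u i n j - \<delta> i j)\<^sup>2 \<le> 2 * (u i n j)\<^sup>2 + 2 * (\<delta> i j)\<^sup>2" for j
      using square_add_le[of "u i n j" "- \<delta> i j"] by simp
  qed auto
  have \<tau>0: "0 \<le> \<tau> i n" for i n unfolding \<tau>_def by (intro infsum_nonneg) auto
  \<comment> \<open>The difference of two approximants is again a combination of kernel sections;
    its coordinates are compared with the unit vector \<open>\<delta> i\<close> in between.\<close>
  have diff: "(ip h (e i m) - ip h (e i n))\<^sup>2 \<le> N * (2 * \<tau> i m + 2 * \<tau> i n)" for i m n
  proof -
    have comb: "kcomb k \<phi> (\<lambda>y. e i m y - e i n y) (\<lambda>j. u i m j - u i n j)"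
      by (intro kcomb_diff e)
    have H: "e i m \<in> H" "e i n \<in> H" using e kcomb_mem[OF features] by auto
    have "ip h (\<lambda>y. e i m y - e i n y) = ip h (e i m) - ip h (e i n)"
      using ip_add_right[OF H(1) scale_mem[OF H(2), of "-1"] h] ip_scale_right[OF H(2) h, of "-1"]
      by simp
    then have "(ip h (e i m) - ip h (e i n))\<^sup>2 \<le> N * (\<Sum>\<^sub>\<infinity>j. (u i m j - u i n j)\<^sup>2)"
      using kcomb_ip_le(1)[OF features h comb] by (simp add: N_def)
    also have "(\<Sum>\<^sub>\<infinity>j. (u i m j - u i n j)\<^sup>2)
        \<le> (\<Sum>\<^sub>\<infinity>j. 2 * (u i m j - \<delta> i j)\<^sup>2 + 2 * (u i n j - \<delta> i j)\<^sup>2)"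
    proof (intro infsum_mono kcomb_ip_le(2)[OF features h comb] summable_on_add summable_on_cmult_right ds)
      fix j
      show "(u i m j - u i n j)\<^sup>2 \<le> 2 * (u i m j - \<delta> i j)\<^sup>2 + 2 * (u i n j - \<delta> i j)\<^sup>2"
        using square_add_le[of "u i m j - \<delta> i j" "- (u i n j - \<delta> i j)"] by (simp only: power2_minus) simp
    qed
    also have "\<dots> = 2 * \<tau> i m + 2 * \<tau> i n"
      unfolding \<tau>_def
      by (subst infsum_add) (auto intro!: summable_on_cmult_right ds simp: infsum_cmult_right ds)
    finally show ?thesis by this (erule mult_left_mono, rule N)
  qed
  have conv: "convergent (\<lambda>n. ip h (e i n))" for i
  proof -
    have "Cauchy (\<lambda>n. ip h (e i n))"
    proof (rule metric_CauchyI)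
      fix \<epsilon> :: real assume \<epsilon>: "0 < \<epsilon>"
      have "(\<lambda>n. N * \<tau> i n) \<longlonglongrightarrow> N * 0" unfolding \<tau>_def by (intro tendsto_intros u)
      then have "\<forall>\<^sub>F n in sequentially. N * \<tau> i n < \<epsilon>\<^sup>2 / 4"
        using \<epsilon> by (intro order_tendstoD) auto
      then obtain M where M: "\<And>n. n \<ge> M \<Longrightarrow> N * \<tau> i n < \<epsilon>\<^sup>2 / 4"
        by (auto simp: eventually_sequentially)
      show "\<exists>M. \<forall>m\<ge>M. \<forall>n\<ge>M. dist (ip h (e i m)) (ip h (e i n)) < \<epsilon>"
      proof (intro exI allI impI)
        fix m n assume "M \<le> m" "M \<le> n"
        then have "(ip h (e i m) - ip h (e i n))\<^sup>2 < \<epsilon>\<^sup>2"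
          using diff[of i m n] M[of m] M[of n] by (simp add: algebra_simps)
        then show "dist (ip h (e i m)) (ip h (e i n)) < \<epsilon>"
          using \<epsilon> power2_less_imp_less[of "\<bar>ip h (e i m) - ip h (e i n)\<bar>" \<epsilon>] by (simp add: dist_real_def)
      qed
    qed
    then show ?thesis by (rule real_Cauchy_convergent)
  qed
  \<comment> \<open>Stands for the inner product of \<open>h\<close> with the feature
    \<open>\<phi> i\<close>.\<close>
  define a where "a = (\<lambda>i. lim (\<lambda>n. ip h (e i n)))"
  have a: "(\<lambda>n. ip h (e i n)) \<longlonglongrightarrow> a i" for i
    using conv[of i] by (simp add: a_def convergent_LIMSEQ_iff)
  \<comment> \<open>The factor 2 comes from \<open>square_add_le\<close>, which replaces the
    triangle inequality for square summable families; only uniformity in \<open>i\<close>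
    matters.\<close>
  have a_le: "(a i)\<^sup>2 \<le> 2 * N" for i
  proof (rule LIMSEQ_le)
    show "(\<lambda>n. (ip h (e i n))\<^sup>2) \<longlonglongrightarrow> (a i)\<^sup>2" by (intro tendsto_intros a)
    show "(\<lambda>n. N * (2 * \<tau> i n + 2)) \<longlonglongrightarrow> 2 * N"
      using tendsto_mult[OF tendsto_const[of N] tendsto_add[OF tendsto_mult[OF tendsto_const[of 2] u[of i]] tendsto_const[of 2]]]
      by (simp add: \<tau>_def mult.commute)
    have "(ip h (e i n))\<^sup>2 \<le> N * (2 * \<tau> i n + 2)" for n
    proof -
      have "(\<Sum>\<^sub>\<infinity>j. (u i n j)\<^sup>2) \<le> (\<Sum>\<^sub>\<infinity>j. 2 * (u i n j - \<delta> i j)\<^sup>2 + 2 * (\<delta> i j)\<^sup>2)"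
      proof (intro infsum_mono us summable_on_add summable_on_cmult_right ds has_sum_imp_summable[OF \<delta>s])
        fix j
        show "(u i n j)\<^sup>2 \<le> 2 * (u i n j - \<delta> i j)\<^sup>2 + 2 * (\<delta> i j)\<^sup>2"
          using square_add_le[of "u i n j - \<delta> i j" "\<delta> i j"] by (simp only: diff_add_cancel)
      qed
      also have "\<dots> = 2 * \<tau> i n + 2"
        unfolding \<tau>_def using infsumI[OF \<delta>s]
        by (subst infsum_add)
          (auto intro!: summable_on_cmult_right ds has_sum_imp_summable[OF \<delta>s]
            simp: infsum_cmult_right ds has_sum_imp_summable[OF \<delta>s])
      finally have "N * (\<Sum>\<^sub>\<infinity>j. (u i n j)\<^sup>2) \<le> N * (2 * \<tau> i n + 2)" using N by (rule mult_left_mono)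
      then show ?thesis using kcomb_ip_le(1)[OF features h e, of i n] unfolding N_def by linarith
    qed
    then show "\<exists>M. \<forall>n\<ge>M. (ip h (e i n))\<^sup>2 \<le> N * (2 * \<tau> i n + 2)" by blast
  qed
  \<comment> \<open>The section \<open>k x\<close> is compared with the combination of the
    \<open>e i n\<close>, \<open>i \<in> S\<close>, with coefficients \<open>\<phi> i x\<close>. In
    the limit of large n the remaining coordinates are those of \<open>k x\<close> outside
    \<open>S\<close>, and their squares form a tail of the series for \<open>k x x\<close>.\<close>
  have approx_err: "(h x - (\<Sum>i\<in>S. a i * \<phi> i x))\<^sup>2 \<le> 2 * N * (\<Sum>\<^sub>\<infinity>j\<in>- S. (\<phi> j x)\<^sup>2)"
    if S: "finite S" for S x
  proof -
    have \<phi>s: "(\<lambda>j. (\<phi> j x)\<^sup>2) summable_on UNIV"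
      using has_sum_imp_summable[OF features[of x x]] by (simp add: power2_eq_square)
    define T where "T = (\<Sum>\<^sub>\<infinity>j\<in>- S. (\<phi> j x)\<^sup>2)"
    have Ts: "((\<lambda>j. if j \<in> S then 0 else (\<phi> j x)\<^sup>2) has_sum T) UNIV"
    proof -
      have "((\<lambda>j. (\<phi> j x)\<^sup>2) has_sum T) (- S)"
        unfolding T_def by (intro has_sum_infsum summable_on_subset[OF \<phi>s]) auto
      moreover have "((\<lambda>j. (\<phi> j x)\<^sup>2) has_sum T) (- S) \<longleftrightarrow>
          ((\<lambda>j. if j \<in> S then 0 else (\<phi> j x)\<^sup>2) has_sum T) UNIV"
        by (rule has_sum_cong_neutral) auto
      ultimately show ?thesis by blast
    qed
    have bound: "(h x - (\<Sum>i\<in>S. \<phi> i x * ip h (e i n)))\<^sup>2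
        \<le> N * (2 * T + 2 * real (card S) * (\<Sum>i\<in>S. (\<phi> i x)\<^sup>2 * \<tau> i n))" for n
    proof -
      define E where "E = (\<lambda>y. k x y - (\<Sum>i\<in>S. \<phi> i x * e i n y))"
      define V where "V = (\<lambda>j. \<phi> j x - (\<Sum>i\<in>S. \<phi> i x * u i n j))"
      have comb: "kcomb k \<phi> E V"
        unfolding E_def V_def by (intro kcomb_diff kcomb.base kcomb_sum S e)
      have eH: "e i n \<in> H" for i using e kcomb_mem[OF features] by blast
      have sumH: "(\<lambda>y. \<Sum>i\<in>S. \<phi> i x * e i n y) \<in> H"
        and ips: "ip h (\<lambda>y. \<Sum>i\<in>S. \<phi> i x * e i n y) = (\<Sum>i\<in>S. \<phi> i x * ip h (e i n))"
        using ip_sum_right[OF features S, of "\<lambda>i. e i n" h "\<lambda>i. \<phi> i x"] eH h by auto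
      have "ip h E = h x - (\<Sum>i\<in>S. \<phi> i x * ip h (e i n))"
        unfolding E_def
        using ip_add_right[OF kernel_mem[of x] scale_mem[OF sumH, of "-1"] h] ip_scale_right[OF sumH h, of "-1"]
          reproducing[OF h] ips by simp
      then have "(h x - (\<Sum>i\<in>S. \<phi> i x * ip h (e i n)))\<^sup>2 \<le> N * (\<Sum>\<^sub>\<infinity>j. (V j)\<^sup>2)"
        using kcomb_ip_le(1)[OF features h comb] by (simp add: N_def)
      also have "(\<Sum>\<^sub>\<infinity>j. (V j)\<^sup>2) \<le> 2 * T + 2 * real (card S) * (\<Sum>i\<in>S. (\<phi> i x)\<^sup>2 * \<tau> i n)"
      proof -
        \<comment> \<open>The majorant separates the part outside \<open>S\<close>, which does not
          depend on n, from the approximation errors, which vanish as n grows.\<close>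
        define W where "W = (\<lambda>j. 2 * (if j \<in> S then 0 else (\<phi> j x)\<^sup>2)
            + 2 * real (card S) * (\<Sum>i\<in>S. (\<phi> i x)\<^sup>2 * (u i n j - \<delta> i j)\<^sup>2))"
        have W: "(W has_sum (2 * T + 2 * real (card S) * (\<Sum>i\<in>S. (\<phi> i x)\<^sup>2 * \<tau> i n))) UNIV"
          unfolding W_def \<tau>_def
          by (intro has_sum_add has_sum_cmult_right Ts has_sum_sum has_sum_infsum ds S)
        have "(V j)\<^sup>2 \<le> W j" for j
        proof -
          have "V j = (if j \<in> S then 0 else \<phi> j x) - (\<Sum>i\<in>S. \<phi> i x * (u i n j - \<delta> i j))"
            using S by (simp add: V_def \<delta>_def right_diff_distrib sum_subtractf if_distrib[of "(*) _"] cong: if_cong)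
          also have "(\<dots>)\<^sup>2 \<le> 2 * (if j \<in> S then 0 else \<phi> j x)\<^sup>2 + 2 * (\<Sum>i\<in>S. \<phi> i x * (u i n j - \<delta> i j))\<^sup>2"
            using square_add_le[of "if j \<in> S then 0 else \<phi> j x" "- (\<Sum>i\<in>S. \<phi> i x * (u i n j - \<delta> i j))"]
            by simp
          also have "(\<Sum>i\<in>S. \<phi> i x * (u i n j - \<delta> i j))\<^sup>2
              \<le> (\<Sum>i\<in>S. (\<phi> i x * (u i n j - \<delta> i j))\<^sup>2) * real (card S)"
            using Cauchy_Schwarz_ineq_sum[of "\<lambda>i. \<phi> i x * (u i n j - \<delta> i j)" "\<lambda>_. 1" S] by simp
          finally show ?thesis by (simp add: W_def power_mult_distrib mult_ac split: if_splits)
        qed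
        then show ?thesis
          using has_sum_mono[OF has_sum_infsum[OF kcomb_ip_le(2)[OF features h comb]] W] by blast
      qed
      finally show ?thesis by this (erule mult_left_mono, rule N)
    qed
    have "(h x - (\<Sum>i\<in>S. \<phi> i x * a i))\<^sup>2 \<le> N * (2 * T + 2 * real (card S) * (\<Sum>i\<in>S. (\<phi> i x)\<^sup>2 * 0))"
    proof (rule LIMSEQ_le)
      show "(\<lambda>n. (h x - (\<Sum>i\<in>S. \<phi> i x * ip h (e i n)))\<^sup>2) \<longlonglongrightarrow> (h x - (\<Sum>i\<in>S. \<phi> i x * a i))\<^sup>2"
        by (intro tendsto_intros a)
      show "(\<lambda>n. N * (2 * T + 2 * real (card S) * (\<Sum>i\<in>S. (\<phi> i x)\<^sup>2 * \<tau> i n)))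
          \<longlonglongrightarrow> N * (2 * T + 2 * real (card S) * (\<Sum>i\<in>S. (\<phi> i x)\<^sup>2 * 0))"
        unfolding \<tau>_def by (intro tendsto_intros u)
      show "\<exists>M. \<forall>n\<ge>M. (h x - (\<Sum>i\<in>S. \<phi> i x * ip h (e i n)))\<^sup>2
        \<le> N * (2 * T + 2 * real (card S) * (\<Sum>i\<in>S. (\<phi> i x)\<^sup>2 * \<tau> i n))" using bound by blast
    qed
    then show ?thesis by (simp add: T_def mult_ac)
  qed
  have "((\<lambda>i. a i * \<phi> i x) has_sum h x) UNIV" for x
  proof -
    have \<phi>s: "(\<lambda>j. (\<phi> j x)\<^sup>2) summable_on UNIV"
      using has_sum_imp_summable[OF features[of x x]] by (simp add: power2_eq_square)
    have "((\<lambda>S. 2 * N * (\<Sum>\<^sub>\<infinity>j\<in>- S. (\<phi> j x)\<^sup>2)) \<longlongrightarrow> 2 * N * 0) (finite_subsets_at_top UNIV)"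
      by (intro tendsto_intros infsum_Compl_tendsto_0 \<phi>s)
    then have lim: "((\<lambda>S. 2 * N * (\<Sum>\<^sub>\<infinity>j\<in>- S. (\<phi> j x)\<^sup>2)) \<longlongrightarrow> 0) (finite_subsets_at_top UNIV)"
      by simp
    have "((\<lambda>S. (h x - (\<Sum>i\<in>S. a i * \<phi> i x))\<^sup>2) \<longlongrightarrow> 0) (finite_subsets_at_top UNIV)"
      by (rule tendsto_sandwich[OF _ _ tendsto_const lim])
        (auto intro!: eventually_finite_subsets_at_top_weakI approx_err)
    then have "((\<lambda>S. sqrt ((h x - (\<Sum>i\<in>S. a i * \<phi> i x))\<^sup>2)) \<longlongrightarrow> sqrt 0) (finite_subsets_at_top UNIV)"
      by (intro tendsto_intros)
    then have "((\<lambda>S. h x - (\<Sum>i\<in>S. a i * \<phi> i x)) \<longlongrightarrow> 0) (finite_subsets_at_top UNIV)"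
      by (simp add: tendsto_rabs_zero_iff)
    then have "((\<lambda>S. h x - (h x - (\<Sum>i\<in>S. a i * \<phi> i x))) \<longlongrightarrow> h x - 0) (finite_subsets_at_top UNIV)"
      by (intro tendsto_intros)
    then show ?thesis by (simp add: has_sum_def)
  qed
  moreover have "\<bar>a i\<bar> \<le> sqrt (2 * N)" for i
    by (rule real_le_rsqrt) (use a_le[of i] in simp)
  ultimately show ?thesis by blast
qed

end

section \<open>Power series expansions of the kernels\<close>

text \<open>Coordinates centred at \<open>x0\<close> and scaled by \<open>\<sigma>\<close>; in them
  the scaled monomials become plain monomials and every kernel formula loses its powers of
  \<open>\<sigma>\<close>.\<close>

definition zcoord :: "real \<Rightarrow> real ^ 'n::finite \<Rightarrow> real ^ 'n \<Rightarrow> 'n \<Rightarrow> real" where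
  "zcoord \<sigma> x0 x l = (x $ l - x0 $ l) / \<sigma>"

definition mon :: "('n::finite \<Rightarrow> real) \<Rightarrow> ('n \<Rightarrow> nat) \<Rightarrow> real" where
  "mon z a = (\<Prod>l\<in>UNIV. z l ^ a l)"

definition weight :: "kernel_kind \<Rightarrow> real \<Rightarrow> real ^ 'n::finite \<Rightarrow> real ^ 'n \<Rightarrow> real" where
  "weight \<kappa> \<sigma> x0 x =
     (case \<kappa> of Exponential \<Rightarrow> 1 | Gaussian \<Rightarrow> exp (- (norm (x - x0))\<^sup>2 / (2 * \<sigma>\<^sup>2)))"

lemma weight_pos: "0 < weight \<kappa> \<sigma> x0 x" and weight_le_1: "weight \<kappa> \<sigma> x0 x \<le> 1"
  by (cases \<kappa>; simp add: weight_def)+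

lemma scaled_monomial_eq: "scaled_monomial \<sigma> x0 a x = mon (zcoord \<sigma> x0 x) a"
  by (simp add: scaled_monomial_def mon_def zcoord_def power_divide prod_dividef power_sum)

lemma feature_eq: "feature \<kappa> \<sigma> x0 a x = weight \<kappa> \<sigma> x0 x * mon (zcoord \<sigma> x0 x) a"
  by (cases \<kappa>) (simp_all add: weight_def scaled_monomial_eq)

lemma mon_mult: "mon (\<lambda>l. y l * z l) a = mon y a * mon z a"
  by (simp add: mon_def power_mult_distrib prod.distrib)

lemma mon_add: "mon z (\<lambda>l. a l + b l) = mon z a * mon z b"
  by (simp add: mon_def power_add prod.distrib)

lemma mon_const: "mon (\<lambda>_. R) a = R ^ sum a UNIV"
  by (simp add: mon_def power_sum)

lemma abs_mon_le:
  assumes "\<And>l. \<bar>z l\<bar> \<le> R"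
  shows "\<bar>mon z a\<bar> \<le> R ^ sum a UNIV"
proof -
  have "\<bar>mon z a\<bar> \<le> (\<Prod>l\<in>UNIV. R ^ a l)"
    unfolding mon_def abs_prod power_abs by (intro prod_mono) (auto intro: power_mono assms)
  then show ?thesis by (simp add: power_sum)
qed

lemma multi_fact_pos: "0 < multi_fact a"
  by (simp add: multi_fact_def prod_pos)

lemma has_sum_multi_index_prod:
  fixes f :: "'n::finite \<Rightarrow> nat \<Rightarrow> real"
  assumes "\<And>l. (\<lambda>k. \<bar>f l k\<bar>) summable_on UNIV"
  shows "((\<lambda>a. \<Prod>l\<in>UNIV. f l (a l)) has_sum (\<Prod>l\<in>UNIV. infsum (f l) UNIV)) UNIV"
proof -
  have *: "Infinite_Set_Sum.abs_summable_on (f l) UNIV" for l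
    using assms[of l] by (subst abs_summable_equivalent[symmetric]) simp
  have "Infinite_Set_Sum.abs_summable_on (\<lambda>a. \<Prod>l\<in>UNIV. f l (a l)) (PiE UNIV (\<lambda>_. UNIV))"
    by (rule Infinite_Set_Sum.abs_summable_on_prod_PiE) (use * in auto)
  then have "(\<lambda>a. norm (\<Prod>l\<in>UNIV. f l (a l))) summable_on (PiE UNIV (\<lambda>_. UNIV))"
    by (subst abs_summable_equivalent)
  then have "(\<lambda>a. norm (\<Prod>l\<in>UNIV. f l (a l))) summable_on UNIV"
    by (simp only: PiE_UNIV_domain) (simp add: Pi_def)
  then have s: "(\<lambda>a. \<Prod>l\<in>UNIV. f l (a l)) summable_on UNIV"
    by (rule abs_summable_summable)
  have "infsum (\<lambda>a. \<Prod>l\<in>UNIV. f l (a l)) (PiE UNIV (\<lambda>_. UNIV)) = (\<Prod>l\<in>UNIV. infsum (f l) UNIV)"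
    by (rule infsum_prod_PiE_abs) (use assms in auto)
  then show ?thesis using has_sum_infsum[OF s] by simp
qed

lemma exp_has_sum:
  fixes t :: real
  shows "((\<lambda>k. t ^ k / fact k) has_sum exp t) UNIV" and "(\<lambda>k. \<bar>t ^ k / fact k\<bar>) summable_on UNIV"
proof -
  have *: "summable (\<lambda>k. \<bar>t ^ k / fact k\<bar>)"
    using summable_norm_exp[of t] by (simp add: field_simps)
  moreover have "(\<lambda>k. t ^ k / fact k) sums exp t"
    using exp_converges[of t] by (simp add: field_simps)
  ultimately show "((\<lambda>k. t ^ k / fact k) has_sum exp t) UNIV"
    by (intro norm_summable_imp_has_sum) auto
  show "(\<lambda>k. \<bar>t ^ k / fact k\<bar>) summable_on UNIV"
    using * by (intro norm_summable_imp_summable_on) auto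
qed

lemma mon_div_multi_fact: "mon t a / multi_fact a = (\<Prod>l\<in>UNIV. t l ^ a l / fact (a l))"
  by (simp add: mon_def multi_fact_def prod_dividef)

lemma has_sum_multi_exp: "((\<lambda>a. mon t a / multi_fact a) has_sum exp (sum t UNIV)) UNIV"
  using has_sum_multi_index_prod[of "\<lambda>l k. t l ^ k / fact k", OF exp_has_sum(2)]
  by (simp add: mon_div_multi_fact infsumI[OF exp_has_sum(1)] exp_sum)

lemma zcoord_inner:
  fixes x y :: "real ^ 'n::finite"
  shows "(\<Sum>l\<in>UNIV. zcoord \<sigma> x0 x l * zcoord \<sigma> x0 y l) = inner (x - x0) (y - x0) / \<sigma>\<^sup>2"
  by (simp add: zcoord_def inner_vec_def sum_divide_distrib power2_eq_square)

text \<open>Expanding the squared distance around \<open>x0\<close> splits the Gaussian kernel into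
  two one-point factors and the exponential kernel, so one expansion serves both.\<close>

lemma kernel_fun_eq:
  "kernel_fun \<kappa> \<sigma> x0 x y
    = weight \<kappa> \<sigma> x0 x * weight \<kappa> \<sigma> x0 y * exp (\<Sum>l\<in>UNIV. zcoord \<sigma> x0 x l * zcoord \<sigma> x0 y l)"
proof (cases \<kappa>)
  case Exponential
  then show ?thesis by (simp add: weight_def zcoord_inner)
next
  case Gaussian
  have "(norm (x - y))\<^sup>2 = (norm (x - x0))\<^sup>2 + (norm (y - x0))\<^sup>2 - 2 * inner (x - x0) (y - x0)"
    by (simp add: power2_norm_eq_inner algebra_simps inner_commute)
  then have "- (norm (x - y))\<^sup>2 / (2 * \<sigma>\<^sup>2)
      = - (norm (x - x0))\<^sup>2 / (2 * \<sigma>\<^sup>2) + - (norm (y - x0))\<^sup>2 / (2 * \<sigma>\<^sup>2) + inner (x - x0) (y - x0) / \<sigma>\<^sup>2"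
    by (simp add: diff_divide_distrib add_divide_distrib)
  then show ?thesis using Gaussian by (simp add: weight_def zcoord_inner mult_exp_exp)
qed

text \<open>This is the exponential series in several variables, with the factor 1/a! split evenly
  between the two points.\<close>

lemma kernel_fun_expansion:
  "((\<lambda>a. (feature \<kappa> \<sigma> x0 a x / sqrt (multi_fact a)) * (feature \<kappa> \<sigma> x0 a y / sqrt (multi_fact a)))
      has_sum kernel_fun \<kappa> \<sigma> x0 x y) UNIV"
proof -
  have "((\<lambda>a. weight \<kappa> \<sigma> x0 x * weight \<kappa> \<sigma> x0 y *
      (mon (\<lambda>l. zcoord \<sigma> x0 x l * zcoord \<sigma> x0 y l) a / multi_fact a)) has_sum kernel_fun \<kappa> \<sigma> x0 x y) UNIV"
    unfolding kernel_fun_eq by (intro has_sum_cmult_right has_sum_multi_exp)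
  moreover have "sqrt (multi_fact a) * sqrt (multi_fact a) = multi_fact a" for a :: "'a \<Rightarrow> nat"
    using multi_fact_pos[of a] by simp
  ultimately show ?thesis by (simp add: feature_eq mon_mult mult_ac)
qed

text \<open>The term is the product of \<open>\<bar>2 * R\<bar> ^ k / sqrt (fact k)\<close> and
  \<open>(1 / 2) ^ k\<close>, hence at most the sum of their squares: a term of an exponential
  series plus a term of a geometric one.\<close>

lemma summable_power_over_sqrt_fact:
  fixes R :: real
  shows "(\<lambda>k. \<bar>R ^ k / sqrt (fact k)\<bar>) summable_on UNIV"
proof (rule summable_on_comparison_test)
  have "(\<lambda>k. (4 * R\<^sup>2) ^ k / fact k) summable_on UNIV"
    by (rule has_sum_imp_summable[OF exp_has_sum(1)])
  moreover have "(\<lambda>k. (1 / 4 :: real) ^ k) summable_on UNIV"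
    by (intro norm_summable_imp_summable_on) (simp add: summable_geometric)
  ultimately show "(\<lambda>k. (4 * R\<^sup>2) ^ k / fact k + (1 / 4) ^ k) summable_on UNIV"
    by (rule summable_on_add)
  show "\<bar>R ^ k / sqrt (fact k)\<bar> \<le> (4 * R\<^sup>2) ^ k / fact k + (1 / 4) ^ k" for k
  proof -
    define p q where "p = \<bar>2 * R\<bar> ^ k / sqrt (fact k)" and "q = (1 / 2 :: real) ^ k"
    have "p * q = \<bar>R ^ k / sqrt (fact k)\<bar>"
      by (simp add: p_def q_def abs_mult power_abs power_mult_distrib power_divide)
    moreover have "p\<^sup>2 = (4 * R\<^sup>2) ^ k / fact k"
      by (simp add: p_def power_divide power_mult_distrib power_abs flip: power_mult)
        (simp add: power_mult mult.commute[of k] power_mult_distrib)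
    moreover have "q\<^sup>2 = (1 / 4) ^ k"
      by (simp add: q_def power_divide flip: power_mult) (simp add: power_mult mult.commute[of k])
    moreover have "p * q \<le> p\<^sup>2 + q\<^sup>2"
      using sum_squares_bound[of p q] zero_le_power2[of p] zero_le_power2[of q] by linarith
    ultimately show ?thesis by simp
  qed
qed auto

text \<open>Absolute convergence at every radius, with \<open>B R\<close> bounding the majorant
  series at radius \<open>R\<close>. The bound is a parameter rather than hidden in an existential
  so that it can be followed uniformly through a whole family of functions. Radii start at 1 so that
  powers of \<open>R\<close> increase with the degree.\<close>

definition entire_bd ::
    "real \<Rightarrow> real ^ 'n::finite \<Rightarrow> (real ^ 'n \<Rightarrow> real) \<Rightarrow> (real \<Rightarrow> real) \<Rightarrow> bool" where
  "entire_bd \<sigma> x0 g B \<longleftrightarrow> (\<exists>a.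
     (\<forall>R\<ge>1. (\<lambda>\<beta>. \<bar>a \<beta>\<bar> * R ^ sum \<beta> UNIV) summable_on UNIV \<and>
             (\<Sum>\<^sub>\<infinity>\<beta>. \<bar>a \<beta>\<bar> * R ^ sum \<beta> UNIV) \<le> B R) \<and>
     (\<forall>x. ((\<lambda>\<beta>. a \<beta> * mon (zcoord \<sigma> x0 x) \<beta>) has_sum g x) UNIV))"

lemma filterlim_grid: "filterlim grid (finite_subsets_at_top (UNIV :: ('n::finite \<Rightarrow> nat) set)) sequentially"
  unfolding filterlim_finite_subsets_at_top
proof (intro allI impI)
  fix X :: "('n \<Rightarrow> nat) set"
  assume "finite X \<and> X \<subseteq> UNIV"
  then have X: "finite X" by simp
  define M where "M = (\<Sum>a\<in>X. sum a UNIV)"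
  have "X \<subseteq> grid n" if "n \<ge> M" for n
  proof
    fix a assume a: "a \<in> X"
    have "a l \<le> n" for l
    proof -
      have "a l \<le> sum a UNIV" by (rule member_le_sum) auto
      also have "\<dots> \<le> M" unfolding M_def by (rule member_le_sum[OF a]) (use X in auto)
      finally show ?thesis using that by simp
    qed
    then show "a \<in> grid n" by auto
  qed
  then show "\<forall>\<^sub>F n in sequentially. finite (grid n :: ('n \<Rightarrow> nat) set) \<and> X \<subseteq> grid n \<and> grid n \<subseteq> (UNIV :: ('n \<Rightarrow> nat) set)"
    using finite_grid by (auto simp: eventually_sequentially intro!: exI[of _ M])
qed

text \<open>The coordinate functionals are approximated by exact numerical differentiation on the grid
  of mesh \<open>1/n\<close> in the unit cube: degrees up to \<open>n\<close> are treated exactly, and the weights grow only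
  exponentially in \<open>n\<close>, which the factor \<open>1/\<gamma>!\<close> absorbs.\<close>

lemma coordinate_functional_approx:
  fixes \<kappa> and x0 :: "real ^ 'n::finite"
  assumes \<sigma>: "0 < \<sigma>"
  defines "\<phi> \<equiv> \<lambda>a x. feature \<kappa> \<sigma> x0 a x / sqrt (multi_fact a)"
  shows "\<exists>e u. (\<forall>n::nat. kcomb (kernel_fun \<kappa> \<sigma> x0) \<phi> (e n) (u n)) \<and>
      (\<lambda>n. \<Sum>\<^sub>\<infinity>\<gamma>. (u n \<gamma> - (if \<gamma> = \<beta> then 1 else 0))\<^sup>2) \<longlonglongrightarrow> 0"
proof -
  obtain C :: real where C: "C \<ge> 1" and ex: "\<forall>D (s :: 'n \<Rightarrow> real) \<beta>. (\<forall>i. \<bar>s i\<bar> \<le> 0) \<longrightarrow>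
    (\<exists>w. (\<forall>\<gamma>\<in>grid D. (\<Sum>\<iota>\<in>grid D. w \<iota> * (\<Prod>i\<in>UNIV. (s i + real (\<iota> i) * 1 / real D) ^ \<gamma> i))
                 = (if \<gamma> = \<beta> then 1 else 0)) \<and>
         (\<Sum>\<iota>\<in>grid D. \<bar>w \<iota>\<bar>) \<le> C ^ D)"
    using grid_weights[of 1 0, where 'n = 'n, OF zero_less_one_class.zero_less_one] by (elim exE conjE) (rule that)
  have "\<forall>D. \<exists>w. (\<forall>\<gamma>\<in>grid D. (\<Sum>\<iota>\<in>grid D. w \<iota> * mon (\<lambda>l. real (\<iota> l) / real D) \<gamma>)
                 = (if \<gamma> = \<beta> then 1 else 0)) \<and> (\<Sum>\<iota>\<in>grid D. \<bar>w \<iota>\<bar>) \<le> C ^ D"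
  proof
    fix D
    show "\<exists>w. (\<forall>\<gamma>\<in>grid D. (\<Sum>\<iota>\<in>grid D. w \<iota> * mon (\<lambda>l. real (\<iota> l) / real D) \<gamma>)
                 = (if \<gamma> = \<beta> then 1 else 0)) \<and> (\<Sum>\<iota>\<in>grid D. \<bar>w \<iota>\<bar>) \<le> C ^ D"
      using spec[OF spec[OF spec[OF ex, of D], of "\<lambda>_. 0"], of \<beta>] by (simp add: mon_def)
  qed
  from choice[OF this] obtain w where
    w: "\<And>D \<gamma>. \<gamma> \<in> grid D \<Longrightarrow> (\<Sum>\<iota>\<in>grid D. w D \<iota> * mon (\<lambda>l. real (\<iota> l) / real D) \<gamma>) = (if \<gamma> = \<beta> then 1 else 0)"
    and wb: "\<And>D. (\<Sum>\<iota>\<in>grid D. \<bar>w D \<iota>\<bar>) \<le> C ^ D"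
    by blast
  define P :: "nat \<Rightarrow> ('n \<Rightarrow> nat) \<Rightarrow> real ^ 'n"
    where "P = (\<lambda>n \<iota>. \<chi> l. x0 $ l + \<sigma> * (real (\<iota> l) / real n))"
  have P: "zcoord \<sigma> x0 (P n \<iota>) = (\<lambda>l. real (\<iota> l) / real n)" for n \<iota>
    using \<sigma> by (simp add: zcoord_def P_def fun_eq_iff)
  \<comment> \<open>Dividing by the weight cancels the weight in the features, and
    \<open>sqrt (multi_fact \<beta>)\<close> makes the coordinate of index \<open>\<beta>\<close>
    exactly 1 as soon as the grid of degrees contains \<open>\<beta>\<close>.\<close>
  define coef where "coef = (\<lambda>n \<iota>. sqrt (multi_fact \<beta>) * w n \<iota> / weight \<kappa> \<sigma> x0 (P n \<iota>))"
  define e where "e = (\<lambda>n y. \<Sum>\<iota>\<in>grid n. coef n \<iota> * kernel_fun \<kappa> \<sigma> x0 (P n \<iota>) y)"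
  define u where "u = (\<lambda>n \<gamma>. \<Sum>\<iota>\<in>grid n. coef n \<iota> * \<phi> \<gamma> (P n \<iota>))"
  have comb: "kcomb (kernel_fun \<kappa> \<sigma> x0) \<phi> (e n) (u n)" for n
    unfolding e_def u_def by (intro kcomb_sum kcomb.base finite_grid)
  have u: "u n \<gamma> = sqrt (multi_fact \<beta>) / sqrt (multi_fact \<gamma>) *
      (\<Sum>\<iota>\<in>grid n. w n \<iota> * mon (\<lambda>l. real (\<iota> l) / real n) \<gamma>)" for n \<gamma>
    unfolding u_def sum_distrib_left
  proof (intro sum.cong refl)
    fix \<iota>
    show "coef n \<iota> * \<phi> \<gamma> (P n \<iota>) = sqrt (multi_fact \<beta>) / sqrt (multi_fact \<gamma>) *
        (w n \<iota> * mon (\<lambda>l. real (\<iota> l) / real n) \<gamma>)"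
      using weight_pos[of \<kappa> \<sigma> x0 "P n \<iota>"] by (simp add: coef_def \<phi>_def feature_eq P)
  qed
  \<comment> \<open>An index outside the grid of degrees has degree at least n. Monomials are at
    most 1 at nodes of the unit cube, so its squared coordinate is at most
    \<open>multi_fact \<beta> / multi_fact \<gamma>\<close> times \<open>(C ^ n)\<^sup>2\<close>,
    and C to the degree of \<open>\<gamma>\<close> bounds \<open>C ^ n\<close>. The result is
    summable and free of n.\<close>
  define t where "t = (\<lambda>\<gamma>::'n \<Rightarrow> nat. multi_fact \<beta> * (mon (\<lambda>_. C\<^sup>2) \<gamma> / multi_fact \<gamma>))"
  have t: "t summable_on UNIV"
    unfolding t_def by (intro summable_on_cmult_right has_sum_imp_summable[OF has_sum_multi_exp])
  have t0: "0 \<le> t \<gamma>" for \<gamma>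
    using multi_fact_pos[of \<beta>] multi_fact_pos[of \<gamma>] by (simp add: t_def mon_const)
  have small: "(\<Sum>\<^sub>\<infinity>\<gamma>. (u n \<gamma> - (if \<gamma> = \<beta> then 1 else 0))\<^sup>2) \<le> infsum t (- grid n)" if n: "\<beta> \<in> grid n" for n
  proof -
    have in0: "(u n \<gamma> - (if \<gamma> = \<beta> then 1 else 0))\<^sup>2 = 0" if "\<gamma> \<in> grid n" for \<gamma>
      using w[OF that] multi_fact_pos[of \<beta>] by (simp add: u)
    have out: "(u n \<gamma> - (if \<gamma> = \<beta> then 1 else 0))\<^sup>2 \<le> t \<gamma>" if g: "\<gamma> \<notin> grid n" for \<gamma>
    proof -
      have "\<exists>l. \<not> \<gamma> l \<le> n"
      proof (rule ccontr)
        assume "\<nexists>l. \<not> \<gamma> l \<le> n"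
        then have "\<gamma> \<in> grid n" by auto
        with g show False by simp
      qed
      then obtain l where l: "n < \<gamma> l" by (auto simp: not_le)
      have "\<gamma> l \<le> sum \<gamma> UNIV" by (rule member_le_sum) auto
      then have deg: "n \<le> sum \<gamma> UNIV" using l by simp
      have "\<bar>\<Sum>\<iota>\<in>grid n. w n \<iota> * mon (\<lambda>l. real (\<iota> l) / real n) \<gamma>\<bar> \<le> (\<Sum>\<iota>\<in>grid n. \<bar>w n \<iota>\<bar>)"
      proof (rule order_trans[OF sum_abs], rule sum_mono)
        fix \<iota> :: "'n \<Rightarrow> nat" assume "\<iota> \<in> grid n"
        then have "\<And>l. \<iota> l \<le> n" by auto
        then have "\<bar>mon (\<lambda>l. real (\<iota> l) / real n) \<gamma>\<bar> \<le> 1 ^ sum \<gamma> UNIV"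
          by (intro abs_mon_le) (auto simp: divide_le_eq_1)
        then show "\<bar>w n \<iota> * mon (\<lambda>l. real (\<iota> l) / real n) \<gamma>\<bar> \<le> \<bar>w n \<iota>\<bar>"
          by (simp add: abs_mult mult_left_le)
      qed
      also have "\<dots> \<le> C ^ n" by (rule wb)
      also have "\<dots> \<le> C ^ sum \<gamma> UNIV" using C deg by (rule power_increasing[rotated])
      finally have "(\<Sum>\<iota>\<in>grid n. w n \<iota> * mon (\<lambda>l. real (\<iota> l) / real n) \<gamma>)\<^sup>2 \<le> (C ^ sum \<gamma> UNIV)\<^sup>2"
        using C by (intro abs_le_square_iff[THEN iffD1]) simp
      then have "(u n \<gamma>)\<^sup>2 \<le> multi_fact \<beta> / multi_fact \<gamma> * (C ^ sum \<gamma> UNIV)\<^sup>2"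
        using multi_fact_pos[of \<beta>] multi_fact_pos[of \<gamma>]
        unfolding u power_mult_distrib by (intro mult_mono) (auto simp: power_divide)
      also have "\<dots> = t \<gamma>" by (simp add: t_def mon_const mult.commute flip: power_mult)
      finally show ?thesis using g n by auto
    qed
    have le: "(u n \<gamma> - (if \<gamma> = \<beta> then 1 else 0))\<^sup>2 \<le> t \<gamma>" for \<gamma>
      using in0[of \<gamma>] out[of \<gamma>] t0[of \<gamma>] by (cases "\<gamma> \<in> grid n") auto
    show ?thesis
    proof (rule infsum_mono_neutral)
      show "(\<lambda>\<gamma>. (u n \<gamma> - (if \<gamma> = \<beta> then 1 else 0))\<^sup>2) summable_on UNIV"
        by (rule summable_on_comparison_test[OF t]) (use le in auto)
      show "t summable_on - grid n" by (rule summable_on_subset[OF t]) auto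
    next
      fix \<gamma> :: "'n \<Rightarrow> nat"
      assume "\<gamma> \<in> UNIV - - grid n"
      then show "(u n \<gamma> - (if \<gamma> = \<beta> then 1 else 0))\<^sup>2 \<le> 0" using in0[of \<gamma>] by simp
    qed (use le in auto)
  qed
  have "(\<lambda>n. \<Sum>\<^sub>\<infinity>\<gamma>. (u n \<gamma> - (if \<gamma> = \<beta> then 1 else 0))\<^sup>2) \<longlonglongrightarrow> 0"
  proof (rule tendsto_sandwich[OF _ _ tendsto_const])
    show "(\<lambda>n. infsum t (- grid n)) \<longlonglongrightarrow> 0"
      by (rule filterlim_compose[OF infsum_Compl_tendsto_0[OF t] filterlim_grid])
    have "\<forall>\<^sub>F n in sequentially. finite (grid n :: ('n \<Rightarrow> nat) set) \<and> {\<beta>} \<subseteq> grid n \<and> grid n \<subseteq> (UNIV :: ('n \<Rightarrow> nat) set)"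
      using spec[OF filterlim_grid[where 'n = 'n, unfolded filterlim_finite_subsets_at_top], of "{\<beta>}"] by simp
    then have "\<forall>\<^sub>F n in sequentially. \<beta> \<in> grid n"
      by (rule eventually_mono) simp
    then show "\<forall>\<^sub>F n in sequentially. (\<Sum>\<^sub>\<infinity>\<gamma>. (u n \<gamma> - (if \<gamma> = \<beta> then 1 else 0))\<^sup>2) \<le> infsum t (- grid n)"
      by eventually_elim (rule small)
  qed (auto intro!: always_eventually infsum_nonneg)
  with comb show ?thesis by blast
qed

section \<open>Entire functions and the images of the features\<close>

lemma sqrt_prod: "sqrt (prod f A) = (\<Prod>x\<in>A. sqrt (f x))"
  by (induction A rule: infinite_finite_induct) (auto simp: real_sqrt_mult)

text \<open>The coordinates of \<open>h\<close> are bounded, and the features carry the factor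
  \<open>1 / sqrt (multi_fact i)\<close>; the majorant series at radius \<open>R\<close> is
  therefore dominated by a product of one-variable series with terms
  \<open>R ^ k / sqrt (fact k)\<close>.\<close>

lemma rkhs_kernel_fun_entire:
  fixes x0 :: "real ^ 'n::finite"
  assumes \<sigma>: "0 < \<sigma>" and rkhs: "rkhs (kernel_fun \<kappa> \<sigma> x0) H ip" and h: "h \<in> H"
  shows "\<exists>B. entire_bd \<sigma> x0 (\<lambda>x. h x / weight \<kappa> \<sigma> x0 x) B"
proof -
  obtain a B where aB: "\<And>i. \<bar>a i\<bar> \<le> B"
    and a: "\<And>x. ((\<lambda>i. a i * (feature \<kappa> \<sigma> x0 i x / sqrt (multi_fact i))) has_sum h x) UNIV"
    using rkhs.feature_expansion[OF rkhs, of "\<lambda>a x. feature \<kappa> \<sigma> x0 a x / sqrt (multi_fact a)",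
        OF kernel_fun_expansion coordinate_functional_approx[OF \<sigma>] h] by blast
  define b where "b = (\<lambda>i. a i / sqrt (multi_fact i))"
  have s: "(\<lambda>\<beta>. \<bar>b \<beta>\<bar> * R ^ sum \<beta> UNIV) summable_on UNIV" if R: "R \<ge> 1" for R
  proof (rule summable_on_comparison_test)
    have "((\<lambda>\<beta>::'n \<Rightarrow> nat. \<Prod>l\<in>UNIV. R ^ \<beta> l / sqrt (fact (\<beta> l))) has_sum
        (\<Prod>l\<in>(UNIV::'n set). infsum (\<lambda>k. R ^ k / sqrt (fact k)) UNIV)) UNIV"
      using has_sum_multi_index_prod[of "\<lambda>_::'n. \<lambda>k. R ^ k / sqrt (fact k)"] summable_power_over_sqrt_fact by simp
    then show "(\<lambda>\<beta>::'n \<Rightarrow> nat. B * (\<Prod>l\<in>UNIV. R ^ \<beta> l / sqrt (fact (\<beta> l)))) summable_on UNIV"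
      by (intro summable_on_cmult_right has_sum_imp_summable)
  next
    fix \<beta> :: "'n \<Rightarrow> nat"
    have "sqrt (multi_fact \<beta>) = (\<Prod>l\<in>UNIV. sqrt (fact (\<beta> l)))"
      unfolding multi_fact_def by (rule sqrt_prod)
    then have eq: "(\<Prod>l\<in>UNIV. R ^ \<beta> l / sqrt (fact (\<beta> l))) = R ^ sum \<beta> UNIV / sqrt (multi_fact \<beta>)"
      by (simp add: prod_dividef power_sum)
    have "\<bar>b \<beta>\<bar> * R ^ sum \<beta> UNIV = \<bar>a \<beta>\<bar> * (R ^ sum \<beta> UNIV / sqrt (multi_fact \<beta>))"
      using multi_fact_pos[of \<beta>] by (simp add: b_def)
    also have "\<dots> \<le> B * (R ^ sum \<beta> UNIV / sqrt (multi_fact \<beta>))"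
      using R multi_fact_pos[of \<beta>] by (intro mult_right_mono aB) auto
    finally show "\<bar>b \<beta>\<bar> * R ^ sum \<beta> UNIV \<le> B * (\<Prod>l\<in>UNIV. R ^ \<beta> l / sqrt (fact (\<beta> l)))"
      by (simp only: eq)
    show "0 \<le> \<bar>b \<beta>\<bar> * R ^ sum \<beta> UNIV" using R by simp
  qed
  have "((\<lambda>\<beta>. b \<beta> * mon (zcoord \<sigma> x0 x) \<beta>) has_sum h x / weight \<kappa> \<sigma> x0 x) UNIV" for x
    using has_sum_cmult_right[OF a[of x], of "1 / weight \<kappa> \<sigma> x0 x"] weight_pos[of \<kappa> \<sigma> x0 x]
    by (simp add: b_def feature_eq)
  with s show ?thesis
    unfolding entire_bd_def
    by (intro exI[of _ "\<lambda>R. \<Sum>\<^sub>\<infinity>\<beta>. \<bar>b \<beta>\<bar> * R ^ sum \<beta> UNIV"] exI[of _ b]) simp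
qed

lemma entire_bd_mono:
  assumes "entire_bd \<sigma> x0 g B" "\<And>R. R \<ge> 1 \<Longrightarrow> B R \<le> B' R"
  shows "entire_bd \<sigma> x0 g B'"
  using assms unfolding entire_bd_def by (meson order_trans)

lemma entire_bd_nonneg:
  fixes x0 :: "real ^ 'n::finite"
  assumes "entire_bd \<sigma> x0 g B" and R: "R \<ge> 1"
  shows "0 \<le> B R"
proof -
  obtain a :: "('n \<Rightarrow> nat) \<Rightarrow> real" where "(\<Sum>\<^sub>\<infinity>\<beta>. \<bar>a \<beta>\<bar> * R ^ sum \<beta> UNIV) \<le> B R" using assms unfolding entire_bd_def by blast
  moreover have "0 \<le> (\<Sum>\<^sub>\<infinity>\<beta>. \<bar>a \<beta>\<bar> * R ^ sum \<beta> UNIV)"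
    by (intro infsum_nonneg mult_nonneg_nonneg) (use R in auto)
  ultimately show ?thesis by linarith
qed

lemma entire_bd_zero: "entire_bd \<sigma> x0 (\<lambda>_. 0) (\<lambda>_. 0)"
  unfolding entire_bd_def by (rule exI[of _ "\<lambda>_. 0"]) simp

lemma entire_bd_add:
  assumes "entire_bd \<sigma> x0 g B" "entire_bd \<sigma> x0 g' B'"
  shows "entire_bd \<sigma> x0 (\<lambda>x. g x + g' x) (\<lambda>R. B R + B' R)"
proof -
  obtain a where a: "\<And>R. R \<ge> 1 \<Longrightarrow> (\<lambda>\<beta>. \<bar>a \<beta>\<bar> * R ^ sum \<beta> UNIV) summable_on UNIV"
    "\<And>R. R \<ge> 1 \<Longrightarrow> (\<Sum>\<^sub>\<infinity>\<beta>. \<bar>a \<beta>\<bar> * R ^ sum \<beta> UNIV) \<le> B R"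
    "\<And>x. ((\<lambda>\<beta>. a \<beta> * mon (zcoord \<sigma> x0 x) \<beta>) has_sum g x) UNIV"
    using assms(1) unfolding entire_bd_def by blast
  obtain b where b: "\<And>R. R \<ge> 1 \<Longrightarrow> (\<lambda>\<beta>. \<bar>b \<beta>\<bar> * R ^ sum \<beta> UNIV) summable_on UNIV"
    "\<And>R. R \<ge> 1 \<Longrightarrow> (\<Sum>\<^sub>\<infinity>\<beta>. \<bar>b \<beta>\<bar> * R ^ sum \<beta> UNIV) \<le> B' R"
    "\<And>x. ((\<lambda>\<beta>. b \<beta> * mon (zcoord \<sigma> x0 x) \<beta>) has_sum g' x) UNIV"
    using assms(2) unfolding entire_bd_def by blast
  have le: "\<bar>a \<beta> + b \<beta>\<bar> * R ^ sum \<beta> UNIV \<le> \<bar>a \<beta>\<bar> * R ^ sum \<beta> UNIV + \<bar>b \<beta>\<bar> * R ^ sum \<beta> UNIV"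
    if "R \<ge> 1" for R :: real and \<beta>
    using that mult_right_mono[OF abs_triangle_ineq[of "a \<beta>" "b \<beta>"], of "R ^ sum \<beta> UNIV"]
    by (simp add: distrib_right)
  have s: "(\<lambda>\<beta>. \<bar>a \<beta> + b \<beta>\<bar> * R ^ sum \<beta> UNIV) summable_on UNIV" if "R \<ge> 1" for R
    by (rule summable_on_comparison_test[OF summable_on_add[OF a(1)[OF that] b(1)[OF that]] le[OF that]])
      (use that in auto)
  have "(\<Sum>\<^sub>\<infinity>\<beta>. \<bar>a \<beta> + b \<beta>\<bar> * R ^ sum \<beta> UNIV) \<le> B R + B' R" if R: "R \<ge> 1" for R
  proof -
    have "(\<Sum>\<^sub>\<infinity>\<beta>. \<bar>a \<beta> + b \<beta>\<bar> * R ^ sum \<beta> UNIV)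
        \<le> (\<Sum>\<^sub>\<infinity>\<beta>. \<bar>a \<beta>\<bar> * R ^ sum \<beta> UNIV + \<bar>b \<beta>\<bar> * R ^ sum \<beta> UNIV)"
      by (rule infsum_mono[OF s[OF R] summable_on_add[OF a(1)[OF R] b(1)[OF R]] le[OF R]])
    also have "\<dots> = (\<Sum>\<^sub>\<infinity>\<beta>. \<bar>a \<beta>\<bar> * R ^ sum \<beta> UNIV) + (\<Sum>\<^sub>\<infinity>\<beta>. \<bar>b \<beta>\<bar> * R ^ sum \<beta> UNIV)"
      by (rule infsum_add[OF a(1)[OF R] b(1)[OF R]])
    finally show ?thesis using a(2)[OF R] b(2)[OF R] by linarith
  qed
  moreover have "((\<lambda>\<beta>. (a \<beta> + b \<beta>) * mon (zcoord \<sigma> x0 x) \<beta>) has_sum (g x + g' x)) UNIV" for x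
    using has_sum_add[OF a(3) b(3), of x x] by (simp add: distrib_right)
  ultimately show ?thesis
    unfolding entire_bd_def by (intro exI[of _ "\<lambda>\<beta>. a \<beta> + b \<beta>"]) (simp add: s)
qed

lemma entire_bd_cmult:
  assumes "entire_bd \<sigma> x0 g B"
  shows "entire_bd \<sigma> x0 (\<lambda>x. c * g x) (\<lambda>R. \<bar>c\<bar> * B R)"
proof -
  obtain a where a: "\<And>R. R \<ge> 1 \<Longrightarrow> (\<lambda>\<beta>. \<bar>a \<beta>\<bar> * R ^ sum \<beta> UNIV) summable_on UNIV"
    "\<And>R. R \<ge> 1 \<Longrightarrow> (\<Sum>\<^sub>\<infinity>\<beta>. \<bar>a \<beta>\<bar> * R ^ sum \<beta> UNIV) \<le> B R"
    "\<And>x. ((\<lambda>\<beta>. a \<beta> * mon (zcoord \<sigma> x0 x) \<beta>) has_sum g x) UNIV"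
    using assms(1) unfolding entire_bd_def by blast
  have h: "((\<lambda>\<beta>. \<bar>c * a \<beta>\<bar> * R ^ sum \<beta> UNIV) has_sum (\<bar>c\<bar> * (\<Sum>\<^sub>\<infinity>\<beta>. \<bar>a \<beta>\<bar> * R ^ sum \<beta> UNIV))) UNIV"
    if "R \<ge> 1" for R
    using has_sum_cmult_right[OF has_sum_infsum[OF a(1)[OF that]], of "\<bar>c\<bar>"]
    by (simp add: abs_mult mult.assoc)
  have "(\<lambda>\<beta>. \<bar>c * a \<beta>\<bar> * R ^ sum \<beta> UNIV) summable_on UNIV \<and>
      (\<Sum>\<^sub>\<infinity>\<beta>. \<bar>c * a \<beta>\<bar> * R ^ sum \<beta> UNIV) \<le> \<bar>c\<bar> * B R" if R: "R \<ge> 1" for R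
    using has_sum_imp_summable[OF h[OF R]] infsumI[OF h[OF R]] mult_left_mono[OF a(2)[OF R], of "\<bar>c\<bar>"]
    by simp
  moreover have "((\<lambda>\<beta>. (c * a \<beta>) * mon (zcoord \<sigma> x0 x) \<beta>) has_sum (c * g x)) UNIV" for x
    using has_sum_cmult_right[OF a(3)[of x], of c] by (simp add: mult.assoc)
  ultimately show ?thesis
    unfolding entire_bd_def by (intro exI[of _ "\<lambda>\<beta>. c * a \<beta>"]) simp
qed

lemma entire_bd_sum:
  assumes "finite S" "\<And>s. s \<in> S \<Longrightarrow> entire_bd \<sigma> x0 (g s) (B s)"
  shows "entire_bd \<sigma> x0 (\<lambda>x. \<Sum>s\<in>S. g s x) (\<lambda>R. \<Sum>s\<in>S. B s R)"
  using assms
proof (induction S rule: finite_induct)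
  case (insert s S)
  then show ?case using entire_bd_add[of \<sigma> x0 "g s" "B s"] by simp
qed (simp add: entire_bd_zero)

lemma has_sum_reindex_neutral:
  assumes "inj h" "\<And>y. y \<notin> range h \<Longrightarrow> f y = 0"
  shows "(f has_sum s) UNIV \<longleftrightarrow> ((\<lambda>x. f (h x)) has_sum s) UNIV"
proof -
  have "(f has_sum s) UNIV \<longleftrightarrow> (f has_sum s) (range h)"
    by (rule has_sum_cong_neutral) (use assms(2) in auto)
  also have "\<dots> \<longleftrightarrow> ((\<lambda>x. f (h x)) has_sum s) UNIV"
    using has_sum_reindex[OF assms(1), of f s] by (simp add: o_def)
  finally show ?thesis .
qed

text \<open>Multiplication by the monomial shifts all coefficients by \<open>p\<close>, which
  multiplies the majorant series at radius \<open>R\<close> by R to the degree of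
  \<open>p\<close>.\<close>

lemma entire_bd_mon_mult:
  fixes x0 :: "real ^ 'n::finite"
  assumes "entire_bd \<sigma> x0 g B"
  shows "entire_bd \<sigma> x0 (\<lambda>x. mon (zcoord \<sigma> x0 x) p * g x) (\<lambda>R. R ^ sum p UNIV * B R)"
proof -
  obtain a where a: "\<And>R. R \<ge> 1 \<Longrightarrow> (\<lambda>\<beta>. \<bar>a \<beta>\<bar> * R ^ sum \<beta> UNIV) summable_on UNIV"
    "\<And>R. R \<ge> 1 \<Longrightarrow> (\<Sum>\<^sub>\<infinity>\<beta>. \<bar>a \<beta>\<bar> * R ^ sum \<beta> UNIV) \<le> B R"
    "\<And>x. ((\<lambda>\<beta>. a \<beta> * mon (zcoord \<sigma> x0 x) \<beta>) has_sum g x) UNIV"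
    using assms(1) unfolding entire_bd_def by blast
  define sh :: "('n \<Rightarrow> nat) \<Rightarrow> 'n \<Rightarrow> nat" where "sh = (\<lambda>\<beta> l. p l + \<beta> l)"
  have inj: "inj sh" by (rule injI) (auto simp: sh_def fun_eq_iff)
  have deg: "sum (sh \<beta>) UNIV = sum p UNIV + sum \<beta> UNIV" for \<beta>
    by (simp add: sh_def sum.distrib)
  define b where "b = (\<lambda>\<gamma>. if \<gamma> \<in> range sh then a (inv_into UNIV sh \<gamma>) else 0)"
  have b: "b (sh \<beta>) = a \<beta>" for \<beta> by (simp add: b_def inv_f_f[OF inj])
  have h: "((\<lambda>\<beta>. \<bar>b \<beta>\<bar> * R ^ sum \<beta> UNIV) has_sum (R ^ sum p UNIV * (\<Sum>\<^sub>\<infinity>\<beta>. \<bar>a \<beta>\<bar> * R ^ sum \<beta> UNIV))) UNIV"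
    if "R \<ge> 1" for R
  proof (subst has_sum_reindex_neutral[OF inj])
    show "((\<lambda>\<beta>. \<bar>b (sh \<beta>)\<bar> * R ^ sum (sh \<beta>) UNIV) has_sum (R ^ sum p UNIV * (\<Sum>\<^sub>\<infinity>\<beta>. \<bar>a \<beta>\<bar> * R ^ sum \<beta> UNIV))) UNIV"
      using has_sum_cmult_right[OF has_sum_infsum[OF a(1)[OF that]], of "R ^ sum p UNIV"]
      by (simp add: b deg power_add mult_ac)
  qed (simp add: b_def)
  have "(\<lambda>\<beta>. \<bar>b \<beta>\<bar> * R ^ sum \<beta> UNIV) summable_on UNIV \<and>
      (\<Sum>\<^sub>\<infinity>\<beta>. \<bar>b \<beta>\<bar> * R ^ sum \<beta> UNIV) \<le> R ^ sum p UNIV * B R" if R: "R \<ge> 1" for R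
    using has_sum_imp_summable[OF h[OF R]] infsumI[OF h[OF R]] mult_left_mono[OF a(2)[OF R], of "R ^ sum p UNIV"] R
    by simp
  moreover have "((\<lambda>\<beta>. b \<beta> * mon (zcoord \<sigma> x0 x) \<beta>) has_sum (mon (zcoord \<sigma> x0 x) p * g x)) UNIV" for x
  proof (subst has_sum_reindex_neutral[OF inj])
    have "mon (zcoord \<sigma> x0 x) (sh \<beta>) = mon (zcoord \<sigma> x0 x) p * mon (zcoord \<sigma> x0 x) \<beta>" for \<beta>
      unfolding sh_def by (rule mon_add)
    then show "((\<lambda>\<beta>. b (sh \<beta>) * mon (zcoord \<sigma> x0 x) (sh \<beta>)) has_sum (mon (zcoord \<sigma> x0 x) p * g x)) UNIV"
      using has_sum_cmult_right[OF a(3)[of x], of "mon (zcoord \<sigma> x0 x) p"] by (simp add: b mult_ac)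
  qed (simp add: b_def)
  ultimately show ?thesis
    unfolding entire_bd_def by (intro exI[of _ b]) simp
qed

text \<open>A numerical switch: it multiplies the term that arises from differentiating the weight,
  so that one derivative formula covers both kernels.\<close>

definition gauss_ind :: "kernel_kind \<Rightarrow> real" where
  "gauss_ind \<kappa> = (case \<kappa> of Exponential \<Rightarrow> 0 | Gaussian \<Rightarrow> 1)"

lemma zcoord_shift:
  "zcoord \<sigma> x0 (x + t *\<^sub>R axis l 1) l' = zcoord \<sigma> x0 x l' + (if l' = l then t / \<sigma> else 0)"
  by (simp add: zcoord_def axis_def diff_divide_distrib add_divide_distrib)

lemma mon_remove: "mon z p = z l ^ p l * (\<Prod>l'\<in>UNIV - {l}. z l' ^ p l')"
  unfolding mon_def by (simp add: prod.remove[of UNIV l])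

text \<open>Along the line only the factor of coordinate \<open>l\<close> varies. If
  \<open>p l = 0\<close>, truncated subtraction leaves the exponent 0, and the factor
  \<open>real (p l)\<close> makes the right-hand side vanish as it should.\<close>

lemma mon_deriv:
  fixes x0 :: "real ^ 'n::finite"
  assumes "\<sigma> > 0"
  shows "((\<lambda>t. mon (zcoord \<sigma> x0 (x + t *\<^sub>R axis l 1)) p) has_real_derivative
     real (p l) / \<sigma> * mon (zcoord \<sigma> x0 x) (p(l := p l - 1))) (at 0)"
proof -
  define A where "A = (\<Prod>l'\<in>UNIV - {l}. zcoord \<sigma> x0 x l' ^ p l')"
  have eq: "mon (zcoord \<sigma> x0 (x + t *\<^sub>R axis l 1)) p = (zcoord \<sigma> x0 x l + t / \<sigma>) ^ p l * A" for t
    unfolding mon_remove[of _ p l] A_def by (auto simp: zcoord_shift intro!: prod.cong)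
  have eq': "mon (zcoord \<sigma> x0 x) (p(l := p l - 1)) = zcoord \<sigma> x0 x l ^ (p l - 1) * A"
    unfolding mon_remove[of _ "p(l := p l - 1)" l] A_def by (auto intro!: prod.cong)
  show ?thesis unfolding eq eq'
    using assms by (auto intro!: derivative_eq_intros)
qed

lemma norm_shift_axis:
  fixes x x0 :: "real ^ 'n::finite"
  shows "(norm (x + t *\<^sub>R axis l 1 - x0))\<^sup>2 = (norm (x - x0))\<^sup>2 + 2 * t * (x $ l - x0 $ l) + t\<^sup>2"
proof -
  have "x + t *\<^sub>R axis l 1 - x0 = (x - x0) + t *\<^sub>R axis l 1" by simp
  then show ?thesis
    by (simp only: power2_norm_eq_inner)
      (simp add: inner_add_left inner_add_right inner_axis inner_axis' power2_eq_square algebra_simps)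
qed

lemma weight_deriv:
  fixes x0 :: "real ^ 'n::finite"
  assumes "\<sigma> > 0"
  shows "((\<lambda>t. weight \<kappa> \<sigma> x0 (x + t *\<^sub>R axis l 1)) has_real_derivative
     - gauss_ind \<kappa> * weight \<kappa> \<sigma> x0 x * zcoord \<sigma> x0 x l / \<sigma>) (at 0)"
proof (cases \<kappa>)
  case Exponential
  then show ?thesis by (simp add: weight_def gauss_ind_def)
next
  case Gaussian
  have "((\<lambda>t. exp (- ((norm (x - x0))\<^sup>2 + 2 * t * (x $ l - x0 $ l) + t\<^sup>2) / (2 * \<sigma>\<^sup>2))) has_real_derivative
     - exp (- (norm (x - x0))\<^sup>2 / (2 * \<sigma>\<^sup>2)) * zcoord \<sigma> x0 x l / \<sigma>) (at 0)"
    using assms by (auto intro!: derivative_eq_intros simp: zcoord_def field_simps power2_eq_square)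
  then show ?thesis using Gaussian by (simp add: weight_def gauss_ind_def norm_shift_axis)
qed

lemma partial_deriv_feature:
  fixes x0 :: "real ^ 'n::finite"
  assumes "\<sigma> > 0"
  shows "partial_deriv l (feature \<kappa> \<sigma> x0 p) x = weight \<kappa> \<sigma> x0 x *
    (real (p l) / \<sigma> * mon (zcoord \<sigma> x0 x) (p(l := p l - 1))
      - gauss_ind \<kappa> / \<sigma> * (zcoord \<sigma> x0 x l * mon (zcoord \<sigma> x0 x) p))"
proof -
  have "((\<lambda>t. feature \<kappa> \<sigma> x0 p (x + t *\<^sub>R axis l 1)) has_real_derivative
    weight \<kappa> \<sigma> x0 x * (real (p l) / \<sigma> * mon (zcoord \<sigma> x0 x) (p(l := p l - 1))
      - gauss_ind \<kappa> / \<sigma> * (zcoord \<sigma> x0 x l * mon (zcoord \<sigma> x0 x) p))) (at 0)"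
    unfolding feature_eq
    using DERIV_mult[OF weight_deriv[OF assms, of \<kappa> x0 x l] mon_deriv[OF assms, of x0 x l p]]
    by (simp add: algebra_simps)
  then show ?thesis unfolding partial_deriv_def by (rule DERIV_imp_deriv)
qed

section \<open>Jets of order at most one of the kernel at the centre\<close>

abbreviation unit_index :: "'n \<Rightarrow> 'n \<Rightarrow> nat" where
  "unit_index l \<equiv> (\<lambda>l'. if l' = l then 1 else 0)"

lemma mon_zero_index: "mon z (\<lambda>_. 0) = 1"
  by (simp add: mon_def)

lemma mon_unit_index: "mon z (unit_index l) = z l"
  by (simp add: mon_remove[of z _ l])

lemma multi_deriv_zero:
  fixes c :: "nat \<Rightarrow> 'n::finite"
  shows "multi_deriv c (\<lambda>_. 0) f = f"
proof -
  have "concat (map (\<lambda>i. [] :: 'n list) xs) = []" for xs :: "nat list"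
    by (induction xs) auto
  then show ?thesis by (simp only: multi_deriv_def iter_partial_def replicate_0 foldr.simps id_apply)
qed

lemma multi_deriv_unit:
  fixes c :: "nat \<Rightarrow> 'n::finite"
  assumes c: "bij_betw c {..<CARD('n)} UNIV"
  shows "multi_deriv c (unit_index l) f = partial_deriv l f"
proof -
  obtain i where i: "i < CARD('n)" "c i = l"
    using c unfolding bij_betw_def by (metis (full_types) UNIV_I imageE lessThan_iff)
  define g where "g = (\<lambda>i. replicate (unit_index l (c i)) (c i))"
  have other: "g j = []" if "j < CARD('n)" "j \<noteq> i" for j
    using c that i unfolding bij_betw_def inj_on_def by (auto simp: g_def)
  obtain k where k: "CARD('n) = i + Suc k" using less_imp_Suc_add[OF i(1)] by auto
  have "[0..<CARD('n)] = [0..<i] @ [i..<CARD('n)]"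
    unfolding k by (rule upt_add_eq_append) simp
  also have "[i..<CARD('n)] = [i] @ [Suc i..<CARD('n)]"
    using i(1) by (simp add: upt_conv_Cons)
  finally have "[0..<CARD('n)] = [0..<i] @ [i] @ [Suc i..<CARD('n)]" .
  then have "concat (map g [0..<CARD('n)])
      = concat (map g [0..<i]) @ g i @ concat (map g [Suc i..<CARD('n)])"
    by simp
  also have "concat (map g [0..<i]) = []" using other i(1) by simp
  also have "concat (map g [Suc i..<CARD('n)]) = []" using other by simp
  also have "g i = [l]" using i(2) by (simp add: g_def)
  finally show ?thesis unfolding g_def multi_deriv_def iter_partial_def by simp
qed

lemma kernel_fun_at_center: "kernel_fun \<kappa> \<sigma> x0 x0 y = feature \<kappa> \<sigma> x0 (\<lambda>_. 0) y"
  by (cases \<kappa>) (simp_all add: feature_eq weight_def mon_zero_index norm_minus_commute)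

text \<open>The derivative of the Gaussian weight vanishes at \<open>x0\<close>, so only the
  coupling term contributes and both kernels give the same multiple of a first-order
  feature.\<close>

lemma partial_deriv_kernel_fun:
  fixes x0 :: "real ^ 'n::finite"
  assumes \<sigma>: "\<sigma> > 0"
  shows "partial_deriv l (\<lambda>x. kernel_fun \<kappa> \<sigma> x0 x y) x0 = feature \<kappa> \<sigma> x0 (unit_index l) y / \<sigma>"
proof -
  have "((\<lambda>t. kernel_fun \<kappa> \<sigma> x0 (x0 + t *\<^sub>R axis l 1) y) has_real_derivative
      weight \<kappa> \<sigma> x0 y * zcoord \<sigma> x0 y l / \<sigma>) (at 0)"
  proof (cases \<kappa>)
    case Exponential
    have "((\<lambda>t. exp (t * d)) has_real_derivative d) (at 0)" for d :: real
      by (auto intro!: derivative_eq_intros)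
    from this[of "(y $ l - x0 $ l) / \<sigma>\<^sup>2"] show ?thesis
      using Exponential by (simp add: weight_def zcoord_def inner_axis' power2_eq_square)
  next
    case Gaussian
    have "((\<lambda>t. exp (- ((norm (x0 - y))\<^sup>2 + 2 * t * (x0 $ l - y $ l) + t\<^sup>2) / (2 * \<sigma>\<^sup>2))) has_real_derivative
      exp (- (norm (x0 - y))\<^sup>2 / (2 * \<sigma>\<^sup>2)) * zcoord \<sigma> x0 y l / \<sigma>) (at 0)"
      using \<sigma> by (auto intro!: derivative_eq_intros simp: zcoord_def field_simps power2_eq_square)
    then show ?thesis using Gaussian by (simp add: weight_def norm_shift_axis norm_minus_commute[of y x0])
  qed
  then have "partial_deriv l (\<lambda>x. kernel_fun \<kappa> \<sigma> x0 x y) x0 = weight \<kappa> \<sigma> x0 y * zcoord \<sigma> x0 y l / \<sigma>"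
    unfolding partial_deriv_def by (rule DERIV_imp_deriv)
  then show ?thesis by (simp only: feature_eq mon_unit_index)
qed

lemma feature_zero_in_jet_span: "feature \<kappa> \<sigma> x0 (\<lambda>_. 0) \<in> jet_span c (kernel_fun \<kappa> \<sigma> x0) x0"
  unfolding jet_span_def
  by (intro CollectI exI[of _ "{\<lambda>_. 0}"] exI[of _ "\<lambda>_. 1"])
    (simp add: multi_deriv_zero kernel_fun_at_center fun_eq_iff)

lemma feature_unit_in_jet_span:
  fixes x0 :: "real ^ 'n::finite"
  assumes \<sigma>: "\<sigma> > 0" and c: "bij_betw c {..<CARD('n)} UNIV"
  shows "feature \<kappa> \<sigma> x0 (unit_index l) \<in> jet_span c (kernel_fun \<kappa> \<sigma> x0) x0"
  unfolding jet_span_def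
  using \<sigma> by (intro CollectI exI[of _ "{unit_index l}"] exI[of _ "\<lambda>_. \<sigma>"])
    (simp add: multi_deriv_unit[OF c] partial_deriv_kernel_fun[OF \<sigma>] fun_eq_iff)

text \<open>The jets of order at most one make the components of \<open>F\<close> entire; the images of the other
  features are then explicit.\<close>

lemma A_op_feature_entire:
  fixes F :: "real ^ 'n::finite \<Rightarrow> real ^ 'n"
  assumes \<sigma>: "\<sigma> > 0" and rkhs: "rkhs (kernel_fun \<kappa> \<sigma> x0) H ip"
    and c: "bij_betw c {..<CARD('n)} UNIV"
    and dom: "jet_span c (kernel_fun \<kappa> \<sigma> x0) x0 \<subseteq> A_dom H F"
  shows "\<exists>T. \<forall>p. entire_bd \<sigma> x0 (\<lambda>x. A_op F (feature \<kappa> \<sigma> x0 p) x / weight \<kappa> \<sigma> x0 x)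
           (\<lambda>R. (2 * R) ^ sum p UNIV * T R)"
proof -
  define z where "z = zcoord \<sigma> x0"
  \<comment> \<open>The contribution of the derivative of the weight, identically 0 for the
    exponential kernel. The zero multi-index isolates \<open>- Q\<close>; adding
    \<open>z x l * Q x\<close> to the image for the unit index of \<open>l\<close> then leaves
    \<open>F x $ l / \<sigma>\<close>.\<close>
  define Q where "Q = (\<lambda>x. gauss_ind \<kappa> / \<sigma> * (\<Sum>l\<in>UNIV. F x $ l * z x l))"
  have A: "A_op F (feature \<kappa> \<sigma> x0 p) x / weight \<kappa> \<sigma> x0 x
      = (\<Sum>l\<in>UNIV. real (p l) / \<sigma> * (mon (z x) (p(l := p l - 1)) * F x $ l)) + (- 1) * (mon (z x) p * Q x)"
    for p x
  proof -
    have "A_op F (feature \<kappa> \<sigma> x0 p) x = weight \<kappa> \<sigma> x0 x *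
      (\<Sum>l\<in>UNIV. real (p l) / \<sigma> * (mon (z x) (p(l := p l - 1)) * F x $ l)
        - mon (z x) p * (gauss_ind \<kappa> / \<sigma> * (F x $ l * z x l)))"
      unfolding A_op_def partial_deriv_feature[OF \<sigma>] sum_distrib_left z_def
      by (intro sum.cong refl) (simp add: algebra_simps)
    also have "\<dots> = weight \<kappa> \<sigma> x0 x *
      ((\<Sum>l\<in>UNIV. real (p l) / \<sigma> * (mon (z x) (p(l := p l - 1)) * F x $ l)) - mon (z x) p * Q x)"
      by (simp add: sum_subtractf Q_def sum_distrib_left)
    finally show ?thesis using weight_pos[of \<kappa> \<sigma> x0 x] by simp
  qed
  have mem: "\<exists>B. entire_bd \<sigma> x0 (\<lambda>x. A_op F (feature \<kappa> \<sigma> x0 p) x / weight \<kappa> \<sigma> x0 x) B"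
    if "feature \<kappa> \<sigma> x0 p \<in> jet_span c (kernel_fun \<kappa> \<sigma> x0) x0" for p
    using that dom rkhs_kernel_fun_entire[OF \<sigma> rkhs] unfolding A_dom_def by blast
  obtain BQ where BQ: "entire_bd \<sigma> x0 Q BQ"
  proof -
    obtain B where "entire_bd \<sigma> x0 (\<lambda>x. A_op F (feature \<kappa> \<sigma> x0 (\<lambda>_. 0)) x / weight \<kappa> \<sigma> x0 x) B"
      using mem[OF feature_zero_in_jet_span] by blast
    then have "entire_bd \<sigma> x0 (\<lambda>x. - 1 * Q x) B" unfolding A by (simp add: mon_zero_index)
    from entire_bd_cmult[OF this, of "- 1"] show ?thesis using that by simp
  qed
  have "\<exists>B. entire_bd \<sigma> x0 (\<lambda>x. F x $ l) B" for l
  proof -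
    obtain B where B: "entire_bd \<sigma> x0 (\<lambda>x. A_op F (feature \<kappa> \<sigma> x0 (unit_index l)) x / weight \<kappa> \<sigma> x0 x) B"
      using mem[OF feature_unit_in_jet_span[OF \<sigma> c]] by blast
    have S: "(\<Sum>l'\<in>UNIV. real (unit_index l l') / \<sigma> * (mon (z x) ((unit_index l)(l' := unit_index l l' - 1)) * F x $ l'))
        = F x $ l / \<sigma>" for x
    proof -
      have "(\<Sum>l'\<in>UNIV. real (unit_index l l') / \<sigma> * (mon (z x) ((unit_index l)(l' := unit_index l l' - 1)) * F x $ l'))
        = (\<Sum>l'\<in>UNIV. if l' = l then mon (z x) ((unit_index l)(l := 0)) * F x $ l / \<sigma> else 0)"
        by (intro sum.cong) auto
      also have "\<dots> = mon (z x) ((unit_index l)(l := 0)) * F x $ l / \<sigma>" by simp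
      also have "(unit_index l)(l := 0) = (\<lambda>_. 0)" by auto
      also have "mon (z x) (\<lambda>_. 0) = 1" by (rule mon_zero_index)
      finally show ?thesis by (simp only: mult_1)
    qed
    have "A_op F (feature \<kappa> \<sigma> x0 (unit_index l)) x / weight \<kappa> \<sigma> x0 x
        = F x $ l / \<sigma> - mon (z x) (unit_index l) * Q x" for x
      unfolding A S by simp
    then have "F x $ l = \<sigma> * (A_op F (feature \<kappa> \<sigma> x0 (unit_index l)) x / weight \<kappa> \<sigma> x0 x
        + mon (z x) (unit_index l) * Q x)" for x
      using \<sigma> by simp
    then show ?thesis
      using entire_bd_cmult[OF entire_bd_add[OF B entire_bd_mon_mult[OF BQ, of "unit_index l"]], of \<sigma>]
      by (auto simp: z_def)
  qed
  then obtain BF where BF: "\<And>l. entire_bd \<sigma> x0 (\<lambda>x. F x $ l) (BF l)" by metis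
  \<comment> \<open>Free of \<open>p\<close>: differentiating a monomial costs the factor
    \<open>p l\<close>, which is at most 2 to the degree of \<open>p\<close>. This is the origin of
    the 2 in \<open>2 * R\<close>.\<close>
  define T where "T = (\<lambda>R. (\<Sum>l\<in>UNIV. BF l R / \<sigma>) + BQ R)"
  have "entire_bd \<sigma> x0 (\<lambda>x. A_op F (feature \<kappa> \<sigma> x0 p) x / weight \<kappa> \<sigma> x0 x)
           (\<lambda>R. (2 * R) ^ sum p UNIV * T R)" for p
  proof (rule entire_bd_mono)
    show "entire_bd \<sigma> x0 (\<lambda>x. A_op F (feature \<kappa> \<sigma> x0 p) x / weight \<kappa> \<sigma> x0 x)
      (\<lambda>R. (\<Sum>l\<in>UNIV. \<bar>real (p l) / \<sigma>\<bar> * (R ^ sum (p(l := p l - 1)) UNIV * BF l R))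
        + \<bar>- 1\<bar> * (R ^ sum p UNIV * BQ R))"
      unfolding A z_def
      by (intro entire_bd_add entire_bd_sum entire_bd_cmult entire_bd_mon_mult BF BQ finite)
  next
    fix R :: real
    assume R: "R \<ge> 1"
    have nn: "0 \<le> BF l R" "0 \<le> BQ R" for l
      using entire_bd_nonneg[OF BF R] entire_bd_nonneg[OF BQ R] by auto
    have two: "1 \<le> (2::real) ^ sum p UNIV" by simp
    have "\<bar>real (p l) / \<sigma>\<bar> * (R ^ sum (p(l := p l - 1)) UNIV * BF l R) \<le> (2 * R) ^ sum p UNIV * (BF l R / \<sigma>)" for l
    proof -
      have "p l \<le> sum p UNIV" by (rule member_le_sum) auto
      also have "sum p UNIV \<le> 2 ^ sum p UNIV" by (rule less_imp_le[OF less_exp])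
      finally have "real (p l) \<le> 2 ^ sum p UNIV"
        by (metis of_nat_le_iff of_nat_numeral of_nat_power)
      moreover have "sum (p(l := p l - 1)) UNIV \<le> sum p UNIV" by (intro sum_mono) auto
      then have "R ^ sum (p(l := p l - 1)) UNIV \<le> R ^ sum p UNIV" using R by (intro power_increasing) auto
      ultimately have "real (p l) * R ^ sum (p(l := p l - 1)) UNIV \<le> 2 ^ sum p UNIV * R ^ sum p UNIV"
        using R by (intro mult_mono) auto
      from mult_right_mono[OF this, of "BF l R / \<sigma>"] show ?thesis
        using \<sigma> nn by (simp add: power_mult_distrib mult_ac)
    qed
    moreover have "\<bar>- 1\<bar> * (R ^ sum p UNIV * BQ R) \<le> (2 * R) ^ sum p UNIV * BQ R"
      using mult_right_mono[OF two, of "R ^ sum p UNIV * BQ R"] nn R by (simp add: power_mult_distrib mult_ac)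
    ultimately show "(\<Sum>l\<in>UNIV. \<bar>real (p l) / \<sigma>\<bar> * (R ^ sum (p(l := p l - 1)) UNIV * BF l R))
        + \<bar>- 1\<bar> * (R ^ sum p UNIV * BQ R) \<le> (2 * R) ^ sum p UNIV * T R"
      unfolding T_def distrib_left sum_distrib_left by (intro add_mono sum_mono)
  qed
  then show ?thesis by blast
qed

section \<open>Coefficients of polynomials and projections\<close>

lemma continuous_on_mon_zcoord: "continuous_on A (\<lambda>x. mon (zcoord \<sigma> x0 x) p)"
  unfolding mon_def zcoord_def divide_inverse by (intro continuous_intros)

lemma continuous_on_weight:
  fixes x0 :: "real ^ 'n::finite"
  shows "continuous_on A (weight \<kappa> \<sigma> x0)"
proof (cases \<kappa>)
  case Gaussian
  then have "weight \<kappa> \<sigma> x0 = (\<lambda>x. exp ((- 1 / (2 * \<sigma>\<^sup>2)) * (norm (x - x0))\<^sup>2))"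
    by (simp add: weight_def fun_eq_iff)
  then show ?thesis by (simp only:) (intro continuous_intros)
qed (simp add: weight_def)

lemma continuous_on_feature: "continuous_on A (feature \<kappa> \<sigma> x0 p)"
proof -
  have "feature \<kappa> \<sigma> x0 p = (\<lambda>x. weight \<kappa> \<sigma> x0 x * mon (zcoord \<sigma> x0 x) p)"
    by (simp add: feature_eq fun_eq_iff)
  then show ?thesis by (simp only:) (intro continuous_intros continuous_on_weight continuous_on_mon_zcoord)
qed

lemma borel_measurable_feature [measurable]: "feature \<kappa> \<sigma> x0 p \<in> borel_measurable borel"
  by (rule borel_measurable_continuous_onI[OF continuous_on_feature])

lemma nn_integral_lborel_translation:
  fixes t :: "'a::euclidean_space"
  assumes [measurable]: "g \<in> borel_measurable borel"
  shows "(\<integral>\<^sup>+x. g (t + x) \<partial>lborel) = (\<integral>\<^sup>+x. g x \<partial>lborel)"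
proof -
  have "(\<integral>\<^sup>+x. g x \<partial>lborel) = (\<integral>\<^sup>+x. g x \<partial>distr lborel borel ((+) t))"
    by (simp add: lborel_distr_plus)
  also have "\<dots> = (\<integral>\<^sup>+x. g (t + x) \<partial>lborel)"
    by (rule nn_integral_distr) auto
  finally show ?thesis by simp
qed

abbreviation cube :: "real ^ 'n::finite \<Rightarrow> real \<Rightarrow> (real ^ 'n) set" where
  "cube y h \<equiv> cbox y (y + h *\<^sub>R 1)"

lemma mem_cube: "x \<in> cube y h \<longleftrightarrow> (\<forall>l. y $ l \<le> x $ l \<and> x $ l \<le> y $ l + h)"
  by (simp add: mem_box_cart)

text \<open>Exact differentiation formulas on translated grids, averaged over the translation, bound the
  coefficients of a polynomial by its \<open>L\<^sup>1\<close>-norm on a cube that need not contain the centre.\<close>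

lemma coefficient_bound_lborel:
  fixes x0 y0 :: "real ^ 'n::finite"
  assumes \<sigma>: "0 < \<sigma>" and h: "0 < h"
  shows "\<exists>C\<ge>1. \<forall>D S c \<beta>. finite S \<longrightarrow> (\<forall>\<gamma>\<in>S. sum \<gamma> UNIV \<le> D) \<longrightarrow> \<beta> \<in> S \<longrightarrow>
    ennreal \<bar>c \<beta>\<bar> * emeasure lborel (cube y0 h)
      \<le> ennreal (C ^ D) * (\<integral>\<^sup>+x\<in>cube y0 (2 * h). ennreal \<bar>\<Sum>\<gamma>\<in>S. c \<gamma> * mon (zcoord \<sigma> x0 x) \<gamma>\<bar> \<partial>lborel)"
proof -
  \<comment> \<open>Bounds the scaled coordinates of every point of \<open>cube y0 h\<close>, so
    that one constant serves all translates of the grid.\<close>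
  define R where "R = (\<Sum>l\<in>UNIV. \<bar>zcoord \<sigma> x0 y0 l\<bar>) + h / \<sigma>"
  have "0 < h / \<sigma>" using h \<sigma> by simp
  from grid_weights[OF this, where R = R and 'n = 'n] obtain C :: real where C: "C \<ge> 1"
    and ex: "\<forall>D (s :: 'n \<Rightarrow> real) \<beta>. (\<forall>i. \<bar>s i\<bar> \<le> R) \<longrightarrow>
    (\<exists>w. (\<forall>\<gamma>\<in>grid D. (\<Sum>\<iota>\<in>grid D. w \<iota> * (\<Prod>i\<in>UNIV. (s i + real (\<iota> i) * (h / \<sigma>) / real D) ^ \<gamma> i))
                 = (if \<gamma> = \<beta> then 1 else 0)) \<and>
         (\<Sum>\<iota>\<in>grid D. \<bar>w \<iota>\<bar>) \<le> C ^ D)"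
    by (elim exE conjE) (rule that)
  show ?thesis
  proof (intro exI[of _ "C * 2 ^ CARD('n)"] conjI allI impI)
    have "1 * 1 \<le> C * 2 ^ CARD('n)" using C by (intro mult_mono) auto
    then show "1 \<le> C * 2 ^ CARD('n)" by simp
  next
    fix D :: nat and S :: "('n \<Rightarrow> nat) set" and c :: "('n \<Rightarrow> nat) \<Rightarrow> real" and \<beta> :: "'n \<Rightarrow> nat"
    assume S: "finite S" and deg: "\<forall>\<gamma>\<in>S. sum \<gamma> UNIV \<le> D" and \<beta>: "\<beta> \<in> S"
    define q where "q = (\<lambda>x. \<Sum>\<gamma>\<in>S. c \<gamma> * mon (zcoord \<sigma> x0 x) \<gamma>)"
    \<comment> \<open>Grid offsets between 0 and \<open>h\<close> in each coordinate: base points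
      from the cube of side \<open>h\<close> reach only nodes in the cube of side
      \<open>2 * h\<close>. In scaled coordinates the grid has side
      \<open>h / \<sigma>\<close>.\<close>
    define t :: "('n \<Rightarrow> nat) \<Rightarrow> real ^ 'n" where "t = (\<lambda>\<iota>. \<chi> l. real (\<iota> l) * h / real D)"
    have q_meas [measurable]: "q \<in> borel_measurable borel"
      unfolding q_def by (intro borel_measurable_continuous_onI continuous_intros continuous_on_mon_zcoord)
    have S_grid: "\<gamma> \<in> grid D" if "\<gamma> \<in> S" for \<gamma>
    proof -
      have "\<gamma> l \<le> D" for l
        using member_le_sum[of l UNIV \<gamma>] deg that by (meson UNIV_I finite le0 order_trans)
      then show ?thesis by auto
    qed
    have t_in: "t \<iota> + y \<in> cube y0 (2 * h)" if "\<iota> \<in> grid D" "y \<in> cube y0 h" for \<iota> y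
    proof -
      have "0 \<le> t \<iota> $ l \<and> t \<iota> $ l \<le> h" for l
      proof -
        have "real (\<iota> l) \<le> real D" using that(1) by auto
        then show ?thesis using h by (cases "D = 0") (auto simp: t_def field_simps)
      qed
      moreover have "y0 $ l \<le> y $ l \<and> y $ l \<le> y0 $ l + h" for l using that(2) by (simp add: mem_cube)
      ultimately show ?thesis unfolding mem_cube by (simp add: add_increasing) (smt (verit))
    qed
    have pointwise: "\<bar>c \<beta>\<bar> \<le> C ^ D * (\<Sum>\<iota>\<in>grid D. \<bar>q (t \<iota> + y)\<bar>)" if y: "y \<in> cube y0 h" for y
    proof -
      have "\<bar>zcoord \<sigma> x0 y i\<bar> \<le> R" for i
      proof -
        have "y0 $ i \<le> y $ i" "y $ i \<le> y0 $ i + h" using y by (auto simp: mem_cube)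
        moreover have "zcoord \<sigma> x0 y i = zcoord \<sigma> x0 y0 i + (y $ i - y0 $ i) / \<sigma>"
          by (simp add: zcoord_def diff_divide_distrib)
        ultimately have "\<bar>zcoord \<sigma> x0 y i\<bar> \<le> \<bar>zcoord \<sigma> x0 y0 i\<bar> + h / \<sigma>"
          using \<sigma> by (smt (verit) divide_nonneg_pos divide_right_mono)
        also have "\<bar>zcoord \<sigma> x0 y0 i\<bar> \<le> (\<Sum>l\<in>UNIV. \<bar>zcoord \<sigma> x0 y0 l\<bar>)"
          by (rule member_le_sum) auto
        finally show ?thesis by (simp add: R_def)
      qed
      then obtain w where w: "\<forall>\<gamma>\<in>grid D. (\<Sum>\<iota>\<in>grid D. w \<iota> *
          (\<Prod>i\<in>UNIV. (zcoord \<sigma> x0 y i + real (\<iota> i) * (h / \<sigma>) / real D) ^ \<gamma> i)) = (if \<gamma> = \<beta> then 1 else 0)"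
        and wC: "(\<Sum>\<iota>\<in>grid D. \<bar>w \<iota>\<bar>) \<le> C ^ D"
        using spec[OF spec[OF spec[OF ex, of D], of "zcoord \<sigma> x0 y"], of \<beta>] by blast
      have z: "zcoord \<sigma> x0 (t \<iota> + y) = (\<lambda>i. zcoord \<sigma> x0 y i + real (\<iota> i) * (h / \<sigma>) / real D)" for \<iota>
        by (simp add: zcoord_def t_def fun_eq_iff diff_divide_distrib add_divide_distrib)
      have "(\<Sum>\<iota>\<in>grid D. w \<iota> * q (t \<iota> + y))
          = (\<Sum>\<iota>\<in>grid D. \<Sum>\<gamma>\<in>S. c \<gamma> * (w \<iota> * mon (zcoord \<sigma> x0 (t \<iota> + y)) \<gamma>))"
        by (simp add: q_def sum_distrib_left mult.left_commute)
      also have "\<dots> = (\<Sum>\<gamma>\<in>S. c \<gamma> * (\<Sum>\<iota>\<in>grid D. w \<iota> * mon (zcoord \<sigma> x0 (t \<iota> + y)) \<gamma>))"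
        by (subst sum.swap) (simp add: sum_distrib_left)
      also have "\<dots> = (\<Sum>\<gamma>\<in>S. c \<gamma> * (if \<gamma> = \<beta> then 1 else 0))"
        by (intro sum.cong refl) (use w S_grid in \<open>simp add: mon_def z\<close>)
      also have "\<dots> = c \<beta>" using S \<beta> by (simp add: if_distrib[of "(*) _"] cong: if_cong)
      finally have "\<bar>c \<beta>\<bar> \<le> (\<Sum>\<iota>\<in>grid D. \<bar>w \<iota>\<bar> * \<bar>q (t \<iota> + y)\<bar>)"
        using sum_abs[of "\<lambda>\<iota>. w \<iota> * q (t \<iota> + y)" "grid D"] by (simp add: abs_mult)
      \<comment> \<open>The weights depend on the base point \<open>y\<close>. Replacing them by the
        common bound leaves an integrand in \<open>y\<close> that is plainly measurable.\<close>
      also have "\<dots> \<le> (\<Sum>\<iota>\<in>grid D. C ^ D * \<bar>q (t \<iota> + y)\<bar>)"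
      proof (intro sum_mono mult_right_mono)
        fix \<iota> :: "'n \<Rightarrow> nat" assume "\<iota> \<in> grid D"
        then have "\<bar>w \<iota>\<bar> \<le> (\<Sum>\<iota>\<in>grid D. \<bar>w \<iota>\<bar>)" by (rule member_le_sum) (auto intro: finite_grid)
        then show "\<bar>w \<iota>\<bar> \<le> C ^ D" using wC by linarith
      qed auto
      finally show ?thesis by (simp add: sum_distrib_left)
    qed
    define I where "I = (\<integral>\<^sup>+x\<in>cube y0 (2 * h). ennreal \<bar>q x\<bar> \<partial>lborel)"
    have "ennreal \<bar>c \<beta>\<bar> * emeasure lborel (cube y0 h) = (\<integral>\<^sup>+y\<in>cube y0 h. ennreal \<bar>c \<beta>\<bar> \<partial>lborel)"
      by (subst nn_integral_cmult_indicator) auto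
    also have "\<dots> \<le> (\<integral>\<^sup>+y. (\<Sum>\<iota>\<in>grid D. ennreal (C ^ D) * (ennreal \<bar>q (t \<iota> + y)\<bar> * indicator (cube y0 (2 * h)) (t \<iota> + y))) \<partial>lborel)"
    proof (rule nn_integral_mono)
      fix y
      show "ennreal \<bar>c \<beta>\<bar> * indicator (cube y0 h) y
        \<le> (\<Sum>\<iota>\<in>grid D. ennreal (C ^ D) * (ennreal \<bar>q (t \<iota> + y)\<bar> * indicator (cube y0 (2 * h)) (t \<iota> + y)))"
      proof (cases "y \<in> cube y0 h")
        case True
        have "ennreal \<bar>c \<beta>\<bar> \<le> ennreal (C ^ D * (\<Sum>\<iota>\<in>grid D. \<bar>q (t \<iota> + y)\<bar>))"
          using pointwise[OF True] by (rule ennreal_leI)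
        also have "\<dots> = (\<Sum>\<iota>\<in>grid D. ennreal (C ^ D) * ennreal \<bar>q (t \<iota> + y)\<bar>)"
          using C by (simp add: ennreal_mult sum_nonneg sum_distrib_left flip: sum_ennreal)
        also have "\<dots> = (\<Sum>\<iota>\<in>grid D. ennreal (C ^ D) * (ennreal \<bar>q (t \<iota> + y)\<bar> * indicator (cube y0 (2 * h)) (t \<iota> + y)))"
          by (intro sum.cong refl) (simp add: t_in[OF _ True])
        finally show ?thesis using True by simp
      qed simp
    qed
    also have "\<dots> = (\<Sum>\<iota>\<in>grid D. ennreal (C ^ D) *
        (\<integral>\<^sup>+y. ennreal \<bar>q (t \<iota> + y)\<bar> * indicator (cube y0 (2 * h)) (t \<iota> + y) \<partial>lborel))"
      by (subst nn_integral_sum) (auto intro!: sum.cong nn_integral_cmult)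
    \<comment> \<open>By translation invariance every node contributes the same integral, and the
      number of nodes grows only exponentially in D.\<close>
    also have "\<dots> = (\<Sum>\<iota>\<in>(grid D :: ('n \<Rightarrow> nat) set). ennreal (C ^ D) * I)"
      unfolding I_def
      by (intro sum.cong refl arg_cong2[where f = "(*)"]
        nn_integral_lborel_translation[of "\<lambda>x. ennreal \<bar>q x\<bar> * indicator (cube y0 (2 * h)) x"]) measurable
    also have "\<dots> = of_nat (Suc D ^ CARD('n)) * (ennreal (C ^ D) * I)"
      by (simp add: card_PiE)
    also have "\<dots> \<le> ennreal ((2 ^ CARD('n)) ^ D) * (ennreal (C ^ D) * I)"
    proof (rule mult_right_mono)
      have "Suc D \<le> 2 ^ D" by (simp add: Suc_leI)
      then have "Suc D ^ CARD('n) \<le> (2 ^ D) ^ CARD('n)" by (rule power_mono) simp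
      also have "(2 ^ D) ^ CARD('n) = ((2::nat) ^ CARD('n)) ^ D"
        by (simp only: power_mult[symmetric] mult.commute[of D])
      finally have "real (Suc D ^ CARD('n)) \<le> real ((2 ^ CARD('n)) ^ D)" by (simp only: of_nat_le_iff)
      then have "real (Suc D ^ CARD('n)) \<le> (2 ^ CARD('n)) ^ D" by simp
      then show "of_nat (Suc D ^ CARD('n)) \<le> ennreal ((2 ^ CARD('n)) ^ D)"
        unfolding ennreal_of_nat_eq_real_of_nat by (rule ennreal_leI)
    qed simp
    also have "\<dots> = ennreal ((C * 2 ^ CARD('n)) ^ D) * I"
      using C by (simp add: power_mult_distrib ennreal_mult mult_ac)
    finally show "ennreal \<bar>c \<beta>\<bar> * emeasure lborel (cube y0 h)
      \<le> ennreal ((C * 2 ^ CARD('n)) ^ D) *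
        (\<integral>\<^sup>+x\<in>cube y0 (2 * h). ennreal \<bar>\<Sum>\<gamma>\<in>S. c \<gamma> * mon (zcoord \<sigma> x0 x) \<gamma>\<bar> \<partial>lborel)"
      by (simp only: I_def q_def)
  qed
qed

text \<open>Collects what is used of the distribution of one sample: the scaled coordinates are
  bounded by \<open>R\<close>, and the law dominates \<open>\<delta>\<close> times Lebesgue measure
  on a cube. Domination is stated through integrals of nonnegative functions, which is the form in
  which it is applied.\<close>

locale sampling = prob_space \<mu> for \<mu> :: "(real ^ 'n::finite) measure" +
  fixes \<kappa> :: kernel_kind and \<sigma> :: real and x0 y0 :: "real ^ 'n" and h R \<delta> :: real
  assumes sets_\<mu> [measurable_cong]: "sets \<mu> = sets borel"
    and \<sigma>: "0 < \<sigma>" and h: "0 < h" and \<delta>: "0 < \<delta>" and R: "1 \<le> R"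
    and support: "AE x in \<mu>. \<forall>l. \<bar>zcoord \<sigma> x0 x l\<bar> \<le> R"
    and lower: "\<And>g. g \<in> borel_measurable borel \<Longrightarrow>
      ennreal \<delta> * (\<integral>\<^sup>+x\<in>cube y0 (2 * h). g x \<partial>lborel) \<le> (\<integral>\<^sup>+x. g x \<partial>\<mu>)"
begin

abbreviation v :: "('n \<Rightarrow> nat) \<Rightarrow> real ^ 'n \<Rightarrow> real" where
  "v \<equiv> feature \<kappa> \<sigma> x0"

text \<open>The bound for Lebesgue measure is transferred by \<open>lower\<close> at the cost of
  \<open>\<delta>\<close>, and from polynomials to features by the minimum \<open>m\<close> of the
  weight on the cube, positive by compactness. Together with the volume of the small cube these make
  up the constant A; the exponential rate C is unchanged.\<close>

lemma coefficient_bound: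
  shows "\<exists>A\<ge>0. \<exists>C\<ge>1. \<forall>D S c \<beta> E. finite S \<longrightarrow> (\<forall>\<gamma>\<in>S. sum \<gamma> UNIV \<le> D) \<longrightarrow> \<beta> \<in> S \<longrightarrow> 0 \<le> E \<longrightarrow>
    (\<integral>\<^sup>+x. ennreal \<bar>\<Sum>\<gamma>\<in>S. c \<gamma> * v \<gamma> x\<bar> \<partial>\<mu>) \<le> ennreal E \<longrightarrow> \<bar>c \<beta>\<bar> \<le> A * C ^ D * E"
proof -
  define B where "B = cube y0 (2 * h)"
  have "y0 \<in> B" using h by (simp add: B_def mem_cube)
  then have "\<exists>x\<in>B. \<forall>y\<in>B. weight \<kappa> \<sigma> x0 x \<le> weight \<kappa> \<sigma> x0 y"
    by (intro continuous_attains_inf continuous_on_weight) (auto simp: B_def)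
  then obtain m where m: "0 < m" and mw: "\<And>y. y \<in> B \<Longrightarrow> m \<le> weight \<kappa> \<sigma> x0 y"
    using weight_pos by blast
  define vol where "vol = h ^ CARD('n)"
  have vol: "0 < vol" using h by (simp add: vol_def)
  have em: "emeasure lborel (cube y0 h) = ennreal vol"
  proof -
    have "measure lborel (cube y0 h) = (\<Prod>i\<in>UNIV. (y0 + h *\<^sub>R 1) $ i - y0 $ i)"
    proof (rule content_cbox_cart)
      have "y0 \<in> cube y0 h" using h by (simp add: mem_cube)
      then show "cube y0 h \<noteq> {}" by blast
    qed
    then have "measure lborel (cube y0 h) = vol" by (simp add: vol_def)
    then show ?thesis
      using emeasure_eq_ennreal_measure[of lborel "cube y0 h"] emeasure_lborel_cbox_finite[of y0 "y0 + h *\<^sub>R 1"]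
      by (simp add: less_top)
  qed
  obtain C where C: "C \<ge> 1" and bd: "\<forall>D S c \<beta>. finite S \<longrightarrow> (\<forall>\<gamma>\<in>S. sum \<gamma> UNIV \<le> D) \<longrightarrow> \<beta> \<in> S \<longrightarrow>
    ennreal \<bar>c \<beta>\<bar> * emeasure lborel (cube y0 h)
      \<le> ennreal (C ^ D) * (\<integral>\<^sup>+x\<in>cube y0 (2 * h). ennreal \<bar>\<Sum>\<gamma>\<in>S. c \<gamma> * mon (zcoord \<sigma> x0 x) \<gamma>\<bar> \<partial>lborel)"
    using coefficient_bound_lborel[OF \<sigma> h, of y0 x0] by (elim exE conjE) (rule that)
  define A where "A = 1 / (vol * m * \<delta>)"
  have A: "0 \<le> A" using vol m \<delta> by (simp add: A_def)
  have "\<forall>D S c \<beta> E. finite S \<longrightarrow> (\<forall>\<gamma>\<in>S. sum \<gamma> UNIV \<le> D) \<longrightarrow> \<beta> \<in> S \<longrightarrow> 0 \<le> E \<longrightarrow>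
    (\<integral>\<^sup>+x. ennreal \<bar>\<Sum>\<gamma>\<in>S. c \<gamma> * v \<gamma> x\<bar> \<partial>\<mu>) \<le> ennreal E \<longrightarrow> \<bar>c \<beta>\<bar> \<le> A * C ^ D * E"
  proof (intro allI impI)
    fix D :: nat and S :: "('n \<Rightarrow> nat) set" and c :: "('n \<Rightarrow> nat) \<Rightarrow> real" and \<beta> :: "'n \<Rightarrow> nat" and E :: real
    assume S: "finite S" and deg: "\<forall>\<gamma>\<in>S. sum \<gamma> UNIV \<le> D" and \<beta>: "\<beta> \<in> S" and E: "0 \<le> E"
      and le: "(\<integral>\<^sup>+x. ennreal \<bar>\<Sum>\<gamma>\<in>S. c \<gamma> * v \<gamma> x\<bar> \<partial>\<mu>) \<le> ennreal E"
    define q where "q = (\<lambda>x. \<Sum>\<gamma>\<in>S. c \<gamma> * mon (zcoord \<sigma> x0 x) \<gamma>)"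
    have vq: "(\<Sum>\<gamma>\<in>S. c \<gamma> * v \<gamma> x) = weight \<kappa> \<sigma> x0 x * q x" for x
      by (simp add: q_def feature_eq sum_distrib_left mult_ac)
    have [measurable]: "(\<lambda>x. \<Sum>\<gamma>\<in>S. c \<gamma> * v \<gamma> x) \<in> borel_measurable borel" by measurable
    have [measurable]: "q \<in> borel_measurable borel"
      unfolding q_def by (intro borel_measurable_continuous_onI continuous_intros continuous_on_mon_zcoord)
    define I where "I = (\<integral>\<^sup>+x\<in>B. ennreal \<bar>q x\<bar> \<partial>lborel)"
    have "ennreal (\<delta> * m) * I = ennreal \<delta> * (ennreal m * I)"
      using \<delta> m by (simp add: ennreal_mult mult.assoc)
    also have "ennreal m * I = (\<integral>\<^sup>+x. ennreal m * (ennreal \<bar>q x\<bar> * indicator B x) \<partial>lborel)"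
      unfolding I_def by (rule nn_integral_cmult[symmetric]) (simp add: B_def)
    also have "\<dots> \<le> (\<integral>\<^sup>+x\<in>B. ennreal \<bar>\<Sum>\<gamma>\<in>S. c \<gamma> * v \<gamma> x\<bar> \<partial>lborel)"
    proof (rule nn_integral_mono)
      fix x
      show "ennreal m * (ennreal \<bar>q x\<bar> * indicator B x) \<le> ennreal \<bar>\<Sum>\<gamma>\<in>S. c \<gamma> * v \<gamma> x\<bar> * indicator B x"
        using mw[of x] m mult_right_mono[OF mw[of x], of "\<bar>q x\<bar>"] weight_pos[of \<kappa> \<sigma> x0 x]
        by (auto simp: vq abs_mult split: split_indicator simp flip: ennreal_mult' intro!: ennreal_leI)
    qed
    also have "ennreal \<delta> * \<dots> \<le> (\<integral>\<^sup>+x. ennreal \<bar>\<Sum>\<gamma>\<in>S. c \<gamma> * v \<gamma> x\<bar> \<partial>\<mu>)"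
      unfolding B_def by (rule lower) measurable
    also have "\<dots> \<le> ennreal E" by (rule le)
    finally have I: "ennreal (\<delta> * m) * I \<le> ennreal E" by (simp add: mult_left_mono)
    have "ennreal (\<delta> * m * \<bar>c \<beta>\<bar> * vol) = ennreal (\<delta> * m) * (ennreal \<bar>c \<beta>\<bar> * emeasure lborel (cube y0 h))"
      using \<delta> m vol by (simp add: em ennreal_mult mult_ac)
    also have "\<dots> \<le> ennreal (\<delta> * m) * (ennreal (C ^ D) * I)"
      using bd S deg \<beta> unfolding I_def B_def q_def by (intro mult_left_mono) auto
    also have "\<dots> = ennreal (C ^ D) * (ennreal (\<delta> * m) * I)" by (simp only: mult_ac)
    also have "\<dots> \<le> ennreal (C ^ D) * ennreal E" by (intro mult_left_mono I) simp
    also have "\<dots> = ennreal (C ^ D * E)" using C E by (simp add: ennreal_mult)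
    finally have "\<delta> * m * \<bar>c \<beta>\<bar> * vol \<le> C ^ D * E" using C E by (simp add: ennreal_le_iff)
    then show "\<bar>c \<beta>\<bar> \<le> A * C ^ D * E"
      using \<delta> m vol by (simp add: A_def field_simps)
  qed
  with A C show ?thesis by blast
qed

text \<open>Almost surely bounded functions form an algebra of integrable functions containing the
  features, so all integrability goals below reduce to closure rules.\<close>

definition bounded_measurable :: "(real ^ 'n \<Rightarrow> real) \<Rightarrow> bool" where
  "bounded_measurable g \<longleftrightarrow> g \<in> borel_measurable borel \<and> (\<exists>B. AE x in \<mu>. \<bar>g x\<bar> \<le> B)"

lemma bounded_measurable_integrable: "bounded_measurable g \<Longrightarrow> integrable \<mu> g"
  unfolding bounded_measurable_def by (elim conjE exE, rule integrable_const_bound) auto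

lemma bounded_measurable_mult:
  assumes "bounded_measurable f" "bounded_measurable g"
  shows "bounded_measurable (\<lambda>x. f x * g x)"
proof -
  obtain B where [measurable]: "f \<in> borel_measurable borel" and B: "AE x in \<mu>. \<bar>f x\<bar> \<le> B"
    using assms(1) unfolding bounded_measurable_def by blast
  obtain B' where [measurable]: "g \<in> borel_measurable borel" and B': "AE x in \<mu>. \<bar>g x\<bar> \<le> B'"
    using assms(2) unfolding bounded_measurable_def by blast
  have "AE x in \<mu>. \<bar>f x * g x\<bar> \<le> B * B'"
    using B B' by eventually_elim (auto simp: abs_mult intro!: mult_mono)
  then show ?thesis unfolding bounded_measurable_def by (auto intro: exI[of _ "B * B'"])
qed

lemma bounded_measurable_add:
  assumes "bounded_measurable f" "bounded_measurable g"
  shows "bounded_measurable (\<lambda>x. f x + g x)"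
proof -
  obtain B where [measurable]: "f \<in> borel_measurable borel" and B: "AE x in \<mu>. \<bar>f x\<bar> \<le> B"
    using assms(1) unfolding bounded_measurable_def by blast
  obtain B' where [measurable]: "g \<in> borel_measurable borel" and B': "AE x in \<mu>. \<bar>g x\<bar> \<le> B'"
    using assms(2) unfolding bounded_measurable_def by blast
  have "AE x in \<mu>. \<bar>f x + g x\<bar> \<le> B + B'"
    using B B' by eventually_elim linarith
  then show ?thesis unfolding bounded_measurable_def by (auto intro: exI[of _ "B + B'"])
qed

lemma bounded_measurable_const: "bounded_measurable (\<lambda>_. c)"
  unfolding bounded_measurable_def by auto

lemma bounded_measurable_diff:
  assumes "bounded_measurable f" "bounded_measurable g"
  shows "bounded_measurable (\<lambda>x. f x - g x)"
  using bounded_measurable_add[OF assms(1) bounded_measurable_mult[OF bounded_measurable_const[of "- 1"] assms(2)]]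
  by simp

lemma bounded_measurable_sum:
  assumes "\<And>s. s \<in> S \<Longrightarrow> bounded_measurable (f s)"
  shows "bounded_measurable (\<lambda>x. \<Sum>s\<in>S. f s x)"
  using assms
  by (induction S rule: infinite_finite_induct) (auto intro: bounded_measurable_add bounded_measurable_const)

lemma bounded_measurable_v: "bounded_measurable (v p)"
proof -
  have "AE x in \<mu>. \<bar>v p x\<bar> \<le> R ^ sum p UNIV"
    using support
  proof eventually_elim
    case (elim x)
    have "\<bar>v p x\<bar> = weight \<kappa> \<sigma> x0 x * \<bar>mon (zcoord \<sigma> x0 x) p\<bar>"
      using weight_pos[of \<kappa> \<sigma> x0 x] by (simp add: feature_eq abs_mult)
    also have "\<dots> \<le> 1 * R ^ sum p UNIV"
      using elim weight_pos[of \<kappa> \<sigma> x0 x] weight_le_1[of \<kappa> \<sigma> x0 x] by (intro mult_mono abs_mon_le) auto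
    finally show ?case by simp
  qed
  then show ?thesis unfolding bounded_measurable_def by auto
qed

lemmas bounded_measurable_intros = bounded_measurable_diff bounded_measurable_add
  bounded_measurable_mult bounded_measurable_sum bounded_measurable_const bounded_measurable_v

text \<open>If \<open>p\<close> is the \<open>L\<^sup>2\<close>-projection of \<open>f\<close> and \<open>t\<close> its Taylor truncation, both of degree at most \<open>D\<close>,
  then \<open>p - t\<close> is no larger in \<open>L\<^sup>2\<close> than \<open>f - t\<close>. The factor \<open>C ^ D\<close> lost in passing to the
  coefficients is absorbed by the Taylor tail, which involves only degrees at least \<open>D\<close>.\<close>

lemma projection_coefficients:
  fixes f :: "real ^ 'n \<Rightarrow> real" and a :: "('n \<Rightarrow> nat) \<Rightarrow> real" and \<alpha> :: "nat \<Rightarrow> 'n \<Rightarrow> nat"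
  assumes f [measurable]: "f \<in> borel_measurable borel"
    and summable: "\<And>T. T \<ge> 1 \<Longrightarrow> (\<lambda>\<beta>. \<bar>a \<beta>\<bar> * T ^ sum \<beta> UNIV) summable_on UNIV"
    and expansion: "\<And>x. ((\<lambda>\<beta>. a \<beta> * mon (zcoord \<sigma> x0 x) \<beta>) has_sum f x / weight \<kappa> \<sigma> x0 x) UNIV"
    and \<alpha>: "bij_betw \<alpha> UNIV UNIV" "\<And>i j. i \<le> j \<Longrightarrow> sum (\<alpha> i) UNIV \<le> sum (\<alpha> j) UNIV"
    and A: "0 \<le> A" and C: "1 \<le> C"
    and bd: "\<And>D S c \<beta> E. finite S \<Longrightarrow> (\<forall>\<gamma>\<in>S. sum \<gamma> UNIV \<le> D) \<Longrightarrow> \<beta> \<in> S \<Longrightarrow> 0 \<le> E \<Longrightarrow>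
        (\<integral>\<^sup>+x. ennreal \<bar>\<Sum>\<gamma>\<in>S. c \<gamma> * v \<gamma> x\<bar> \<partial>\<mu>) \<le> ennreal E \<Longrightarrow> \<bar>c \<beta>\<bar> \<le> A * C ^ D * E"
    and orth: "\<And>i. i < r \<Longrightarrow> (\<integral>x. (f x - (\<Sum>j<r. b j * v (\<alpha> j) x)) * v (\<alpha> i) x \<partial>\<mu>) = 0"
    and j: "j < r"
  shows "\<bar>b j - a (\<alpha> j)\<bar> \<le> A * (\<Sum>\<^sub>\<infinity>\<beta>\<in>- \<alpha> ` {..<r}. \<bar>a \<beta>\<bar> * (C * R) ^ sum \<beta> UNIV)"
proof -
  define G where "G = \<alpha> ` {..<r}"
  \<comment> \<open>The degree of the last of the first \<open>r\<close> multi-indices. The grading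
    gives degrees at most D in \<open>G\<close> and at least D outside; neither bound is strict
    because \<open>r\<close> may cut through a degree.\<close>
  define D where "D = sum (\<alpha> (r - 1)) UNIV"
  have inj: "inj \<alpha>" and surj: "surj \<alpha>" using \<alpha>(1) by (auto simp: bij_betw_def)
  have D_le: "sum \<beta> UNIV \<le> D" if "\<beta> \<in> G" for \<beta>
    using that \<alpha>(2) by (auto simp: G_def D_def)
  have D_ge: "D \<le> sum \<beta> UNIV" if "\<beta> \<notin> G" for \<beta>
  proof -
    obtain i where i: "\<beta> = \<alpha> i" using surj by auto
    then have "r \<le> i" using that by (auto simp: G_def not_less)
    then show ?thesis using \<alpha>(2)[of "r - 1" i] by (simp add: D_def i)
  qed
  define \<epsilon> where "\<epsilon> = (\<Sum>\<^sub>\<infinity>\<beta>\<in>- G. \<bar>a \<beta>\<bar> * R ^ sum \<beta> UNIV)"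
  have \<epsilon>0: "0 \<le> \<epsilon>" unfolding \<epsilon>_def using R by (intro infsum_nonneg) auto
  define e where "e = (\<lambda>x. f x - (\<Sum>i<r. a (\<alpha> i) * v (\<alpha> i) x))"
  \<comment> \<open>The projection minus the truncated Taylor series; hence \<open>e - q\<close> is
    the projection residual, orthogonal to \<open>q\<close>.\<close>
  define q where "q = (\<lambda>x. \<Sum>i<r. (b i - a (\<alpha> i)) * v (\<alpha> i) x)"
  have [measurable]: "e \<in> borel_measurable borel" unfolding e_def by measurable
  have e_le: "AE x in \<mu>. \<bar>e x\<bar> \<le> \<epsilon>"
    using support
  proof eventually_elim
    case (elim x)
    define z where "z = zcoord \<sigma> x0 x"
    have le: "\<bar>a \<beta> * mon z \<beta>\<bar> \<le> \<bar>a \<beta>\<bar> * R ^ sum \<beta> UNIV" for \<beta>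
      using abs_mon_le[of z R \<beta>] elim by (auto simp: abs_mult z_def intro!: mult_left_mono)
    have s: "(\<lambda>\<beta>. \<bar>a \<beta> * mon z \<beta>\<bar>) summable_on B" for B
      by (rule summable_on_subset[of _ UNIV]) (rule summable_on_comparison_test[OF summable[OF R]], use le in auto)
    have "((\<lambda>\<beta>. a \<beta> * mon z \<beta>) has_sum (\<Sum>\<^sub>\<infinity>\<beta>\<in>- G. a \<beta> * mon z \<beta>)) (- G)"
      by (rule has_sum_infsum, rule abs_summable_summable) (simp add: s)
    moreover have "((\<lambda>\<beta>. a \<beta> * mon z \<beta>) has_sum (\<Sum>\<beta>\<in>G. a \<beta> * mon z \<beta>)) G"
      by (intro has_sum_finite) (simp add: G_def)
    ultimately have "((\<lambda>\<beta>. a \<beta> * mon z \<beta>) has_sum ((\<Sum>\<beta>\<in>G. a \<beta> * mon z \<beta>) + (\<Sum>\<^sub>\<infinity>\<beta>\<in>- G. a \<beta> * mon z \<beta>))) (G \<union> - G)"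
      by (intro has_sum_Un_disjoint) auto
    then have "f x / weight \<kappa> \<sigma> x0 x = (\<Sum>\<beta>\<in>G. a \<beta> * mon z \<beta>) + (\<Sum>\<^sub>\<infinity>\<beta>\<in>- G. a \<beta> * mon z \<beta>)"
      using has_sum_unique[OF expansion[of x]] by (simp add: z_def)
    moreover have "(\<Sum>i<r. a (\<alpha> i) * v (\<alpha> i) x) = weight \<kappa> \<sigma> x0 x * (\<Sum>\<beta>\<in>G. a \<beta> * mon z \<beta>)"
      unfolding G_def by (subst sum.reindex) (auto simp: inj_on_subset[OF inj] feature_eq z_def sum_distrib_left mult_ac)
    ultimately have "e x = weight \<kappa> \<sigma> x0 x * (\<Sum>\<^sub>\<infinity>\<beta>\<in>- G. a \<beta> * mon z \<beta>)"
      using weight_pos[of \<kappa> \<sigma> x0 x] by (simp add: e_def field_simps)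
    then have "\<bar>e x\<bar> = weight \<kappa> \<sigma> x0 x * \<bar>\<Sum>\<^sub>\<infinity>\<beta>\<in>- G. a \<beta> * mon z \<beta>\<bar>"
      using weight_pos[of \<kappa> \<sigma> x0 x] by (simp add: abs_mult)
    also have "\<dots> \<le> 1 * \<bar>\<Sum>\<^sub>\<infinity>\<beta>\<in>- G. a \<beta> * mon z \<beta>\<bar>"
      by (intro mult_right_mono weight_le_1) auto
    also have "\<bar>\<Sum>\<^sub>\<infinity>\<beta>\<in>- G. a \<beta> * mon z \<beta>\<bar> \<le> (\<Sum>\<^sub>\<infinity>\<beta>\<in>- G. \<bar>a \<beta> * mon z \<beta>\<bar>)"
      using norm_infsum_bound[of "\<lambda>\<beta>. a \<beta> * mon z \<beta>" "- G"] s by simp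
    also have "\<dots> \<le> \<epsilon>"
      unfolding \<epsilon>_def by (intro infsum_mono s le summable_on_subset[OF summable[OF R]]) auto
    finally show ?case by simp
  qed
  have be: "bounded_measurable e" unfolding bounded_measurable_def using e_le by auto
  have bq: "bounded_measurable q" unfolding q_def by (intro bounded_measurable_intros)
  have [measurable]: "q \<in> borel_measurable borel" using bq by (simp add: bounded_measurable_def)
  have eq_int: "(\<integral>x. (e x - q x) * q x \<partial>\<mu>) = 0"
  proof -
    have eq: "e x - q x = f x - (\<Sum>j<r. b j * v (\<alpha> j) x)" for x
      by (simp add: e_def q_def left_diff_distrib sum_subtractf)
    have "(\<integral>x. (e x - q x) * q x \<partial>\<mu>) = (\<integral>x. (\<Sum>i<r. (b i - a (\<alpha> i)) * ((e x - q x) * v (\<alpha> i) x)) \<partial>\<mu>)"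
    proof (rule Bochner_Integration.integral_cong[OF refl])
      fix x
      have "y * q x = (\<Sum>i<r. (b i - a (\<alpha> i)) * (y * v (\<alpha> i) x))" for y
        by (simp add: q_def sum_distrib_left mult_ac)
      then show "(e x - q x) * q x = (\<Sum>i<r. (b i - a (\<alpha> i)) * ((e x - q x) * v (\<alpha> i) x))" .
    qed
    also have "\<dots> = (\<Sum>i<r. (\<integral>x. (b i - a (\<alpha> i)) * ((e x - q x) * v (\<alpha> i) x) \<partial>\<mu>))"
      by (intro Bochner_Integration.integral_sum bounded_measurable_integrable bounded_measurable_intros be bq)
    also have "\<dots> = (\<Sum>i<r. (b i - a (\<alpha> i)) * (\<integral>x. (e x - q x) * v (\<alpha> i) x \<partial>\<mu>))"
      by simp
    also have "\<dots> = 0" by (intro sum.neutral ballI) (use orth in \<open>simp add: eq\<close>)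
    finally show ?thesis .
  qed
  have q2: "(\<integral>x. (q x)\<^sup>2 \<partial>\<mu>) \<le> \<epsilon>\<^sup>2"
  proof -
    have i1: "integrable \<mu> (\<lambda>x. (e x)\<^sup>2)" "integrable \<mu> (\<lambda>x. (q x)\<^sup>2)" "integrable \<mu> (\<lambda>x. (e x - q x) * q x)"
      unfolding power2_eq_square by (intro bounded_measurable_integrable bounded_measurable_intros be bq)+
    \<comment> \<open>The integrand on the left is
      \<open>(e x)\<^sup>2 - (e x - q x)\<^sup>2\<close>, and its mixed term integrates to 0 by
      orthogonality: the Pythagorean estimate.\<close>
    have "(\<integral>x. (q x)\<^sup>2 + 2 * ((e x - q x) * q x) \<partial>\<mu>) \<le> (\<integral>x. (e x)\<^sup>2 \<partial>\<mu>)"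
    proof (rule integral_mono)
      show "(q x)\<^sup>2 + 2 * ((e x - q x) * q x) \<le> (e x)\<^sup>2" for x
        using zero_le_power2[of "e x - q x"] by (simp add: power2_eq_square algebra_simps)
    qed (intro i1 Bochner_Integration.integrable_add integrable_mult_right)+
    moreover have "(\<integral>x. (q x)\<^sup>2 + 2 * ((e x - q x) * q x) \<partial>\<mu>) = (\<integral>x. (q x)\<^sup>2 \<partial>\<mu>)"
      using i1 eq_int by simp
    moreover have "(\<integral>x. (e x)\<^sup>2 \<partial>\<mu>) \<le> \<epsilon>\<^sup>2"
    proof (rule integral_le_const[OF i1(1)])
      show "AE x in \<mu>. (e x)\<^sup>2 \<le> \<epsilon>\<^sup>2"
        using e_le by eventually_elim (use \<epsilon>0 in \<open>intro abs_le_square_iff[THEN iffD1], simp\<close>)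
    qed
    ultimately show ?thesis by linarith
  qed
  have babs: "bounded_measurable (\<lambda>x. \<bar>q x\<bar>)"
    using bq unfolding bounded_measurable_def by auto
  \<comment> \<open>Nonnegativity of the variance of the modulus of \<open>q\<close> compares the
    two norms under a probability measure.\<close>
  have "(\<integral>x. \<bar>q x\<bar> \<partial>\<mu>)\<^sup>2 \<le> (\<integral>x. (q x)\<^sup>2 \<partial>\<mu>)"
  proof -
    have i: "integrable \<mu> (\<lambda>x. \<bar>q x\<bar>)" "integrable \<mu> (\<lambda>x. \<bar>q x\<bar>\<^sup>2)"
      using babs bounded_measurable_mult[OF babs babs] unfolding power2_eq_square
      by (auto intro: bounded_measurable_integrable)
    then show ?thesis
      using variance_eq[OF i] variance_positive[of "\<lambda>x. \<bar>q x\<bar>"] by simp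
  qed
  then have "(\<integral>x. \<bar>q x\<bar> \<partial>\<mu>)\<^sup>2 \<le> \<epsilon>\<^sup>2" using q2 by linarith
  then have q1: "(\<integral>x. \<bar>q x\<bar> \<partial>\<mu>) \<le> \<epsilon>" using \<epsilon>0 by (rule power2_le_imp_le)
  define c where "c = (\<lambda>\<gamma>. b (inv_into UNIV \<alpha> \<gamma>) - a \<gamma>)"
  have c\<alpha>: "c (\<alpha> i) = b i - a (\<alpha> i)" for i by (simp add: c_def inv_f_f[OF inj])
  have q_sum: "q x = (\<Sum>\<gamma>\<in>G. c \<gamma> * v \<gamma> x)" for x
    unfolding q_def G_def by (subst sum.reindex) (auto simp: inj_on_subset[OF inj] c\<alpha>)
  have "\<bar>c (\<alpha> j)\<bar> \<le> A * C ^ D * \<epsilon>"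
  proof (rule bd)
    show "(\<integral>\<^sup>+x. ennreal \<bar>\<Sum>\<gamma>\<in>G. c \<gamma> * v \<gamma> x\<bar> \<partial>\<mu>) \<le> ennreal \<epsilon>"
      unfolding q_sum[symmetric]
      by (subst nn_integral_eq_integral) (auto intro: bounded_measurable_integrable[OF babs] ennreal_leI q1)
  qed (use j D_le \<epsilon>0 in \<open>auto simp: G_def\<close>)
  also have "A * C ^ D * \<epsilon> = A * (\<Sum>\<^sub>\<infinity>\<beta>\<in>- G. C ^ D * (\<bar>a \<beta>\<bar> * R ^ sum \<beta> UNIV))"
    unfolding \<epsilon>_def by (simp add: infsum_cmult_right' mult.assoc)
  \<comment> \<open>Outside \<open>G\<close> the degree is at least D, so \<open>C ^ D\<close> can
    be moved into the radius.\<close>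
  also have "\<dots> \<le> A * (\<Sum>\<^sub>\<infinity>\<beta>\<in>- G. \<bar>a \<beta>\<bar> * (C * R) ^ sum \<beta> UNIV)"
  proof (intro mult_left_mono infsum_mono A)
    show "(\<lambda>\<beta>. C ^ D * (\<bar>a \<beta>\<bar> * R ^ sum \<beta> UNIV)) summable_on - G"
      by (intro summable_on_cmult_right summable_on_subset[OF summable[OF R]]) auto
    have "1 * 1 \<le> C * R" using C R by (intro mult_mono) auto
    then show "(\<lambda>\<beta>. \<bar>a \<beta>\<bar> * (C * R) ^ sum \<beta> UNIV) summable_on - G"
      by (intro summable_on_subset[OF summable]) auto
    fix \<beta> assume "\<beta> \<in> - G"
    then have "C ^ D \<le> C ^ sum \<beta> UNIV" using C D_ge by (intro power_increasing) auto
    then show "C ^ D * (\<bar>a \<beta>\<bar> * R ^ sum \<beta> UNIV) \<le> \<bar>a \<beta>\<bar> * (C * R) ^ sum \<beta> UNIV"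
      using R mult_right_mono[of "C ^ D" "C ^ sum \<beta> UNIV" "\<bar>a \<beta>\<bar> * R ^ sum \<beta> UNIV"]
      by (simp add: power_mult_distrib mult_ac)
  qed
  finally show ?thesis by (simp add: c\<alpha> G_def)
qed

end

section \<open>Law of large numbers and least squares\<close>

text \<open>For bounded variables Hoeffding's inequality makes the probability of a deviation by
  \<open>\<epsilon>\<close> geometrically small in N, so Borel-Cantelli applies; the sequence
  \<open>1 / Suc k\<close> reduces all \<open>\<epsilon>\<close> to countably many.\<close>

lemma (in prob_space) strong_law_bounded:
  fixes X :: "nat \<Rightarrow> 'a \<Rightarrow> real"
  assumes indep: "indep_vars (\<lambda>_. borel) X UNIV"
    and id: "\<And>i. distr M borel (X i) = distr M borel (X 0)"
    and bd: "AE x in M. \<bar>X 0 x\<bar> \<le> B"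
  shows "AE \<omega> in M. (\<lambda>N. (\<Sum>i<N. X i \<omega>) / real N) \<longlonglongrightarrow> expectation (X 0)"
proof -
  \<comment> \<open>The added 1 keeps the interval from \<open>- b\<close> to \<open>b\<close>
    nondegenerate, hence the Hoeffding exponent well defined and negative.\<close>
  define b where "b = \<bar>B\<bar> + 1"
  have b: "0 < b" by (simp add: b_def)
  have rv [measurable]: "random_variable borel (X i)" for i
    using indep unfolding indep_vars_def by blast
  have conc: "prob {x \<in> space M. \<epsilon> \<le> \<bar>(\<Sum>i<N. X i x) / real N - expectation (X 0)\<bar>}
      \<le> 2 * exp (- 2 * real N * \<epsilon>\<^sup>2 / (b - (- b))\<^sup>2)" if N: "0 < N" and \<epsilon>: "0 < \<epsilon>" for N \<epsilon>
  proof -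
    interpret H: Hoeffding_ineq_iid M "{..<N}" X "X 0" "- b" b "expectation (X 0)"
    proof unfold_locales
      show "indep_vars (\<lambda>_. borel) X {..<N}" by (rule indep_vars_subset[OF indep]) auto
      show "AE x in M. X 0 x \<in> {- b..b}" using bd by eventually_elim (auto simp: b_def)
      show "distr M borel (X i) = distr M borel (X 0)" for i by (rule id)
    qed auto
    show ?thesis using H.Hoeffding_ineq_abs_ge'[of \<epsilon>] b N \<epsilon> by (simp add: lessThan_empty_iff del: H.expectation_X)
  qed
  have "AE \<omega> in M. eventually (\<lambda>N. \<bar>(\<Sum>i<N. X i \<omega>) / real N - expectation (X 0)\<bar> < \<epsilon>) sequentially"
    if \<epsilon>: "0 < \<epsilon>" for \<epsilon>
  proof -
    define A where "A = (\<lambda>N. {x \<in> space M. \<epsilon> \<le> \<bar>(\<Sum>i<N. X i x) / real N - expectation (X 0)\<bar>})"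
    have [measurable]: "A N \<in> sets M" for N unfolding A_def by measurable
    define r where "r = exp (- 2 * \<epsilon>\<^sup>2 / (b - (- b))\<^sup>2)"
    have r: "0 < r" "r < 1" using \<epsilon> b by (auto simp: r_def)
    have "summable (\<lambda>N. 2 * r ^ N)" using r by (intro summable_mult summable_geometric) auto
    moreover have "norm (measure M (A N)) \<le> 2 * r ^ N" if "1 \<le> N" for N
    proof -
      have "r ^ N = exp (- 2 * real N * \<epsilon>\<^sup>2 / (b - (- b))\<^sup>2)"
        unfolding r_def exp_of_nat_mult[symmetric] by (rule arg_cong[of _ _ exp]) simp
      then show ?thesis using conc[of N \<epsilon>] that \<epsilon> by (simp add: A_def)
    qed
    ultimately have "summable (\<lambda>N. measure M (A N))"
      by (rule summable_comparison_test'[of "\<lambda>N. 2 * r ^ N" 1])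
    then have "AE x in M. eventually (\<lambda>N. x \<in> space M - A N) sequentially"
      by (rule borel_cantelli_AE1[rotated 2]) (simp_all add: emeasure_eq_measure)
    then show ?thesis
    proof eventually_elim
      case (elim \<omega>)
      then show ?case by (rule eventually_mono) (simp add: A_def not_le)
    qed
  qed
  then have "AE \<omega> in M. \<forall>k. eventually (\<lambda>N. \<bar>(\<Sum>i<N. X i \<omega>) / real N - expectation (X 0)\<bar> < 1 / real (Suc k)) sequentially"
    unfolding AE_all_countable by (intro allI) simp
  then show ?thesis
  proof eventually_elim
    case (elim \<omega>)
    show ?case
    proof (rule metric_LIMSEQ_I)
      fix r :: real assume "0 < r"
      then obtain k where k: "1 / real (Suc k) < r" by (rule nat_approx_posE)
      have "eventually (\<lambda>N. dist ((\<Sum>i<N. X i \<omega>) / real N) (expectation (X 0)) < r) sequentially"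
        using spec[OF elim, of k] by (rule eventually_mono) (use k in \<open>simp add: dist_real_def\<close>)
      then show "\<exists>no. \<forall>n\<ge>no. dist ((\<Sum>i<n. X i \<omega>) / real n) (expectation (X 0)) < r"
        by (simp add: eventually_sequentially)
    qed
  qed
qed

lemma (in prob_space) empirical_means_converge:
  fixes X :: "nat \<Rightarrow> 'a \<Rightarrow> 'b::topological_space" and g :: "'b \<Rightarrow> real"
  assumes indep: "indep_vars (\<lambda>_. borel) X UNIV"
    and id: "\<And>i. distr M borel (X i) = \<mu>"
    and g [measurable]: "g \<in> borel_measurable borel"
    and bd: "AE x in \<mu>. \<bar>g x\<bar> \<le> B"
  shows "AE \<omega> in M. (\<lambda>N. (\<Sum>i<N. g (X i \<omega>)) / real N) \<longlonglongrightarrow> (\<integral>x. g x \<partial>\<mu>)"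
proof -
  have rv [measurable]: "random_variable borel (X i)" for i
    using indep unfolding indep_vars_def by blast
  have \<mu>: "\<mu> = distr M borel (X i)" for i by (rule id[symmetric])
  have E: "expectation (\<lambda>\<omega>. g (X 0 \<omega>)) = (\<integral>x. g x \<partial>\<mu>)"
    unfolding \<mu>[of 0] by (rule integral_distr[symmetric]) auto
  have D: "distr M borel (\<lambda>\<omega>. g (X i \<omega>)) = distr \<mu> borel g" for i
    unfolding \<mu>[of i] by (subst distr_distr) (auto simp: comp_def)
  have B: "AE \<omega> in M. \<bar>g (X 0 \<omega>)\<bar> \<le> B"
    using bd unfolding \<mu>[of 0] by (subst (asm) AE_distr_iff) auto
  have ind: "indep_vars (\<lambda>_. borel) (\<lambda>i \<omega>. g (X i \<omega>)) UNIV"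
    by (rule indep_vars_compose2[OF indep]) simp
  show ?thesis
    unfolding E[symmetric] by (rule strong_law_bounded[OF ind _ B]) (simp only: D)
qed

section \<open>Entrywise limits of determinants and inverses\<close>

lemma tendsto_det:
  fixes A :: "nat \<Rightarrow> real mat"
  assumes "\<And>k. A k \<in> carrier_mat n n" "B \<in> carrier_mat n n"
    and "\<And>i j. i < n \<Longrightarrow> j < n \<Longrightarrow> (\<lambda>k. A k $$ (i, j)) \<longlonglongrightarrow> B $$ (i, j)"
  shows "(\<lambda>k. det (A k)) \<longlonglongrightarrow> det B"
  unfolding det_def'[OF assms(1)] det_def'[OF assms(2)]
proof (intro tendsto_intros assms(3))
  fix p i
  assume "p \<in> {p. p permutes {0..<n}}" "i \<in> {0..<n}"
  then show "p i < n" using permutes_in_image[of p "{0..<n}" i] by simp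
qed simp

lemma tendsto_adj_mat:
  fixes A :: "nat \<Rightarrow> real mat"
  assumes A: "\<And>k. A k \<in> carrier_mat n n" and B: "B \<in> carrier_mat n n"
    and lim: "\<And>i j. i < n \<Longrightarrow> j < n \<Longrightarrow> (\<lambda>k. A k $$ (i, j)) \<longlonglongrightarrow> B $$ (i, j)"
    and ij: "i < n" "j < n"
  shows "(\<lambda>k. adj_mat (A k) $$ (i, j)) \<longlonglongrightarrow> adj_mat B $$ (i, j)"
proof -
  have dims: "dim_row (A k) = n" "dim_col (A k) = n" "dim_row B = n" "dim_col B = n" for k
    using A[of k] B by auto
  have "(\<lambda>k. det (mat_delete (A k) j i)) \<longlonglongrightarrow> det (mat_delete B j i)"
  proof (rule tendsto_det)
    show "mat_delete (A k) j i \<in> carrier_mat (n - 1) (n - 1)" for k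
      using A by (rule mat_delete_carrier)
    show "mat_delete B j i \<in> carrier_mat (n - 1) (n - 1)" using B by (rule mat_delete_carrier)
    fix i' j' assume "i' < n - 1" "j' < n - 1"
    then show "(\<lambda>k. mat_delete (A k) j i $$ (i', j')) \<longlonglongrightarrow> mat_delete B j i $$ (i', j')"
      by (auto simp: mat_delete_def dims intro!: lim)
  qed
  then show ?thesis
    using ij by (auto simp: adj_mat_def dims cofactor_def intro!: tendsto_intros)
qed

text \<open>Cramer's rule. The entries are rational functions of those of the matrix, so entrywise
  limits pass through wherever the limiting determinant is nonzero; elimination, which branches on
  pivots, would hide this.\<close>

definition adj_inverse :: "real mat \<Rightarrow> real mat" where
  "adj_inverse A = (1 / det A) \<cdot>\<^sub>m adj_mat A"

lemma adj_inverse: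
  assumes A: "A \<in> carrier_mat n n" and det: "det A \<noteq> 0"
  shows "adj_inverse A \<in> carrier_mat n n" "A * adj_inverse A = 1\<^sub>m n" "adj_inverse A * A = 1\<^sub>m n"
proof -
  define S where "S = adj_inverse A"
  note S_def = S_def[unfolded adj_inverse_def]
  note adj = adj_mat[OF A]
  have "S \<in> carrier_mat n n" using adj(1) by (simp add: S_def)
  then show "adj_inverse A \<in> carrier_mat n n" by (simp add: adj_inverse_def S_def)
  have "A * S = (1 / det A) \<cdot>\<^sub>m (A * adj_mat A)"
    unfolding S_def using A adj(1) by (rule mult_smult_distrib)
  then have "A * S = 1\<^sub>m n" using adj det by (auto intro!: eq_matI)
  then show "A * adj_inverse A = 1\<^sub>m n" by (simp add: adj_inverse_def S_def)
  have "S * A = (1 / det A) \<cdot>\<^sub>m (adj_mat A * A)"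
    unfolding S_def using adj(1) A by (rule mult_smult_assoc_mat)
  then have "S * A = 1\<^sub>m n" using adj det by (auto intro!: eq_matI)
  then show "adj_inverse A * A = 1\<^sub>m n" by (simp add: adj_inverse_def S_def)
qed

text \<open>With S the inverse of V times its transpose, the candidate is a right inverse of V,
  which settles the two product identities and the symmetry of the first product. The symmetry of
  the second needs \<open>S\<close> symmetric, which holds because \<open>S\<close> inverts a
  symmetric matrix.\<close>

lemma pinv_full_row_rank:
  fixes V :: "real mat"
  assumes V: "V \<in> carrier_mat n N" and S: "S \<in> carrier_mat n n"
    and inv: "V * transpose_mat V * S = 1\<^sub>m n" "S * (V * transpose_mat V) = 1\<^sub>m n"
  shows "pinv V = transpose_mat V * S"
proof (rule pinv_eqI)
  define T where "T = transpose_mat V"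
  have T: "T \<in> carrier_mat N n" using V by (simp add: T_def)
  have VT: "V * T \<in> carrier_mat n n" and TS: "T * S \<in> carrier_mat N n" using V T S by auto
  have sym: "transpose_mat (V * T) = V * T"
    unfolding T_def by (subst transpose_mult[OF V]) (use V in auto)
  have St: "transpose_mat S \<in> carrier_mat n n" using S by simp
  have "transpose_mat (S * (V * T)) = V * T * transpose_mat S"
    by (subst transpose_mult[OF S VT]) (simp only: sym)
  then have VTSt: "V * T * transpose_mat S = 1\<^sub>m n"
    using inv(2) by (simp add: T_def)
  have "transpose_mat S = S * (V * T) * transpose_mat S" using inv(2) St by (simp add: T_def)
  also have "\<dots> = S * (V * T * transpose_mat S)" by (rule assoc_mult_mat[OF S VT St])
  also have "\<dots> = S" using S VTSt by simp
  finally have S_sym: "transpose_mat S = S" .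
  have VB: "V * (T * S) = 1\<^sub>m n" using assoc_mult_mat[OF V T S] inv(1) by (simp add: T_def)
  have BV: "T * S * V \<in> carrier_mat N N" using TS V by simp
  have SV: "S * V \<in> carrier_mat n N" using S V by simp
  have "transpose_mat (T * S * V) = transpose_mat V * transpose_mat (T * S)"
    by (rule transpose_mult[OF TS V])
  also have "transpose_mat (T * S) = transpose_mat S * transpose_mat T" by (rule transpose_mult[OF T S])
  also have "transpose_mat T = V" by (simp add: T_def)
  also have "transpose_mat V * (transpose_mat S * V) = T * S * V"
    unfolding S_sym T_def[symmetric] by (rule assoc_mult_mat[OF T S V, symmetric])
  finally have BV_sym: "transpose_mat (T * S * V) = T * S * V" .
  have BVB: "T * S * V * (T * S) = T * S"
    using assoc_mult_mat[OF TS V TS] VB right_mult_one_mat[OF TS] by simp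
  show "is_pinv V (transpose_mat V * S)"
    unfolding is_pinv_def T_def[symmetric]
    using V TS VB BV_sym BVB by auto
qed

section \<open>Iterated limits\<close>

text \<open>Normalising both cross products by N turns the least-squares solution into a product of
  empirical averages. Their limits exist by assumption, and since G is nonsingular the empirical
  Gram matrix is eventually so too, whence the pseudo-inverse has its closed form.\<close>

lemma least_squares_limit:
  fixes V W :: "nat \<Rightarrow> real mat"
  assumes V: "\<And>N. V N \<in> carrier_mat r N" and W: "\<And>N. W N \<in> carrier_mat m N"
    and G: "G \<in> carrier_mat r r" and C: "C \<in> carrier_mat m r" and det: "det G \<noteq> 0"
    and VV: "\<And>i j. i < r \<Longrightarrow> j < r \<Longrightarrow>
      (\<lambda>N. (\<Sum>t<N. V N $$ (i, t) * V N $$ (j, t)) / real N) \<longlonglongrightarrow> G $$ (i, j)"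
    and WV: "\<And>i j. i < m \<Longrightarrow> j < r \<Longrightarrow>
      (\<lambda>N. (\<Sum>t<N. W N $$ (i, t) * V N $$ (j, t)) / real N) \<longlonglongrightarrow> C $$ (i, j)"
    and ij: "i < m" "j < r"
  shows "(\<lambda>N. (W N * pinv (V N)) $$ (i, j)) \<longlonglongrightarrow> (C * adj_inverse G) $$ (i, j)"
proof -
  define A where "A = (\<lambda>N. (1 / real N) \<cdot>\<^sub>m (V N * transpose_mat (V N)))"
  define D where "D = (\<lambda>N. (1 / real N) \<cdot>\<^sub>m (W N * transpose_mat (V N)))"
  have Vt: "transpose_mat (V N) \<in> carrier_mat N r" for N using V by simp
  have VVt: "V N * transpose_mat (V N) \<in> carrier_mat r r" for N using V Vt by (rule mult_carrier_mat)
  have WVt: "W N * transpose_mat (V N) \<in> carrier_mat m r" for N using W Vt by (rule mult_carrier_mat)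
  have A: "A N \<in> carrier_mat r r" and D: "D N \<in> carrier_mat m r" for N
    using VVt[of N] WVt[of N] by (auto simp: A_def D_def)
  have AX: "A N * X = (1 / real N) \<cdot>\<^sub>m (V N * transpose_mat (V N) * X)" if "X \<in> carrier_mat r r" for N X
    unfolding A_def by (rule mult_smult_assoc_mat[OF VVt that])
  have XA: "X * A N = (1 / real N) \<cdot>\<^sub>m (X * (V N * transpose_mat (V N)))" if "X \<in> carrier_mat r r" for N X
    unfolding A_def by (rule mult_smult_distrib[OF that VVt])
  have DX: "D N * X = (1 / real N) \<cdot>\<^sub>m (W N * transpose_mat (V N) * X)" if "X \<in> carrier_mat r r" for N X
    unfolding D_def by (rule mult_smult_assoc_mat[OF WVt that])
  have dims: "dim_row (V N) = r" "dim_col (V N) = N" "dim_row (W N) = m" "dim_col (W N) = N" for N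
    using V[of N] W[of N] by auto
  have A_entry: "A N $$ (i, j) = (\<Sum>t<N. V N $$ (i, t) * V N $$ (j, t)) / real N" if "i < r" "j < r" for N i j
    using that by (simp add: A_def dims scalar_prod_def atLeast0LessThan)
  have D_entry: "D N $$ (i, j) = (\<Sum>t<N. W N $$ (i, t) * V N $$ (j, t)) / real N" if "i < m" "j < r" for N i j
    using that by (simp add: D_def dims scalar_prod_def atLeast0LessThan)
  have A_lim: "(\<lambda>N. A N $$ (i, j)) \<longlonglongrightarrow> G $$ (i, j)" if "i < r" "j < r" for i j
    using VV[OF that] by (simp add: A_entry that)
  have D_lim: "(\<lambda>N. D N $$ (i, j)) \<longlonglongrightarrow> C $$ (i, j)" if "i < m" "j < r" for i j
    using WV[OF that] by (simp add: D_entry that)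
  have det_lim: "(\<lambda>N. det (A N)) \<longlonglongrightarrow> det G" by (rule tendsto_det[OF A G A_lim])
  then have "eventually (\<lambda>N. det (A N) \<noteq> 0) sequentially"
    using det by (rule tendsto_imp_eventually_ne)
  then have ev: "eventually (\<lambda>N. W N * pinv (V N) = D N * adj_inverse (A N)) sequentially"
    using eventually_gt_at_top[of 0]
  proof eventually_elim
    case (elim N)
    note I = adj_inverse[OF A elim(1)]
    \<comment> \<open>The inverse of the unnormalised Gram matrix: \<open>A N\<close> contains the
      factor 1/N, so its inverse has to be divided by N.\<close>
    define S where "S = (1 / real N) \<cdot>\<^sub>m adj_inverse (A N)"
    have S: "S \<in> carrier_mat r r" using I(1) by (simp add: S_def)
    have "V N * transpose_mat (V N) * S = (1 / real N) \<cdot>\<^sub>m (V N * transpose_mat (V N) * adj_inverse (A N))"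
      unfolding S_def by (rule mult_smult_distrib[OF VVt I(1)])
    also have "\<dots> = A N * adj_inverse (A N)"
      by (rule AX[OF I(1), symmetric])
    finally have S1: "V N * transpose_mat (V N) * S = 1\<^sub>m r" using I(2) by simp
    have "S * (V N * transpose_mat (V N)) = (1 / real N) \<cdot>\<^sub>m (adj_inverse (A N) * (V N * transpose_mat (V N)))"
      unfolding S_def by (rule mult_smult_assoc_mat[OF I(1) VVt])
    also have "\<dots> = adj_inverse (A N) * A N"
      by (rule XA[OF I(1), symmetric])
    finally have S2: "S * (V N * transpose_mat (V N)) = 1\<^sub>m r" using I(3) by simp
    have "W N * pinv (V N) = W N * (transpose_mat (V N) * S)"
      by (simp only: pinv_full_row_rank[OF V S S1 S2])
    also have "\<dots> = W N * transpose_mat (V N) * S" by (rule assoc_mult_mat[symmetric, OF W Vt S])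
    also have "\<dots> = (1 / real N) \<cdot>\<^sub>m (W N * transpose_mat (V N) * adj_inverse (A N))"
      unfolding S_def by (rule mult_smult_distrib[OF WVt I(1)])
    also have "\<dots> = D N * adj_inverse (A N)"
      by (rule DX[OF I(1), symmetric])
    finally show ?case .
  qed
  have entry: "(X * adj_inverse Y) $$ (i, j) = (\<Sum>k<r. X $$ (i, k) * (1 / det Y * adj_mat Y $$ (k, j)))"
    if X: "X \<in> carrier_mat m r" and Y: "Y \<in> carrier_mat r r" and ij: "i < m" "j < r" for X Y i j
    using X Y adj_mat(1)[OF Y] ij by (auto simp: adj_inverse_def scalar_prod_def atLeast0LessThan)
  show ?thesis
  proof (rule Lim_transform_eventually)
    show "(\<lambda>N. (D N * adj_inverse (A N)) $$ (i, j)) \<longlonglongrightarrow> (C * adj_inverse G) $$ (i, j)"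
      unfolding entry[OF D A ij] entry[OF C G ij]
      by (intro tendsto_intros D_lim det_lim det tendsto_adj_mat[OF A G A_lim]) (use ij in auto)
    show "eventually (\<lambda>N. (D N * adj_inverse (A N)) $$ (i, j) = (W N * pinv (V N)) $$ (i, j)) sequentially"
      using ev by (rule eventually_mono) simp
  qed
qed

lemma sup_dist_on_le:
  assumes "\<And>y. y \<in> K \<Longrightarrow> norm (f y - g y) \<le> e"
  shows "sup_dist_on K f g \<le> ennreal e"
  unfolding sup_dist_on_def using assms by (intro SUP_least ennreal_leI) auto

lemma sup_dist_on_triangle:
  assumes "\<And>y. y \<in> K \<Longrightarrow> norm (g y - g' y) \<le> e" "0 \<le> e"
  shows "sup_dist_on K f g' \<le> sup_dist_on K f g + ennreal e"
  unfolding sup_dist_on_def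
proof (rule SUP_least)
  fix y assume y: "y \<in> K"
  have "norm (f y - g' y) \<le> norm (f y - g y) + e"
    using norm_triangle_ineq[of "f y - g y" "g y - g' y"] assms(1)[OF y] by simp
  then have "ennreal (norm (f y - g' y)) \<le> ennreal (norm (f y - g y)) + ennreal e"
    using assms(2) by (metis ennreal_leI ennreal_plus norm_ge_zero)
  also have "\<dots> \<le> (SUP y\<in>K. ennreal (norm (f y - g y))) + ennreal e"
    using y by (intro add_right_mono SUP_upper)
  finally show "ennreal (norm (f y - g' y)) \<le> (SUP y\<in>K. ennreal (norm (f y - g y))) + ennreal e" .
qed

text \<open>Uniform convergence moves the supremum by at most \<open>e k\<close> in either
  direction. Finiteness of the limiting supremum allows the lower estimate to be written with real
  subtraction before returning to \<open>ennreal\<close>.\<close>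

lemma sup_dist_on_tendsto:
  fixes e :: "nat \<Rightarrow> real"
  assumes fin: "sup_dist_on K f g < \<top>"
    and e: "e \<longlonglongrightarrow> 0" and le: "\<forall>\<^sub>F k in sequentially. \<forall>y\<in>K. norm (gs k y - g y) \<le> e k"
  shows "(\<lambda>k. sup_dist_on K f (gs k)) \<longlonglongrightarrow> sup_dist_on K f g"
proof -
  define E where "E = (\<lambda>k. \<bar>e k\<bar>)"
  have E: "E \<longlonglongrightarrow> 0" unfolding E_def using e by (rule tendsto_rabs_zero)
  have le': "\<forall>\<^sub>F k in sequentially. \<forall>y\<in>K. norm (gs k y - g y) \<le> E k"
    using le by (rule eventually_mono) (auto simp: E_def intro: order_trans[OF _ abs_ge_self])
  define s where "s = enn2real (sup_dist_on K f g)"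
  have s: "sup_dist_on K f g = ennreal s" using fin by (simp add: s_def)
  have s0: "0 \<le> s" by (simp add: s_def)
  have up: "sup_dist_on K f (gs k) \<le> ennreal (s + E k)" and low: "ennreal (s - E k) \<le> sup_dist_on K f (gs k)"
    if k: "\<forall>y\<in>K. norm (gs k y - g y) \<le> E k" for k
  proof -
    have E0: "0 \<le> E k" by (simp add: E_def)
    have "sup_dist_on K f (gs k) \<le> sup_dist_on K f g + ennreal (E k)"
      by (rule sup_dist_on_triangle[OF _ E0]) (use k in \<open>simp add: norm_minus_commute\<close>)
    then show "sup_dist_on K f (gs k) \<le> ennreal (s + E k)" using s s0 E0 by simp
    have "sup_dist_on K f g \<le> sup_dist_on K f (gs k) + ennreal (E k)"
      by (rule sup_dist_on_triangle[OF _ E0]) (use k in simp)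
    then have "ennreal s - ennreal (E k) \<le> sup_dist_on K f (gs k)"
      unfolding s by (simp add: ennreal_minus_le_iff add.commute)
    then show "ennreal (s - E k) \<le> sup_dist_on K f (gs k)" using s0 E0 by (simp add: ennreal_minus)
  qed
  show ?thesis
  proof (rule tendsto_sandwich)
    show "\<forall>\<^sub>F k in sequentially. ennreal (s - E k) \<le> sup_dist_on K f (gs k)"
      using le' by (rule eventually_mono) (rule low)
    show "\<forall>\<^sub>F k in sequentially. sup_dist_on K f (gs k) \<le> ennreal (s + E k)"
      using le' by (rule eventually_mono) (rule up)
    show "(\<lambda>k. ennreal (s - E k)) \<longlonglongrightarrow> sup_dist_on K f g"
      unfolding s using tendsto_diff[OF tendsto_const[of s] E] by (intro tendsto_ennrealI) simp
    show "(\<lambda>k. ennreal (s + E k)) \<longlonglongrightarrow> sup_dist_on K f g"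
      unfolding s using tendsto_add[OF tendsto_const[of s] E] by (intro tendsto_ennrealI) simp
  qed
qed

lemma filterlim_square:
  assumes r: "filterlim r at_top sequentially"
  shows "filterlim (\<lambda>m. {..<r m} \<times> {..<r m}) (finite_subsets_at_top (UNIV :: (nat \<times> nat) set)) sequentially"
  unfolding filterlim_finite_subsets_at_top
proof (intro allI impI)
  fix X :: "(nat \<times> nat) set"
  assume "finite X \<and> X \<subseteq> UNIV"
  then have X: "finite X" by simp
  define M where "M = Suc (\<Sum>p\<in>X. fst p + snd p)"
  have XM: "X \<subseteq> {..<M} \<times> {..<M}"
  proof
    fix p assume "p \<in> X"
    then have "fst p + snd p \<le> (\<Sum>p\<in>X. fst p + snd p)" using X by (intro member_le_sum) auto
    then show "p \<in> {..<M} \<times> {..<M}" by (cases p) (auto simp: M_def)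
  qed
  have "\<forall>\<^sub>F m in sequentially. M \<le> r m" using r by (simp add: filterlim_at_top)
  then show "\<forall>\<^sub>F m in sequentially. finite ({..<r m} \<times> {..<r m}) \<and> X \<subseteq> {..<r m} \<times> {..<r m} \<and> {..<r m} \<times> {..<r m} \<subseteq> UNIV"
  proof (rule eventually_mono)
    fix m assume "M \<le> r m"
    then have "{..<M} \<times> {..<M} \<subseteq> {..<r m} \<times> {..<r m}" by auto
    with XM show "finite ({..<r m} \<times> {..<r m}) \<and> X \<subseteq> {..<r m} \<times> {..<r m} \<and> {..<r m} \<times> {..<r m} \<subseteq> UNIV"
      by blast
  qed
qed

text \<open>For fixed m the output is a finite linear combination of fixed functions, bounded on
  \<open>K\<close>, so entrywise convergence of the coefficients is uniform on \<open>K\<close>;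
  this gives the two inner limits. In the outer limit the error is a tail of an absolutely summable
  double series, cut off along squares.\<close>

lemma iterated_sup_limits:
  fixes F :: "real ^ 'n::finite \<Rightarrow> real ^ 'n" and \<psi> :: "'n \<Rightarrow> nat \<Rightarrow> nat \<Rightarrow> real ^ 'n \<Rightarrow> real"
  assumes P: "\<And>l i j y. y \<in> K \<Longrightarrow> \<bar>\<psi> l i j y\<bar> \<le> P l i j"
    and summ: "\<And>l. (\<lambda>(i, j). \<bar>a i j\<bar> * P l i j) summable_on UNIV"
    and total: "\<And>l y. y \<in> K \<Longrightarrow> ((\<lambda>(i, j). a i j * \<psi> l i j y) has_sum (F y $ l)) UNIV"
    and r: "filterlim r at_top sequentially"
    and B: "\<And>i j. (\<lambda>n. B n i j) \<longlonglongrightarrow> a i j"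
    and A: "\<And>m n i j. 1 \<le> m \<Longrightarrow> m \<le> n \<Longrightarrow> i < r m \<Longrightarrow> j < r m \<Longrightarrow> (\<lambda>N. A m n N i j) \<longlonglongrightarrow> B n i j"
    and Fh: "\<And>m n N y l. 1 \<le> m \<Longrightarrow> Fh m n N y $ l = (\<Sum>i<r m. \<Sum>j<r m. A m n N i j * \<psi> l i j y)"
  shows "\<exists>(L :: nat \<Rightarrow> nat \<Rightarrow> ennreal) (L' :: nat \<Rightarrow> ennreal).
      (\<forall>m n. 1 \<le> m \<longrightarrow> m \<le> n \<longrightarrow> L m n < \<top> \<and>
        (\<lambda>N. sup_dist_on K F (Fh m n N)) \<longlonglongrightarrow> L m n) \<and>
      (\<forall>m. 1 \<le> m \<longrightarrow> L' m < \<top> \<and> (\<lambda>n. L m n) \<longlonglongrightarrow> L' m) \<and>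
      L' \<longlonglongrightarrow> 0"
proof -
  \<comment> \<open>The output as a function of an arbitrary coefficient matrix; the three stages
    differ only in the matrix inserted: empirical \<open>A m n N\<close>, projected
    \<open>B n\<close>, exact \<open>a\<close>.\<close>
  define \<Phi> :: "nat \<Rightarrow> (nat \<Rightarrow> nat \<Rightarrow> real) \<Rightarrow> real ^ 'n \<Rightarrow> real ^ 'n"
    where "\<Phi> = (\<lambda>m A y. \<chi> l. \<Sum>i<r m. \<Sum>j<r m. A i j * \<psi> l i j y)"
  have dist: "norm (\<Phi> m X y - \<Phi> m Y y) \<le> (\<Sum>l\<in>UNIV. \<Sum>i<r m. \<Sum>j<r m. \<bar>X i j - Y i j\<bar> * P l i j)"
    if y: "y \<in> K" for m X Y y
  proof -
    have "norm (\<Phi> m X y - \<Phi> m Y y) \<le> (\<Sum>l\<in>UNIV. \<bar>(\<Phi> m X y - \<Phi> m Y y) $ l\<bar>)" by (rule norm_le_l1_cart)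
    also have "\<dots> \<le> (\<Sum>l\<in>UNIV. \<Sum>i<r m. \<Sum>j<r m. \<bar>X i j - Y i j\<bar> * P l i j)"
    proof (rule sum_mono)
      fix l
      have "(\<Phi> m X y - \<Phi> m Y y) $ l = (\<Sum>i<r m. \<Sum>j<r m. (X i j - Y i j) * \<psi> l i j y)"
        by (simp add: \<Phi>_def sum_subtractf left_diff_distrib)
      also have "\<bar>\<dots>\<bar> \<le> (\<Sum>i<r m. \<Sum>j<r m. \<bar>(X i j - Y i j) * \<psi> l i j y\<bar>)"
        by (rule order_trans[OF sum_abs], rule sum_mono, rule sum_abs)
      also have "\<dots> \<le> (\<Sum>i<r m. \<Sum>j<r m. \<bar>X i j - Y i j\<bar> * P l i j)"
        unfolding abs_mult by (rule sum_mono, rule sum_mono, rule mult_left_mono[OF P[OF y]]) simp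
      finally show "\<bar>(\<Phi> m X y - \<Phi> m Y y) $ l\<bar> \<le> (\<Sum>i<r m. \<Sum>j<r m. \<bar>X i j - Y i j\<bar> * P l i j)" .
    qed
    finally show ?thesis .
  qed
  have dist_lim: "(\<lambda>k. \<Sum>l\<in>UNIV. \<Sum>i<r m. \<Sum>j<r m. \<bar>Xs k i j - Y i j\<bar> * P l i j) \<longlonglongrightarrow> 0"
    if "\<And>i j. i < r m \<Longrightarrow> j < r m \<Longrightarrow> (\<lambda>k. Xs k i j) \<longlonglongrightarrow> Y i j" for m Y and Xs :: "nat \<Rightarrow> nat \<Rightarrow> nat \<Rightarrow> real"
  proof (rule tendsto_null_sum, rule tendsto_null_sum, rule tendsto_null_sum)
    fix l i j assume "i \<in> {..<r m}" "j \<in> {..<r m}"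
    then have "(\<lambda>k. \<bar>Xs k i j - Y i j\<bar> * P l i j) \<longlonglongrightarrow> \<bar>Y i j - Y i j\<bar> * P l i j"
      by (intro tendsto_intros that) auto
    then show "(\<lambda>k. \<bar>Xs k i j - Y i j\<bar> * P l i j) \<longlonglongrightarrow> 0" by simp
  qed
  define tail where "tail = (\<lambda>m. \<Sum>l\<in>UNIV. \<Sum>\<^sub>\<infinity>(i, j)\<in>- ({..<r m} \<times> {..<r m}). \<bar>a i j\<bar> * P l i j)"
  have tail: "tail \<longlonglongrightarrow> 0"
    unfolding tail_def
    by (rule tendsto_null_sum) (rule filterlim_compose[OF infsum_Compl_tendsto_0[OF summ] filterlim_square[OF r]])
  have err: "norm (F y - \<Phi> m a y) \<le> tail m" if y: "y \<in> K" for m y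
  proof -
    define S where "S = {..<r m} \<times> {..<r m}"
    have "norm (F y - \<Phi> m a y) \<le> (\<Sum>l\<in>UNIV. \<bar>(F y - \<Phi> m a y) $ l\<bar>)" by (rule norm_le_l1_cart)
    also have "\<dots> \<le> tail m"
      unfolding tail_def
    proof (rule sum_mono)
      fix l
      define f where "f = (\<lambda>(i, j). a i j * \<psi> l i j y)"
      have le: "\<bar>f p\<bar> \<le> (case p of (i, j) \<Rightarrow> \<bar>a i j\<bar> * P l i j)" for p
        using P[OF y] by (cases p) (auto simp: f_def abs_mult intro!: mult_left_mono)
      have abs: "(\<lambda>p. \<bar>f p\<bar>) summable_on X" for X
        by (rule summable_on_subset[of _ UNIV], rule summable_on_comparison_test[OF summ[of l]]) (use le in auto)
      have "(f has_sum (\<Sum>\<^sub>\<infinity>p\<in>- S. f p)) (- S)"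
        by (rule has_sum_infsum, rule abs_summable_summable) (simp add: abs)
      moreover have "(f has_sum sum f S) S" by (rule has_sum_finite) (simp add: S_def)
      ultimately have "(f has_sum (sum f S + (\<Sum>\<^sub>\<infinity>p\<in>- S. f p))) (S \<union> - S)"
        by (intro has_sum_Un_disjoint) auto
      then have "F y $ l = sum f S + (\<Sum>\<^sub>\<infinity>p\<in>- S. f p)"
        using has_sum_unique[OF total[OF y, of l]] by (simp add: f_def)
      moreover have "\<Phi> m a y $ l = sum f S"
        by (simp add: \<Phi>_def S_def f_def sum.cartesian_product)
      ultimately have "\<bar>(F y - \<Phi> m a y) $ l\<bar> = \<bar>\<Sum>\<^sub>\<infinity>p\<in>- S. f p\<bar>" by simp
      also have "\<dots> \<le> (\<Sum>\<^sub>\<infinity>p\<in>- S. \<bar>f p\<bar>)"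
        using norm_infsum_bound[of f "- S"] abs by simp
      also have "\<dots> \<le> (\<Sum>\<^sub>\<infinity>(i, j)\<in>- S. \<bar>a i j\<bar> * P l i j)"
        by (rule infsum_mono[OF abs summable_on_subset[OF summ[of l]] le]) simp
      finally show "\<bar>(F y - \<Phi> m a y) $ l\<bar> \<le> (\<Sum>\<^sub>\<infinity>(i, j)\<in>- ({..<r m} \<times> {..<r m}). \<bar>a i j\<bar> * P l i j)"
        by (simp only: S_def)
    qed
    finally show ?thesis .
  qed
  have fin: "sup_dist_on K F (\<Phi> m X) < \<top>" for m X
  proof -
    have "sup_dist_on K F (\<Phi> m X) \<le> ennreal (tail m + (\<Sum>l\<in>UNIV. \<Sum>i<r m. \<Sum>j<r m. \<bar>a i j - X i j\<bar> * P l i j))"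
    proof (rule sup_dist_on_le)
      fix y assume y: "y \<in> K"
      show "norm (F y - \<Phi> m X y) \<le> tail m + (\<Sum>l\<in>UNIV. \<Sum>i<r m. \<Sum>j<r m. \<bar>a i j - X i j\<bar> * P l i j)"
        using norm_triangle_ineq[of "F y - \<Phi> m a y" "\<Phi> m a y - \<Phi> m X y"] err[OF y, of m] dist[OF y, of m a X]
        by simp
    qed
    then show ?thesis by (rule le_less_trans) simp
  qed
  have Fh\<Phi>: "Fh m n N = \<Phi> m (A m n N)" if "1 \<le> m" for m n N
    by (rule ext, subst Finite_Cartesian_Product.vec_eq_iff) (simp add: \<Phi>_def Fh[OF that])
  \<comment> \<open>The inner limit inserts the projection coefficients, the middle one the Taylor
    coefficients, both still truncated to size \<open>r m\<close>.\<close>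
  show ?thesis
  proof (intro exI[of _ "\<lambda>m n. sup_dist_on K F (\<Phi> m (B n))"] exI[of _ "\<lambda>m. sup_dist_on K F (\<Phi> m a)"] conjI allI impI fin)
    fix m n :: nat assume mn: "1 \<le> m" "m \<le> n"
    show "(\<lambda>N. sup_dist_on K F (Fh m n N)) \<longlonglongrightarrow> sup_dist_on K F (\<Phi> m (B n))"
      unfolding Fh\<Phi>[OF mn(1)]
      by (rule sup_dist_on_tendsto[OF fin dist_lim[of m "\<lambda>N. A m n N" "B n", OF A[OF mn]]]) (auto intro!: always_eventually dist)
  next
    fix m :: nat
    show "(\<lambda>n. sup_dist_on K F (\<Phi> m (B n))) \<longlonglongrightarrow> sup_dist_on K F (\<Phi> m a)"
      by (rule sup_dist_on_tendsto[OF fin dist_lim[of m B a, OF B]]) (auto intro!: always_eventually dist)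
  next
    show "(\<lambda>m. sup_dist_on K F (\<Phi> m a)) \<longlonglongrightarrow> 0"
    proof (rule tendsto_sandwich[OF _ _ tendsto_const])
      show "\<forall>\<^sub>F m in sequentially. sup_dist_on K F (\<Phi> m a) \<le> ennreal (tail m)"
        by (auto intro!: always_eventually sup_dist_on_le err)
      show "(\<lambda>m. ennreal (tail m)) \<longlonglongrightarrow> 0"
        using tendsto_ennrealI[OF tail] by simp
    qed simp
  qed
qed

section \<open>The output of the algorithm\<close>

lemma Suc_le_binomial_add: "1 \<le> d \<Longrightarrow> Suc m \<le> (m + d) choose d"
proof (induction d rule: dec_induct)
  case (step d)
  then show ?case by (simp add: trans_le_add1)
qed simp

lemma r_dim_ge: "1 \<le> d \<Longrightarrow> Suc m \<le> r_dim d m"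
  unfolding r_dim_def by (rule Suc_le_binomial_add)

text \<open>Ensures that all first-order features are present once m is at least 1, so that the
  components read off in the exponential case exist.\<close>

lemma r_dim_ge_dim: "1 \<le> m \<Longrightarrow> Suc d \<le> r_dim d m"
  using Suc_le_binomial_add[of m d] binomial_symmetric[of d "m + d"] by (simp add: r_dim_def add.commute)

lemma r_dim_mono: "m \<le> n \<Longrightarrow> r_dim d m \<le> r_dim d n"
proof (rule lift_Suc_mono_le[of "r_dim d"])
  show "r_dim d n \<le> r_dim d (Suc n)" for n
    by (cases d) (simp_all add: r_dim_def)
qed

lemma filterlim_r_dim: "1 \<le> d \<Longrightarrow> filterlim (r_dim d) at_top sequentially"
  by (rule filterlim_at_top_mono[OF filterlim_ident])
    (rule always_eventually, rule allI, rule Suc_leD, rule r_dim_ge)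

section \<open>One-variable sums for the Gaussian output\<close>

lemma has_sum_Suc_iff:
  fixes f :: "nat \<Rightarrow> real"
  assumes "f 0 = 0"
  shows "(f has_sum s) UNIV \<longleftrightarrow> ((\<lambda>k. f (Suc k)) has_sum s) UNIV"
proof (rule has_sum_reindex_neutral)
  show "f y = 0" if "y \<notin> range Suc" for y
    using that assms by (cases y) auto
qed simp

context
  fixes z :: real
begin

text \<open>Equals \<open>exp (z\<^sup>2 / 2)\<close> times the derivative of
  \<open>z ^ k * exp (- z\<^sup>2 / 2)\<close> in \<open>z\<close>: the factor of a differentiated
  coordinate, with the weight taken out.\<close>

definition gauss_factor :: "nat \<Rightarrow> real" where
  "gauss_factor k = real k * z ^ (k - 1) - z * z ^ k"

private definition E :: "nat \<Rightarrow> real" where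
  "E k = (z\<^sup>2) ^ k / fact k"

private lemma E_sum: "(E has_sum exp (z\<^sup>2)) UNIV"
  using exp_has_sum(1)[of "z\<^sup>2"] by (simp add: E_def[abs_def])

private lemma E_Suc: "real (Suc k) * E (Suc k) = z\<^sup>2 * E k"
  by (simp add: E_def del: of_nat_Suc)

private lemma Suc_div_fact: "real (Suc k) * x / fact (Suc k) = (x / fact k :: real)"
  by (simp del: of_nat_Suc)

private lemma zz: "z ^ k * z ^ k / fact k = E k"
  by (simp add: E_def power2_eq_square power_mult_distrib)

text \<open>Both parts have the sum \<open>z * exp (z\<^sup>2)\<close> up to sign: in the first, the
  factor k cancels against the factorial after an index shift.\<close>

private lemma gauss_mixed_sum: "((\<lambda>k. gauss_factor k * z ^ k / fact k) has_sum 0) UNIV"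
proof -
  have "((\<lambda>k. real k * z ^ (k - 1) * z ^ k / fact k) has_sum z * exp (z\<^sup>2)) UNIV"
  proof (subst has_sum_Suc_iff)
    have "real (Suc k) * z ^ (Suc k - 1) * z ^ Suc k / fact (Suc k) = z * E k" for k
      using Suc_div_fact[of k "z ^ k * z ^ Suc k"] by (simp add: zz[symmetric] mult_ac del: of_nat_Suc fact_Suc)
    then show "((\<lambda>k. real (Suc k) * z ^ (Suc k - 1) * z ^ Suc k / fact (Suc k)) has_sum z * exp (z\<^sup>2)) UNIV"
      using has_sum_cmult_right[OF E_sum, of z] by (simp only:)
  qed simp
  moreover have "((\<lambda>k. (- z) * E k) has_sum (- z) * exp (z\<^sup>2)) UNIV"
    by (rule has_sum_cmult_right[OF E_sum])
  ultimately have "((\<lambda>k. real k * z ^ (k - 1) * z ^ k / fact k + (- z) * E k) has_sum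
      (z * exp (z\<^sup>2) + (- z) * exp (z\<^sup>2))) UNIV"
    by (rule has_sum_add)
  moreover have "real k * z ^ (k - 1) * z ^ k / fact k + (- z) * E k = gauss_factor k * z ^ k / fact k" for k
    by (simp add: gauss_factor_def zz[symmetric] field_simps)
  ultimately show ?thesis by simp
qed

text \<open>In units of \<open>exp (z\<^sup>2)\<close> the squared first term contributes
  \<open>z\<^sup>2 + 1\<close>, the cross term \<open>- 2 * z\<^sup>2\<close> and the squared second
  term \<open>z\<^sup>2\<close>.\<close>

private lemma gauss_square_sum: "((\<lambda>k. gauss_factor k * gauss_factor k / fact k) has_sum exp (z\<^sup>2)) UNIV"
proof -
  have kE: "((\<lambda>k. real k * E k) has_sum z\<^sup>2 * exp (z\<^sup>2)) UNIV"
    by (subst has_sum_Suc_iff) (simp_all only: E_Suc has_sum_cmult_right[OF E_sum] of_nat_0 mult_zero_left)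
  have "((\<lambda>k. (real k * z ^ (k - 1)) * (real k * z ^ (k - 1)) / fact k) has_sum (z\<^sup>2 * exp (z\<^sup>2) + exp (z\<^sup>2))) UNIV"
  proof (subst has_sum_Suc_iff)
    have "(real (Suc k) * z ^ (Suc k - 1)) * (real (Suc k) * z ^ (Suc k - 1)) / fact (Suc k) = real k * E k + E k" for k
    proof -
      have "(real (Suc k) * z ^ (Suc k - 1)) * (real (Suc k) * z ^ (Suc k - 1)) / fact (Suc k)
          = real (Suc k) * (z ^ k * z ^ k / fact k)"
        by (simp add: divide_simps)
      then show ?thesis by (simp add: zz distrib_right)
    qed
    then show "((\<lambda>k. (real (Suc k) * z ^ (Suc k - 1)) * (real (Suc k) * z ^ (Suc k - 1)) / fact (Suc k))
        has_sum (z\<^sup>2 * exp (z\<^sup>2) + exp (z\<^sup>2))) UNIV"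
      using has_sum_add[OF kE E_sum] by (simp only:)
  qed simp
  from has_sum_add[OF has_sum_add[OF this has_sum_cmult_right[OF kE, of "- 2"]] has_sum_cmult_right[OF E_sum, of "z\<^sup>2"]]
  have "((\<lambda>k. (real k * z ^ (k - 1)) * (real k * z ^ (k - 1)) / fact k + (- 2) * (real k * E k) + z\<^sup>2 * E k)
      has_sum exp (z\<^sup>2)) UNIV"
    by simp
  moreover have "(real k * z ^ (k - 1)) * (real k * z ^ (k - 1)) / fact k + (- 2) * (real k * E k) + z\<^sup>2 * E k
      = gauss_factor k * gauss_factor k / fact k" for k
  proof (cases k)
    case 0
    then show ?thesis by (simp add: gauss_factor_def E_def power2_eq_square)
  next
    case (Suc k')
    have "real k * E k = (real k * z ^ (k - 1)) * (z * z ^ k) / fact k"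
      by (simp add: zz[symmetric] Suc)
    moreover have "z\<^sup>2 * E k = (z * z ^ k) * (z * z ^ k) / fact k"
      by (simp add: zz[symmetric] power2_eq_square mult_ac)
    ultimately show ?thesis
      by (simp only: gauss_factor_def) (simp add: algebra_simps add_divide_distrib diff_divide_distrib)
  qed
  ultimately show ?thesis by simp
qed

lemma gauss_factor_sums:
  shows "((\<lambda>k. z ^ k * z ^ k / fact k) has_sum exp (z\<^sup>2)) UNIV"
    and "((\<lambda>k. gauss_factor k * z ^ k / fact k) has_sum 0) UNIV"
    and "((\<lambda>k. gauss_factor k * gauss_factor k / fact k) has_sum exp (z\<^sup>2)) UNIV"
  using E_sum gauss_mixed_sum gauss_square_sum by (simp_all add: zz)

end

text \<open>The sum factors over the coordinates. For \<open>l \<noteq> l'\<close> the factor of coordinate \<open>l\<close> is, up to a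
  constant, \<open>\<partial>\<^sub>s exp (-(s - t)\<^sup>2/2)\<close> at \<open>s = t\<close>, which vanishes.\<close>

lemma gaussian_derivative_orthogonality:
  fixes x0 y :: "real ^ 'n::finite"
  assumes \<sigma>: "0 < \<sigma>"
  shows "((\<lambda>p. partial_deriv l (feature Gaussian \<sigma> x0 p) y * partial_deriv l' (feature Gaussian \<sigma> x0 p) y
      / multi_fact p) has_sum (if l = l' then 1 / \<sigma>\<^sup>2 else 0)) UNIV"
proof -
  define z where "z = zcoord \<sigma> x0 y"
  define w where "w = weight Gaussian \<sigma> x0 y"
  \<comment> \<open>The factor of coordinate \<open>m\<close>: differentiated if
    \<open>m = l\<close>, a plain power otherwise.\<close>
  define g where "g = (\<lambda>l m k. if m = l then gauss_factor (z m) k else z m ^ k)"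
  have pd: "partial_deriv l (feature Gaussian \<sigma> x0 p) y = w / \<sigma> * (\<Prod>m\<in>UNIV. g l m (p m))" for l p
  proof -
    define Q where "Q = (\<Prod>m\<in>UNIV - {l}. z m ^ p m)"
    have "(\<Prod>m\<in>UNIV. g l m (p m)) = gauss_factor (z l) (p l) * Q"
      unfolding Q_def by (subst prod.remove[of UNIV l]) (auto simp: g_def intro!: prod.cong)
    then have g: "(\<Prod>m\<in>UNIV. g l m (p m)) = (real (p l) * z l ^ (p l - 1) - z l * z l ^ p l) * Q"
      by (simp only: gauss_factor_def)
    have m1: "mon z (p(l := p l - 1)) = z l ^ (p l - 1) * Q"
      unfolding Q_def by (subst mon_remove[of _ _ l]) (auto intro!: prod.cong)
    have m2: "mon z p = z l ^ p l * Q" unfolding Q_def by (rule mon_remove)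
    show ?thesis
      unfolding partial_deriv_feature[OF \<sigma>] z_def[symmetric] w_def[symmetric] g m1 m2
      using \<sigma> by (simp add: gauss_ind_def field_simps)
  qed
  \<comment> \<open>A coordinate differentiated in both factors or in neither sums to the
    exponential; one differentiated exactly once sums to 0.\<close>
  define s where "s = (\<lambda>m. if m = l \<and> m = l' \<or> m \<noteq> l \<and> m \<noteq> l' then exp ((z m)\<^sup>2) else 0)"
  have f: "((\<lambda>k. g l m k * g l' m k / fact k) has_sum s m) UNIV" for m
    using gauss_factor_sums[of "z m"] by (auto simp: g_def s_def mult.commute)
  have fs: "(\<lambda>k. \<bar>g l m k * g l' m k / fact k\<bar>) summable_on UNIV" for m
    by (rule summable_on_iff_abs_summable_on_real[THEN iffD1, OF has_sum_imp_summable[OF f], unfolded real_norm_def])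
  have "((\<lambda>p. \<Prod>m\<in>UNIV. g l m (p m) * g l' m (p m) / fact (p m)) has_sum (\<Prod>m\<in>UNIV. s m)) UNIV"
    using has_sum_multi_index_prod[of "\<lambda>m k. g l m k * g l' m k / fact k", OF fs]
    by (simp only: infsumI[OF f])
  from has_sum_cmult_right[OF this, of "(w / \<sigma>)\<^sup>2"]
  have "((\<lambda>p. partial_deriv l (feature Gaussian \<sigma> x0 p) y * partial_deriv l' (feature Gaussian \<sigma> x0 p) y
      / multi_fact p) has_sum (w / \<sigma>)\<^sup>2 * (\<Prod>m\<in>UNIV. s m)) UNIV"
    by (simp add: pd multi_fact_def prod_dividef prod.distrib power2_eq_square mult_ac)
  moreover have "(w / \<sigma>)\<^sup>2 * (\<Prod>m\<in>UNIV. s m) = (if l = l' then 1 / \<sigma>\<^sup>2 else 0)"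
  proof (cases "l = l'")
    case True
    then have "(\<Prod>m\<in>UNIV. s m) = (\<Prod>m\<in>UNIV. exp ((z m)\<^sup>2))" by (intro prod.cong) (auto simp: s_def)
    also have "\<dots> = exp (\<Sum>m\<in>UNIV. (z m)\<^sup>2)" by (simp add: exp_sum)
    also have "(\<Sum>m\<in>UNIV. (z m)\<^sup>2) = (norm (y - x0))\<^sup>2 / \<sigma>\<^sup>2"
      unfolding power2_norm_eq_inner z_def power2_eq_square[of "zcoord _ _ _ _"] by (rule zcoord_inner)
    finally have P: "(\<Prod>m\<in>UNIV. s m) = exp ((norm (y - x0))\<^sup>2 / \<sigma>\<^sup>2)" .
    \<comment> \<open>The squared weight is the reciprocal of the product of the coordinate sums, so
      only the chain-rule factor \<open>1 / \<sigma>\<^sup>2\<close> survives.\<close>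
    have "w\<^sup>2 = exp (- ((norm (y - x0))\<^sup>2 / \<sigma>\<^sup>2))"
      by (simp add: w_def weight_def power2_eq_square[of "exp _"] mult_exp_exp flip: exp_double)
    then have "w\<^sup>2 * (\<Prod>m\<in>UNIV. s m) = 1" by (simp add: P mult_exp_exp)
    then show ?thesis using True by (simp add: power_divide)
  next
    case False
    then have "s l = 0" by (simp add: s_def)
    then have "(\<Prod>m\<in>UNIV. s m) = 0" by (intro prod_zero) auto
    then show ?thesis using False by simp
  qed
  ultimately show ?thesis by simp
qed

text \<open>The factor with which entry (i, j) of the regression matrix enters component
  \<open>l\<close> of the output at \<open>y\<close>. The output is linear in that matrix for both
  kernels, and from here on only these factors distinguish the kernels.\<close>

definition output_coeff ::
    "kernel_kind \<Rightarrow> real \<Rightarrow> real ^ 'n::finite \<Rightarrow> (nat \<Rightarrow> 'n) \<Rightarrow> (nat \<Rightarrow> 'n \<Rightarrow> nat) \<Rightarrow> 'n \<Rightarrow> nat \<Rightarrow> nat \<Rightarrow> real ^ 'n \<Rightarrow> real"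
where
  "output_coeff \<kappa> \<sigma> x0 c \<alpha> l i j y =
     (case \<kappa> of
        Exponential \<Rightarrow>
          if i = Suc (the_inv_into {..<CARD('n)} c l) then \<sigma> * feature \<kappa> \<sigma> x0 (\<alpha> j) y else 0
      | Gaussian \<Rightarrow>
          \<sigma>\<^sup>2 * (partial_deriv l (feature \<kappa> \<sigma> x0 (\<alpha> i)) y / multi_fact (\<alpha> i)) * feature \<kappa> \<sigma> x0 (\<alpha> j) y)"

text \<open>Invertibility in the matrix ring excludes the outcome \<open>None\<close>, and
  uniqueness of inverses identifies the result without unfolding the elimination.\<close>

lemma mat_inverse_diag:
  fixes d :: "nat \<Rightarrow> real"
  assumes d: "\<And>i. d i \<noteq> 0"
  shows "the (mat_inverse (mat_diag n d)) = mat_diag n (\<lambda>i. 1 / d i)"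
proof -
  let ?A = "mat_diag n d" and ?B = "mat_diag n (\<lambda>i. 1 / d i)"
  have A: "?A \<in> carrier_mat n n" and B: "?B \<in> carrier_mat n n" by auto
  have AB: "?A * ?B = 1\<^sub>m n" and BA: "?B * ?A = 1\<^sub>m n"
    using d by (simp_all add: mat_diag_diag)
  have "mat_inverse ?A \<noteq> None"
  proof
    assume "mat_inverse ?A = None"
    then have "?A \<notin> Units (ring_mat TYPE(real) n ())" by (rule mat_inverse(1)[OF A])
    moreover have "?A \<in> Units (ring_mat TYPE(real) n ())"
      unfolding Units_def ring_mat_def
      by (intro CollectI conjI bexI[of _ ?B]) (simp_all only: A B AB BA monoid.simps partial_object.simps)
    ultimately show False by contradiction
  qed
  then obtain C where C: "mat_inverse ?A = Some C" by blast
  have AC: "?A * C = 1\<^sub>m n" and C': "C \<in> carrier_mat n n"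
    using mat_inverse(2)[OF A C] by auto
  have "C = ?B * ?A * C" by (simp only: BA left_mult_one_mat[OF C'])
  also have "\<dots> = ?B * (?A * C)" by (rule assoc_mult_mat[OF B A C'])
  also have "\<dots> = ?B" by (simp only: AC right_mult_one_mat[OF B])
  finally have "C = ?B" .
  then show ?thesis using C by simp
qed

lemma F_hat_eq:
  fixes x0 :: "real ^ 'n::finite"
  assumes m: "1 \<le> m" and c: "bij_betw c {..<CARD('n)} UNIV"
  shows "F_hat \<kappa> \<sigma> x0 c \<alpha> m n N xs ys y $ l =
    (\<Sum>i<r_dim CARD('n) m. \<Sum>j<r_dim CARD('n) m.
       (W_mat \<kappa> \<sigma> x0 \<alpha> m N xs ys * pinv (V_mat \<kappa> \<sigma> x0 \<alpha> n N xs)) $$ (i, j) * output_coeff \<kappa> \<sigma> x0 c \<alpha> l i j y)"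
proof -
  define r where "r = r_dim CARD('n) m"
  define P where "P = W_mat \<kappa> \<sigma> x0 \<alpha> m N xs ys * pinv (V_mat \<kappa> \<sigma> x0 \<alpha> n N xs)"
  define A where "A = A_hat \<kappa> \<sigma> x0 \<alpha> m n N xs ys"
  have A: "A \<in> carrier_mat r r" and A_entry: "\<And>i j. i < r \<Longrightarrow> j < r \<Longrightarrow> A $$ (i, j) = P $$ (i, j)"
    by (auto simp: A_def A_hat_def P_def r_def)
  define fv where "fv = feature_vec \<kappa> \<sigma> x0 \<alpha> m y"
  have fv: "fv \<in> carrier_vec r" "\<And>j. j < r \<Longrightarrow> vec_index fv j = feature \<kappa> \<sigma> x0 (\<alpha> j) y"
    by (auto simp: fv_def feature_vec_def r_def)
  define u where "u = A *\<^sub>v fv"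
  have Afv: "u \<in> carrier_vec r" using A fv by (auto simp: u_def)
  have Afv_entry: "vec_index u i = (\<Sum>j<r. P $$ (i, j) * feature \<kappa> \<sigma> x0 (\<alpha> j) y)" if "i < r" for i
    using that A fv by (auto simp: u_def scalar_prod_def A_entry atLeast0LessThan intro!: sum.cong)
  show ?thesis
  proof (cases \<kappa>)
    case Exponential
    define i0 where "i0 = Suc (the_inv_into {..<CARD('n)} c l)"
    have "the_inv_into {..<CARD('n)} c l < CARD('n)"
      using the_inv_into_into[of c "{..<CARD('n)}" l "{..<CARD('n)}"] c by (auto simp: bij_betw_def)
    then have i0: "i0 < r" using r_dim_ge_dim[OF m, of "CARD('n)"] by (simp add: i0_def r_def)
    have "F_hat \<kappa> \<sigma> x0 c \<alpha> m n N xs ys y $ l = vec_index (\<sigma> \<cdot>\<^sub>v u) i0"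
      using Exponential by (simp add: F_hat_def A_def fv_def u_def i0_def)
    also have "\<dots> = \<sigma> * (\<Sum>j<r. P $$ (i0, j) * feature \<kappa> \<sigma> x0 (\<alpha> j) y)"
      using Afv i0 Afv_entry[OF i0] by simp
    also have "\<dots> = (\<Sum>i<r. if i = i0 then \<Sum>j<r. P $$ (i, j) * (\<sigma> * feature \<kappa> \<sigma> x0 (\<alpha> j) y) else 0)"
      using i0 by (simp add: sum_distrib_left mult.left_commute)
    also have "\<dots> = (\<Sum>i<r. \<Sum>j<r. P $$ (i, j) * output_coeff \<kappa> \<sigma> x0 c \<alpha> l i j y)"
      by (intro sum.cong refl) (simp add: output_coeff_def Exponential i0_def)
    finally show ?thesis by (simp only: r_def P_def)
  next
    case Gaussian
    define D where "D = mat_diag r (\<lambda>i. 1 / multi_fact (\<alpha> i))"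
    have D: "the (mat_inverse (G_mat \<alpha> m)) = D"
      unfolding G_mat_def D_def r_def by (rule mat_inverse_diag) (simp add: less_imp_neq[OF multi_fact_pos, symmetric])
    have DA: "vec_index (D *\<^sub>v u) i = 1 / multi_fact (\<alpha> i) * vec_index u i" if "i < r" for i
    proof -
      have "vec_index (D *\<^sub>v u) i = (\<Sum>k<r. (if i = k then 1 / multi_fact (\<alpha> k) else 0) * vec_index u k)"
        using that Afv by (auto simp: D_def scalar_prod_def atLeast0LessThan mat_diag_def intro!: sum.cong)
      also have "\<dots> = (\<Sum>k<r. if i = k then 1 / multi_fact (\<alpha> k) * vec_index u k else 0)"
        by (intro sum.cong) auto
      also have "\<dots> = 1 / multi_fact (\<alpha> i) * vec_index u i" using that by simp
      finally show ?thesis .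
    qed
    have "D \<in> carrier_mat r r" by (simp add: D_def)
    then have dimD: "dim_vec (D *\<^sub>v u) = r" by simp
    have "F_hat \<kappa> \<sigma> x0 c \<alpha> m n N xs ys y $ l
        = \<sigma>\<^sup>2 * scalar_prod (feature_vec_deriv \<kappa> \<sigma> x0 \<alpha> l m y) (D *\<^sub>v u)"
      using Gaussian by (simp add: F_hat_def A_def fv_def u_def D)
    also have "\<dots> = \<sigma>\<^sup>2 * (\<Sum>i<r. partial_deriv l (feature \<kappa> \<sigma> x0 (\<alpha> i)) y *
        (1 / multi_fact (\<alpha> i) * (\<Sum>j<r. P $$ (i, j) * feature \<kappa> \<sigma> x0 (\<alpha> j) y)))"
      unfolding scalar_prod_def dimD
      by (rule arg_cong[of _ _ "(*) (\<sigma>\<^sup>2)"], rule sum.cong)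
        (simp_all only: atLeast0LessThan, simp add: feature_vec_deriv_def r_def[symmetric] DA Afv_entry del: index_mult_mat_vec)
    also have "\<dots> = (\<Sum>i<r. \<Sum>j<r. P $$ (i, j) * output_coeff \<kappa> \<sigma> x0 c \<alpha> l i j y)"
      unfolding sum_distrib_left
      by (intro sum.cong refl) (simp add: output_coeff_def Gaussian mult_ac)
    finally show ?thesis by (simp only: r_def P_def)
  qed
qed

section \<open>Regression coefficients\<close>

lemma continuous_on_partial_deriv_feature:
  fixes x0 :: "real ^ 'n::finite"
  assumes \<sigma>: "0 < \<sigma>"
  shows "continuous_on A (partial_deriv l (feature \<kappa> \<sigma> x0 p))"
proof -
  have "continuous_on A (\<lambda>x. zcoord \<sigma> x0 x l)"
    unfolding zcoord_def divide_inverse by (intro continuous_intros)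
  then show ?thesis
    unfolding partial_deriv_feature[OF \<sigma>, abs_def]
    by (intro continuous_intros continuous_on_weight continuous_on_mon_zcoord)
qed

lemma borel_measurable_A_op_feature:
  fixes F :: "real ^ 'n::finite \<Rightarrow> real ^ 'n"
  assumes \<sigma>: "0 < \<sigma>" and F: "\<And>l. continuous_on UNIV (\<lambda>x. F x $ l)"
  shows "A_op F (feature \<kappa> \<sigma> x0 p) \<in> borel_measurable borel"
  unfolding A_op_def[abs_def]
  by (intro borel_measurable_continuous_onI continuous_on_sum continuous_on_mult F
      continuous_on_partial_deriv_feature[OF \<sigma>])

context sampling
begin

definition gram :: "(nat \<Rightarrow> 'n \<Rightarrow> nat) \<Rightarrow> nat \<Rightarrow> real mat" where
  "gram \<alpha> r = Matrix.mat r r (\<lambda>(i, j). \<integral>x. v (\<alpha> i) x * v (\<alpha> j) x \<partial>\<mu>)"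

text \<open>A null vector of the Gram matrix is a combination of features with zero norm, hence zero
  almost everywhere; the coefficient bound with \<open>E = 0\<close> forces all its coefficients to
  vanish.\<close>

lemma gram_det_nonzero:
  assumes inj: "inj \<alpha>"
  shows "det (gram \<alpha> r) \<noteq> 0"
proof
  have G: "gram \<alpha> r \<in> carrier_mat r r" by (simp add: gram_def)
  assume "det (gram \<alpha> r) = 0"
  then obtain u where u: "u \<in> carrier_vec r" "u \<noteq> 0\<^sub>v r" and Gu: "gram \<alpha> r *\<^sub>v u = 0\<^sub>v r"
    using det_0_iff_vec_prod_zero_field[OF G] by blast
  define c where "c = (\<lambda>i. vec_index u i)"
  have Gc: "(\<Sum>j<r. (\<integral>x. v (\<alpha> i) x * v (\<alpha> j) x \<partial>\<mu>) * c j) = 0" if i: "i < r" for i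
  proof -
    have "vec_index (gram \<alpha> r *\<^sub>v u) i = (\<Sum>j<r. (\<integral>x. v (\<alpha> i) x * v (\<alpha> j) x \<partial>\<mu>) * c j)"
      using i u(1) by (auto simp: gram_def c_def scalar_prod_def atLeast0LessThan intro!: sum.cong)
    then show ?thesis using i by (simp only: Gu index_zero_vec)
  qed
  define q where "q = (\<lambda>x. \<Sum>i<r. c i * v (\<alpha> i) x)"
  have bq: "bounded_measurable q" unfolding q_def by (intro bounded_measurable_intros)
  have [measurable]: "q \<in> borel_measurable borel" using bq by (simp add: bounded_measurable_def)
  have "(\<integral>x. q x * q x \<partial>\<mu>) = (\<integral>x. (\<Sum>i<r. \<Sum>j<r. c i * (v (\<alpha> i) x * v (\<alpha> j) x * c j)) \<partial>\<mu>)"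
    unfolding q_def sum_product
    by (intro Bochner_Integration.integral_cong refl sum.cong) (simp add: mult_ac)
  also have "\<dots> = (\<Sum>i<r. \<Sum>j<r. (\<integral>x. c i * (v (\<alpha> i) x * v (\<alpha> j) x * c j) \<partial>\<mu>))"
    by (subst Bochner_Integration.integral_sum, (intro bounded_measurable_integrable bounded_measurable_intros),
        intro sum.cong refl Bochner_Integration.integral_sum bounded_measurable_integrable bounded_measurable_intros)
  also have "\<dots> = (\<Sum>i<r. c i * (\<Sum>j<r. (\<integral>x. v (\<alpha> i) x * v (\<alpha> j) x \<partial>\<mu>) * c j))"
    by (simp add: sum_distrib_left)
  also have "\<dots> = 0" by (simp add: Gc)
  finally have "(\<integral>x. q x * q x \<partial>\<mu>) = 0" .
  then have "AE x in \<mu>. q x * q x = 0"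
    using integral_nonneg_eq_0_iff_AE[of \<mu> "\<lambda>x. q x * q x"] bounded_measurable_integrable[OF bounded_measurable_mult[OF bq bq]]
    by simp
  then have "AE x in \<mu>. ennreal \<bar>q x\<bar> = 0" by eventually_elim simp
  then have q0: "(\<integral>\<^sup>+x. ennreal \<bar>q x\<bar> \<partial>\<mu>) = 0"
    by (subst nn_integral_0_iff_AE) auto
  define d where "d = (\<lambda>\<gamma>. c (inv_into UNIV \<alpha> \<gamma>))"
  have d\<alpha>: "d (\<alpha> i) = c i" for i by (simp add: d_def inv_f_f[OF inj])
  define S where "S = \<alpha> ` {..<r}"
  have q_sum: "q x = (\<Sum>\<gamma>\<in>S. d \<gamma> * v \<gamma> x)" for x
    unfolding q_def S_def by (subst sum.reindex) (auto simp: inj_on_subset[OF inj] d\<alpha>)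
  obtain A C where AC: "\<And>D S c \<beta> E. finite S \<Longrightarrow> (\<forall>\<gamma>\<in>S. sum \<gamma> UNIV \<le> D) \<Longrightarrow> \<beta> \<in> S \<Longrightarrow> 0 \<le> E \<Longrightarrow>
        (\<integral>\<^sup>+x. ennreal \<bar>\<Sum>\<gamma>\<in>S. c \<gamma> * v \<gamma> x\<bar> \<partial>\<mu>) \<le> ennreal E \<Longrightarrow> \<bar>c \<beta>\<bar> \<le> A * C ^ D * E"
    using coefficient_bound by blast
  have "c i = 0" if i: "i < r" for i
  proof -
    have "\<bar>d (\<alpha> i)\<bar> \<le> A * C ^ (\<Sum>\<gamma>\<in>S. sum \<gamma> UNIV) * 0"
    proof (rule AC)
      show "finite S" by (simp add: S_def)
      then show "\<forall>\<gamma>\<in>S. sum \<gamma> UNIV \<le> (\<Sum>\<gamma>\<in>S. sum \<gamma> UNIV)"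
        by (intro ballI member_le_sum) auto
      show "(\<integral>\<^sup>+x. ennreal \<bar>\<Sum>\<gamma>\<in>S. d \<gamma> * v \<gamma> x\<bar> \<partial>\<mu>) \<le> ennreal 0"
        unfolding q_sum[symmetric] q0 by simp
    qed (use i in \<open>auto simp: S_def\<close>)
    then show ?thesis by (simp add: d\<alpha>)
  qed
  then have "u = 0\<^sub>v r" using u(1) by (intro eq_vecI) (auto simp: c_def)
  then show False using u(2) by simp
qed

text \<open>Row \<open>i\<close> of the cross-moment matrix times the inverse Gram matrix: the
  coefficients of the orthogonal projection of \<open>A_op F (v (\<alpha> i))\<close> onto the first
  \<open>r\<close> features, square integrable functions for \<open>\<mu>\<close> being the ambient
  space.\<close>

definition regression :: "(nat \<Rightarrow> 'n \<Rightarrow> nat) \<Rightarrow> (real ^ 'n \<Rightarrow> real ^ 'n) \<Rightarrow> nat \<Rightarrow> nat \<Rightarrow> nat \<Rightarrow> real" where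
  "regression \<alpha> F r i j = (\<Sum>k<r. (\<integral>x. A_op F (v (\<alpha> i)) x * v (\<alpha> k) x \<partial>\<mu>) * adj_inverse (gram \<alpha> r) $$ (k, j))"

text \<open>These are the normal equations: the coefficients times the Gram matrix return the cross
  moments.\<close>

lemma regression_orthogonal:
  assumes inj: "inj \<alpha>" and k: "k < r" and f: "bounded_measurable (A_op F (v (\<alpha> i)))"
  shows "(\<integral>x. (A_op F (v (\<alpha> i)) x - (\<Sum>j<r. regression \<alpha> F r i j * v (\<alpha> j) x)) * v (\<alpha> k) x \<partial>\<mu>) = 0"
proof -
  define S where "S = adj_inverse (gram \<alpha> r)"
  have G: "gram \<alpha> r \<in> carrier_mat r r" by (simp add: gram_def)
  note inv = adj_inverse[OF G gram_det_nonzero[OF inj], folded S_def]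
  define C where "C = (\<lambda>k. \<integral>x. A_op F (v (\<alpha> i)) x * v (\<alpha> k) x \<partial>\<mu>)"
  have SG: "(\<Sum>j<r. S $$ (m, j) * (\<integral>x. v (\<alpha> j) x * v (\<alpha> k) x \<partial>\<mu>)) = (if m = k then 1 else 0)" if m: "m < r" for m
  proof -
    have "(S * gram \<alpha> r) $$ (m, k) = (\<Sum>j<r. S $$ (m, j) * (\<integral>x. v (\<alpha> j) x * v (\<alpha> k) x \<partial>\<mu>))"
      using m k inv(1) by (auto simp: gram_def scalar_prod_def atLeast0LessThan intro!: sum.cong)
    then show ?thesis using m k by (simp add: inv(3))
  qed
  have "(\<integral>x. (A_op F (v (\<alpha> i)) x - (\<Sum>j<r. regression \<alpha> F r i j * v (\<alpha> j) x)) * v (\<alpha> k) x \<partial>\<mu>)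
      = (\<integral>x. A_op F (v (\<alpha> i)) x * v (\<alpha> k) x - (\<Sum>j<r. regression \<alpha> F r i j * (v (\<alpha> j) x * v (\<alpha> k) x)) \<partial>\<mu>)"
    by (intro Bochner_Integration.integral_cong refl) (simp add: left_diff_distrib sum_distrib_right mult.assoc)
  also have "\<dots> = C k - (\<integral>x. (\<Sum>j<r. regression \<alpha> F r i j * (v (\<alpha> j) x * v (\<alpha> k) x)) \<partial>\<mu>)"
    unfolding C_def
    by (intro Bochner_Integration.integral_diff bounded_measurable_integrable bounded_measurable_intros f)
  also have "(\<integral>x. (\<Sum>j<r. regression \<alpha> F r i j * (v (\<alpha> j) x * v (\<alpha> k) x)) \<partial>\<mu>)
      = (\<Sum>j<r. (\<integral>x. regression \<alpha> F r i j * (v (\<alpha> j) x * v (\<alpha> k) x) \<partial>\<mu>))"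
    by (intro Bochner_Integration.integral_sum bounded_measurable_integrable bounded_measurable_intros)
  also have "\<dots> = (\<Sum>j<r. (\<Sum>m<r. C m * S $$ (m, j)) * (\<integral>x. v (\<alpha> j) x * v (\<alpha> k) x \<partial>\<mu>))"
    by (simp add: regression_def C_def S_def)
  also have "\<dots> = (\<Sum>j<r. \<Sum>m<r. C m * (S $$ (m, j) * (\<integral>x. v (\<alpha> j) x * v (\<alpha> k) x \<partial>\<mu>)))"
    by (simp add: sum_distrib_right mult.assoc)
  also have "\<dots> = (\<Sum>m<r. C m * (\<Sum>j<r. S $$ (m, j) * (\<integral>x. v (\<alpha> j) x * v (\<alpha> k) x \<partial>\<mu>)))"
    by (subst sum.swap) (simp add: sum_distrib_left)
  also have "\<dots> = (\<Sum>m<r. if m = k then C m else 0)"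
    by (intro sum.cong refl) (simp add: SG)
  also have "\<dots> = C k" using k by simp
  finally show ?thesis by simp
qed

text \<open>On the support the monomials are at most a power of \<open>R\<close> and the weight is
  at most 1, so the majorant series at radius \<open>R\<close> bounds the function.\<close>

lemma entire_bounded_measurable:
  assumes f [measurable]: "f \<in> borel_measurable borel"
    and summable: "\<And>T. T \<ge> 1 \<Longrightarrow> (\<lambda>\<beta>. \<bar>a \<beta>\<bar> * T ^ sum \<beta> UNIV) summable_on UNIV"
    and expansion: "\<And>x. ((\<lambda>\<beta>. a \<beta> * mon (zcoord \<sigma> x0 x) \<beta>) has_sum f x / weight \<kappa> \<sigma> x0 x) UNIV"
  shows "bounded_measurable f"
proof -
  have "AE x in \<mu>. \<bar>f x\<bar> \<le> (\<Sum>\<^sub>\<infinity>\<beta>. \<bar>a \<beta>\<bar> * R ^ sum \<beta> UNIV)"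
    using support
  proof eventually_elim
    case (elim x)
    define z where "z = zcoord \<sigma> x0 x"
    have le: "\<bar>a \<beta> * mon z \<beta>\<bar> \<le> \<bar>a \<beta>\<bar> * R ^ sum \<beta> UNIV" for \<beta>
      using abs_mon_le[of z R \<beta>] elim by (auto simp: abs_mult z_def intro!: mult_left_mono)
    have s: "(\<lambda>\<beta>. \<bar>a \<beta> * mon z \<beta>\<bar>) summable_on UNIV"
      by (rule summable_on_comparison_test[OF summable[OF R]]) (use le in auto)
    have "\<bar>f x / weight \<kappa> \<sigma> x0 x\<bar> \<le> (\<Sum>\<^sub>\<infinity>\<beta>. \<bar>a \<beta> * mon z \<beta>\<bar>)"
      using norm_infsum_bound[of "\<lambda>\<beta>. a \<beta> * mon z \<beta>" UNIV] s infsumI[OF expansion[of x]] by (simp add: z_def)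
    also have "\<dots> \<le> (\<Sum>\<^sub>\<infinity>\<beta>. \<bar>a \<beta>\<bar> * R ^ sum \<beta> UNIV)"
      by (rule infsum_mono[OF s summable[OF R] le])
    finally have "\<bar>f x / weight \<kappa> \<sigma> x0 x\<bar> \<le> (\<Sum>\<^sub>\<infinity>\<beta>. \<bar>a \<beta>\<bar> * R ^ sum \<beta> UNIV)" .
    moreover have "\<bar>f x\<bar> = weight \<kappa> \<sigma> x0 x * \<bar>f x / weight \<kappa> \<sigma> x0 x\<bar>"
      using weight_pos[of \<kappa> \<sigma> x0 x] by (simp add: abs_divide)
    moreover have "weight \<kappa> \<sigma> x0 x * \<bar>f x / weight \<kappa> \<sigma> x0 x\<bar> \<le> 1 * \<bar>f x / weight \<kappa> \<sigma> x0 x\<bar>"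
      by (intro mult_right_mono weight_le_1) simp
    ultimately show ?case by linarith
  qed
  then show ?thesis unfolding bounded_measurable_def by auto
qed

text \<open>The error is bounded by a tail of the majorant series at radius \<open>C * R\<close>,
  over the complement of the first \<open>r\<close> multi-indices; these exhaust all multi-indices.
  The limit is along all \<open>r\<close>, and the binomial dimensions are substituted
  later.\<close>

lemma regression_tendsto:
  fixes a :: "('n \<Rightarrow> nat) \<Rightarrow> real"
  assumes f: "A_op F (v (\<alpha> i)) \<in> borel_measurable borel"
    and summable: "\<And>T. T \<ge> 1 \<Longrightarrow> (\<lambda>\<beta>. \<bar>a \<beta>\<bar> * T ^ sum \<beta> UNIV) summable_on UNIV"
    and expansion: "\<And>x. ((\<lambda>\<beta>. a \<beta> * mon (zcoord \<sigma> x0 x) \<beta>) has_sum A_op F (v (\<alpha> i)) x / weight \<kappa> \<sigma> x0 x) UNIV"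
    and \<alpha>: "bij_betw \<alpha> UNIV UNIV" "\<And>i j. i \<le> j \<Longrightarrow> sum (\<alpha> i) UNIV \<le> sum (\<alpha> j) UNIV"
  shows "(\<lambda>r. regression \<alpha> F r i j) \<longlonglongrightarrow> a (\<alpha> j)"
proof -
  have inj: "inj \<alpha>" using \<alpha>(1) by (simp add: bij_betw_def)
  obtain A C where A: "0 \<le> A" and C: "1 \<le> C" and AC: "\<And>D S c \<beta> E. finite S \<Longrightarrow> (\<forall>\<gamma>\<in>S. sum \<gamma> UNIV \<le> D) \<Longrightarrow> \<beta> \<in> S \<Longrightarrow> 0 \<le> E \<Longrightarrow>
        (\<integral>\<^sup>+x. ennreal \<bar>\<Sum>\<gamma>\<in>S. c \<gamma> * v \<gamma> x\<bar> \<partial>\<mu>) \<le> ennreal E \<Longrightarrow> \<bar>c \<beta>\<bar> \<le> A * C ^ D * E"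
    using coefficient_bound by blast
  define t where "t = (\<lambda>\<beta>. \<bar>a \<beta>\<bar> * (C * R) ^ sum \<beta> UNIV)"
  have "1 * 1 \<le> C * R" using C R by (intro mult_mono) auto
  then have t: "t summable_on UNIV" unfolding t_def by (intro summable) simp
  have fil: "filterlim (\<lambda>r. \<alpha> ` {..<r}) (finite_subsets_at_top UNIV) sequentially"
    unfolding filterlim_finite_subsets_at_top
  proof (intro allI impI)
    fix X :: "('n \<Rightarrow> nat) set"
    assume "finite X \<and> X \<subseteq> UNIV"
    then obtain N where N: "finite N" "X = \<alpha> ` N"
      using \<alpha>(1) by (metis bij_betw_def finite_subset_image)
    obtain b where "N \<subseteq> {..<b}" using N(1) finite_nat_iff_bounded by blast
    then have "X \<subseteq> \<alpha> ` {..<r}" if "b \<le> r" for r using N(2) that by (auto intro!: imageI)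
    then show "\<forall>\<^sub>F r in sequentially. finite (\<alpha> ` {..<r}) \<and> X \<subseteq> \<alpha> ` {..<r} \<and> \<alpha> ` {..<r} \<subseteq> UNIV"
      by (auto simp: eventually_sequentially)
  qed
  have bound: "\<bar>regression \<alpha> F r i j - a (\<alpha> j)\<bar> \<le> A * infsum t (- \<alpha> ` {..<r})" if "j < r" for r
    unfolding t_def
  proof (rule projection_coefficients[where f = "A_op F (v (\<alpha> i))" and b = "\<lambda>j. regression \<alpha> F r i j"])
    fix k assume "k < r"
    then show "(\<integral>x. (A_op F (v (\<alpha> i)) x - (\<Sum>j<r. regression \<alpha> F r i j * v (\<alpha> j) x)) * v (\<alpha> k) x \<partial>\<mu>) = 0"
      by (intro regression_orthogonal inj entire_bounded_measurable[OF f summable expansion])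
  qed (fact f summable expansion \<alpha> A C AC that)+
  have "(\<lambda>r. A * infsum t (- \<alpha> ` {..<r})) \<longlonglongrightarrow> A * 0"
    by (intro tendsto_mult tendsto_const filterlim_compose[OF infsum_Compl_tendsto_0[OF t] fil])
  then have lim: "(\<lambda>r. A * infsum t (- \<alpha> ` {..<r})) \<longlonglongrightarrow> 0" by simp
  have "(\<lambda>r. regression \<alpha> F r i j - a (\<alpha> j)) \<longlonglongrightarrow> 0"
  proof (rule Lim_null_comparison[OF _ lim])
    show "\<forall>\<^sub>F r in sequentially. norm (regression \<alpha> F r i j - a (\<alpha> j)) \<le> A * infsum t (- \<alpha> ` {..<r})"
      using eventually_gt_at_top[of j] by eventually_elim (simp add: bound)
  qed
  then show ?thesis by (simp add: LIM_zero_iff)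
qed

text \<open>Because the outputs are \<open>F (xs t)\<close>, the entries of \<open>W_mat\<close> are
  values of \<open>A_op F\<close> of a feature at the samples, so both matrix products are sums of
  the kind averaged in the hypotheses.\<close>

lemma least_squares_tendsto_regression:
  assumes inj: "inj \<alpha>"
    and VV: "\<And>i j. (\<lambda>N. (\<Sum>t<N. v (\<alpha> i) (xs t) * v (\<alpha> j) (xs t)) / real N)
               \<longlonglongrightarrow> (\<integral>x. v (\<alpha> i) x * v (\<alpha> j) x \<partial>\<mu>)"
    and WV: "\<And>i j. (\<lambda>N. (\<Sum>t<N. A_op F (v (\<alpha> i)) (xs t) * v (\<alpha> j) (xs t)) / real N)
               \<longlonglongrightarrow> (\<integral>x. A_op F (v (\<alpha> i)) x * v (\<alpha> j) x \<partial>\<mu>)"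
    and i: "i < r_dim CARD('n) m" and j: "j < r_dim CARD('n) n"
  shows "(\<lambda>N. (W_mat \<kappa> \<sigma> x0 \<alpha> m N xs (\<lambda>t. F (xs t)) * pinv (V_mat \<kappa> \<sigma> x0 \<alpha> n N xs)) $$ (i, j))
    \<longlonglongrightarrow> regression \<alpha> F (r_dim CARD('n) n) i j"
proof -
  let ?rm = "r_dim CARD('n) m" and ?rn = "r_dim CARD('n) n"
  define C where "C = Matrix.mat ?rm ?rn (\<lambda>(i, j). \<integral>x. A_op F (v (\<alpha> i)) x * v (\<alpha> j) x \<partial>\<mu>)"
  have G: "gram \<alpha> ?rn \<in> carrier_mat ?rn ?rn" by (simp add: gram_def)
  have C: "C \<in> carrier_mat ?rm ?rn" by (simp add: C_def)
  have V_entry: "V_mat \<kappa> \<sigma> x0 \<alpha> n N xs $$ (i, t) = v (\<alpha> i) (xs t)" if "i < ?rn" "t < N" for i t N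
    using that by (simp add: V_mat_def feature_vec_def)
  have W_entry: "W_mat \<kappa> \<sigma> x0 \<alpha> m N xs (\<lambda>t. F (xs t)) $$ (i, t) = A_op F (v (\<alpha> i)) (xs t)" if "i < ?rm" "t < N" for i t N
    using that by (simp add: W_mat_def feature_vec_deriv_def A_op_def)
  have "(\<lambda>N. (W_mat \<kappa> \<sigma> x0 \<alpha> m N xs (\<lambda>t. F (xs t)) * pinv (V_mat \<kappa> \<sigma> x0 \<alpha> n N xs)) $$ (i, j))
      \<longlonglongrightarrow> (C * adj_inverse (gram \<alpha> ?rn)) $$ (i, j)"
  proof (rule least_squares_limit[OF _ _ G C gram_det_nonzero[OF inj] _ _ i j])
    fix i j assume ij: "i < ?rn" "j < ?rn"
    then show "(\<lambda>N. (\<Sum>t<N. V_mat \<kappa> \<sigma> x0 \<alpha> n N xs $$ (i, t) * V_mat \<kappa> \<sigma> x0 \<alpha> n N xs $$ (j, t)) / real N)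
        \<longlonglongrightarrow> gram \<alpha> ?rn $$ (i, j)"
      using VV[of i j] by (simp add: V_entry gram_def)
  next
    fix i j assume ij: "i < ?rm" "j < ?rn"
    then show "(\<lambda>N. (\<Sum>t<N. W_mat \<kappa> \<sigma> x0 \<alpha> m N xs (\<lambda>t. F (xs t)) $$ (i, t) * V_mat \<kappa> \<sigma> x0 \<alpha> n N xs $$ (j, t)) / real N)
        \<longlonglongrightarrow> C $$ (i, j)"
      using WV[of i j] by (simp add: V_entry W_entry C_def)
  qed (simp_all add: V_mat_def W_mat_def)
  also have "(C * adj_inverse (gram \<alpha> ?rn)) $$ (i, j) = regression \<alpha> F ?rn i j"
    using i j adj_inverse(1)[OF G gram_det_nonzero[OF inj]]
    by (auto simp: regression_def C_def scalar_prod_def atLeast0LessThan intro!: sum.cong)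
  finally show ?thesis .
qed

end

section \<open>Recovery of the vector field\<close>

lemma compact_zcoord_bounded:
  fixes x0 :: "real ^ 'n::finite"
  assumes \<sigma>: "0 < \<sigma>" and S: "bounded S"
  shows "\<exists>R\<ge>1. \<forall>x\<in>S. \<forall>l. \<bar>zcoord \<sigma> x0 x l\<bar> \<le> R"
proof -
  obtain b where b: "\<And>x. x \<in> S \<Longrightarrow> norm x \<le> b" using S by (auto simp: bounded_iff)
  have "\<bar>zcoord \<sigma> x0 x l\<bar> \<le> max 1 ((b + norm x0) / \<sigma>)" if "x \<in> S" for x l
  proof -
    have "\<bar>x $ l - x0 $ l\<bar> \<le> b + norm x0"
      using component_le_norm_cart[of x l] component_le_norm_cart[of x0 l] b[OF that] by linarith
    then have "\<bar>zcoord \<sigma> x0 x l\<bar> \<le> (b + norm x0) / \<sigma>"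
      using \<sigma> by (simp add: zcoord_def abs_divide divide_right_mono)
    then show ?thesis by simp
  qed
  then show ?thesis by (intro exI[of _ "max 1 ((b + norm x0) / \<sigma>)"]) simp
qed

lemma open_contains_cube:
  fixes U :: "(real ^ 'n::finite) set"
  assumes "open U" "U \<noteq> {}"
  shows "\<exists>y h. 0 < h \<and> cube y (2 * h) \<subseteq> U"
proof -
  obtain y where y: "y \<in> U" using assms by blast
  obtain e where e: "0 < e" "ball y e \<subseteq> U" using assms(1) y by (auto simp: open_contains_ball)
  \<comment> \<open>With side \<open>2 * h\<close> the coordinate differences add up to at most
    \<open>e / 2\<close>.\<close>
  define h where "h = e / (4 * CARD('n))"
  have h: "0 < h" using e by (simp add: h_def)
  have "cube y (2 * h) \<subseteq> ball y e"
  proof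
    fix x assume x: "x \<in> cube y (2 * h)"
    have "norm (x - y) \<le> (\<Sum>l\<in>UNIV. \<bar>(x - y) $ l\<bar>)" by (rule norm_le_l1_cart)
    also have "\<dots> \<le> (\<Sum>l\<in>(UNIV :: 'n set). 2 * h)"
    proof (rule sum_mono)
      fix l
      have "y $ l \<le> x $ l \<and> x $ l \<le> y $ l + 2 * h" using x unfolding mem_cube by blast
      then show "\<bar>(x - y) $ l\<bar> \<le> 2 * h" by simp
    qed
    also have "\<dots> = e / 2" by (simp add: h_def)
    finally show "x \<in> ball y e" using e(1) by (simp add: dist_norm norm_minus_commute)
  qed
  with e h show ?thesis by blast
qed

lemma ess_inf_on_pos:
  assumes "ess_inf_on U \<rho> > 0" and U: "U \<in> sets borel"
  shows "\<exists>\<delta>>0. AE x in lborel. x \<in> U \<longrightarrow> \<delta> \<le> \<rho> x"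
proof -
  define s where "s = esssup (restrict_space lborel U) (\<lambda>x. - ereal (\<rho> x))"
  have s: "s < 0" using assms(1) by (simp add: ess_inf_on_def s_def ereal_uminus_less_reorder)
  \<comment> \<open>The essential supremum may be minus infinity, in which case any positive number
    will do, here 1.\<close>
  then obtain \<delta> :: real where \<delta>: "0 < \<delta>" "s \<le> - ereal \<delta>"
  proof (cases s)
    case (real q)
    then show thesis using s that[of "- q"] by simp
  next
    case MInf
    then show thesis using that[of 1] by simp
  qed simp
  have "AE x in restrict_space lborel U. - ereal (\<rho> x) \<le> s" unfolding s_def by (rule esssup_AE)
  then have "AE x in restrict_space lborel U. \<delta> \<le> \<rho> x"
  proof eventually_elim
    case (elim x)
    then have "- ereal (\<rho> x) \<le> - ereal \<delta>" using \<delta>(2) by (rule order_trans)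
    then show ?case by simp
  qed
  then have "AE x in lborel. x \<in> U \<longrightarrow> \<delta> \<le> \<rho> x"
    using U by (subst (asm) AE_restrict_space_iff) auto
  with \<delta>(1) show ?thesis by blast
qed

lemma sampling_density:
  fixes x0 :: "real ^ 'n::finite" and \<rho> :: "real ^ 'n \<Rightarrow> real"
  assumes \<sigma>: "0 < \<sigma>" and \<rho>: "\<And>x. 0 \<le> \<rho> x"
    and meas: "(\<lambda>x. ennreal (\<rho> x)) \<in> borel_measurable lborel"
    and prob: "prob_space (density lborel (\<lambda>x. ennreal (\<rho> x)))"
    and supp: "compact (closure {x. \<rho> x \<noteq> 0})"
    and U: "open U" "U \<noteq> {}" "ess_inf_on U \<rho> > 0"
  shows "\<exists>y0 h R \<delta>. sampling (density lborel (\<lambda>x. ennreal (\<rho> x))) \<sigma> x0 y0 h R \<delta>"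
proof -
  let ?\<mu> = "density lborel (\<lambda>x. ennreal (\<rho> x))"
  obtain y0 h where h: "0 < h" "cube y0 (2 * h) \<subseteq> U" using open_contains_cube[OF U(1,2)] by blast
  obtain \<delta> where \<delta>: "0 < \<delta>" and ae: "AE x in lborel. x \<in> U \<longrightarrow> \<delta> \<le> \<rho> x"
    using ess_inf_on_pos[OF U(3)] U(1) by auto
  obtain R where R: "R \<ge> 1" and RS: "\<forall>x\<in>closure {x. \<rho> x \<noteq> 0}. \<forall>l. \<bar>zcoord \<sigma> x0 x l\<bar> \<le> R"
    using compact_zcoord_bounded[OF \<sigma> compact_imp_bounded[OF supp]] by blast
  have "sampling ?\<mu> \<sigma> x0 y0 h R \<delta>"
  proof (rule sampling.intro[OF prob], rule sampling_axioms.intro)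
    show "sets ?\<mu> = sets borel" by simp
    show "AE x in ?\<mu>. \<forall>l. \<bar>zcoord \<sigma> x0 x l\<bar> \<le> R"
    proof (subst AE_density[OF meas], rule AE_I2, rule impI)
      fix x assume "0 < ennreal (\<rho> x)"
      then have "x \<in> {x. \<rho> x \<noteq> 0}" by auto
      then have "x \<in> closure {x. \<rho> x \<noteq> 0}" by (rule subsetD[OF closure_subset])
      then show "\<forall>l. \<bar>zcoord \<sigma> x0 x l\<bar> \<le> R" using RS by blast
    qed
  next
    fix g :: "real ^ 'n \<Rightarrow> ennreal"
    assume g [measurable]: "g \<in> borel_measurable borel"
    have "ennreal \<delta> * (\<integral>\<^sup>+x\<in>cube y0 (2 * h). g x \<partial>lborel) = (\<integral>\<^sup>+x. ennreal \<delta> * (g x * indicator (cube y0 (2 * h)) x) \<partial>lborel)"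
      by (rule nn_integral_cmult[symmetric]) measurable
    also have "\<dots> \<le> (\<integral>\<^sup>+x. ennreal (\<rho> x) * g x \<partial>lborel)"
    proof (rule nn_integral_mono_AE)
      show "AE x in lborel. ennreal \<delta> * (g x * indicator (cube y0 (2 * h)) x) \<le> ennreal (\<rho> x) * g x"
        using ae
      proof eventually_elim
        case (elim x)
        show ?case
        proof (cases "x \<in> cube y0 (2 * h)")
          case True
          then have "\<delta> \<le> \<rho> x" using elim h(2) by blast
          then show ?thesis using True by (simp add: mult_right_mono ennreal_leI)
        qed simp
      qed
    qed
    also have "\<dots> = (\<integral>\<^sup>+x. g x \<partial>?\<mu>)"
      by (rule nn_integral_density[symmetric]) (use meas in auto)
    finally show "ennreal \<delta> * (\<integral>\<^sup>+x\<in>cube y0 (2 * h). g x \<partial>lborel) \<le> (\<integral>\<^sup>+x. g x \<partial>?\<mu>)" .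
  qed (fact \<sigma> h(1) \<delta> R)+
  then show ?thesis by blast
qed

text \<open>The sum over \<open>j\<close> gives \<open>A\<^sub>F\<close> of the feature \<open>\<alpha> i\<close>. In the exponential case only \<open>\<alpha> i = e\<^sub>l\<close> occurs; in
  the Gaussian case the sum over \<open>i\<close> is \<open>\<sigma>\<^sup>2 \<Sum>\<^sub>l\<^sub>' F\<^sub>l\<^sub>' \<partial>\<^sub>s\<^sub>l \<partial>\<^sub>t\<^sub>l\<^sub>' k(s, t)\<close> at \<open>s = t\<close>, which is \<open>F\<^sub>l\<close>.\<close>

lemma output_series:
  fixes x0 :: "real ^ 'n::finite" and a :: "('n \<Rightarrow> nat) \<Rightarrow> ('n \<Rightarrow> nat) \<Rightarrow> real"
  assumes \<sigma>: "0 < \<sigma>" and c: "bij_betw c {..<CARD('n)} UNIV" and \<alpha>: "graded_enumeration c \<alpha>"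
    and summable: "\<And>p T. T \<ge> 1 \<Longrightarrow> (\<lambda>\<beta>. \<bar>a p \<beta>\<bar> * T ^ sum \<beta> UNIV) summable_on UNIV"
    and bound: "\<And>p T. T \<ge> 1 \<Longrightarrow> (\<Sum>\<^sub>\<infinity>\<beta>. \<bar>a p \<beta>\<bar> * T ^ sum \<beta> UNIV) \<le> (2 * T) ^ sum p UNIV * B T"
    and expansion: "\<And>p x. ((\<lambda>\<beta>. a p \<beta> * mon (zcoord \<sigma> x0 x) \<beta>) has_sum
        A_op F (feature \<kappa> \<sigma> x0 p) x / weight \<kappa> \<sigma> x0 x) UNIV"
    and R: "R \<ge> 1"
  shows "\<exists>P. (\<forall>l i j y. (\<forall>l. \<bar>zcoord \<sigma> x0 y l\<bar> \<le> R) \<longrightarrow> \<bar>output_coeff \<kappa> \<sigma> x0 c \<alpha> l i j y\<bar> \<le> P l i j) \<and>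
    (\<forall>l. (\<lambda>(i, j). \<bar>a (\<alpha> i) (\<alpha> j)\<bar> * P l i j) summable_on UNIV) \<and>
    (\<forall>l y. (\<forall>l. \<bar>zcoord \<sigma> x0 y l\<bar> \<le> R) \<longrightarrow>
       ((\<lambda>(i, j). a (\<alpha> i) (\<alpha> j) * output_coeff \<kappa> \<sigma> x0 c \<alpha> l i j y) has_sum F y $ l) UNIV)"
proof -
  have bij: "bij_betw \<alpha> UNIV UNIV" using \<alpha> by (simp add: graded_enumeration_def)
  define i0 where "i0 = (\<lambda>l. Suc (the_inv_into {..<CARD('n)} c l))"
  have \<alpha>_i0: "\<alpha> (i0 l) = unit_index l" for l
  proof -
    have "the_inv_into {..<CARD('n)} c l < CARD('n)"
      using the_inv_into_into[of c "{..<CARD('n)}" l "{..<CARD('n)}"] c by (auto simp: bij_betw_def)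
    moreover have "c (the_inv_into {..<CARD('n)} c l) = l"
      using f_the_inv_into_f[of c "{..<CARD('n)}" l] c by (auto simp: bij_betw_def)
    ultimately show ?thesis using \<alpha> by (simp add: graded_enumeration_def i0_def)
  qed
  \<comment> \<open>Bounds the part of \<open>output_coeff\<close> that depends on \<open>i\<close>.
    In the Gaussian case it is \<open>\<sigma>\<^sup>2\<close> times the derivative bound
    \<open>pd_le\<close>, divided by the factorial.\<close>
  define q where "q = (\<lambda>l i. case \<kappa> of Exponential \<Rightarrow> if i = i0 l then \<sigma> else 0
      | Gaussian \<Rightarrow> 2 * \<sigma> * R * (2 * R) ^ sum (\<alpha> i) UNIV / multi_fact (\<alpha> i))"
  define P where "P = (\<lambda>l i j. q l i * R ^ sum (\<alpha> j) UNIV)"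
  have q0: "0 \<le> q l i" for l i
    using \<sigma> R multi_fact_pos[of "\<alpha> i"] by (cases \<kappa>) (auto simp: q_def)
  have v_le: "\<bar>feature \<kappa> \<sigma> x0 p y\<bar> \<le> R ^ sum p UNIV" if y: "\<And>l. \<bar>zcoord \<sigma> x0 y l\<bar> \<le> R" for p y
  proof -
    have "\<bar>feature \<kappa> \<sigma> x0 p y\<bar> = weight \<kappa> \<sigma> x0 y * \<bar>mon (zcoord \<sigma> x0 y) p\<bar>"
      using weight_pos[of \<kappa> \<sigma> x0 y] by (simp add: feature_eq abs_mult)
    also have "\<dots> \<le> 1 * R ^ sum p UNIV"
      using weight_pos[of \<kappa> \<sigma> x0 y] weight_le_1[of \<kappa> \<sigma> x0 y] y by (intro mult_mono abs_mon_le) auto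
    finally show ?thesis by simp
  qed
  have pd_le: "\<bar>partial_deriv l (feature \<kappa> \<sigma> x0 p) y\<bar> \<le> 2 * R * (2 * R) ^ sum p UNIV / \<sigma>"
    if y: "\<And>l. \<bar>zcoord \<sigma> x0 y l\<bar> \<le> R" for l p y
  proof -
    define z where "z = zcoord \<sigma> x0 y"
    have z: "\<bar>z l\<bar> \<le> R" for l using y by (simp add: z_def)
    have g: "0 \<le> gauss_ind \<kappa>" "gauss_ind \<kappa> \<le> 1" by (cases \<kappa>; simp add: gauss_ind_def)+
    have RR: "R ^ sum p UNIV \<le> (2 * R) ^ sum p UNIV" using R by (intro power_mono) auto
    have "\<bar>real (p l) / \<sigma> * mon z (p(l := p l - 1))\<bar> \<le> R * (2 * R) ^ sum p UNIV / \<sigma>"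
    proof -
      have "p l \<le> sum p UNIV" by (rule member_le_sum) auto
      also have "sum p UNIV \<le> 2 ^ sum p UNIV" by (rule less_imp_le[OF less_exp])
      finally have p: "real (p l) \<le> 2 ^ sum p UNIV"
        by (metis of_nat_le_iff of_nat_numeral of_nat_power)
      have "\<bar>mon z (p(l := p l - 1))\<bar> \<le> R ^ sum (p(l := p l - 1)) UNIV" by (rule abs_mon_le[OF z])
      also have "\<dots> \<le> R ^ sum p UNIV" using R by (intro power_increasing sum_mono) auto
      finally have "real (p l) * \<bar>mon z (p(l := p l - 1))\<bar> \<le> 2 ^ sum p UNIV * R ^ sum p UNIV"
        using p by (intro mult_mono) auto
      also have "\<dots> = (2 * R) ^ sum p UNIV" by (simp add: power_mult_distrib)
      also have "\<dots> \<le> R * (2 * R) ^ sum p UNIV" using R mult_right_mono[of 1 R "(2 * R) ^ sum p UNIV"] by simp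
      finally have "real (p l) * \<bar>mon z (p(l := p l - 1))\<bar> / \<sigma> \<le> R * (2 * R) ^ sum p UNIV / \<sigma>"
        using \<sigma> by (intro divide_right_mono) auto
      then show ?thesis using \<sigma> by (simp add: abs_mult)
    qed
    moreover have "\<bar>gauss_ind \<kappa> / \<sigma> * (z l * mon z p)\<bar> \<le> R * (2 * R) ^ sum p UNIV / \<sigma>"
    proof -
      have "\<bar>z l\<bar> * \<bar>mon z p\<bar> \<le> R * (2 * R) ^ sum p UNIV"
        using z R by (intro mult_mono order_trans[OF abs_mon_le[of z R p] RR]) auto
      from mult_mono[OF g(2) this]
      have "gauss_ind \<kappa> * (\<bar>z l\<bar> * \<bar>mon z p\<bar>) \<le> 1 * (R * (2 * R) ^ sum p UNIV)" by simp
      then have "gauss_ind \<kappa> * (\<bar>z l\<bar> * \<bar>mon z p\<bar>) / \<sigma> \<le> R * (2 * R) ^ sum p UNIV / \<sigma>"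
        using \<sigma> by (intro divide_right_mono) auto
      then show ?thesis using \<sigma> g by (simp add: abs_mult)
    qed
    ultimately have "\<bar>real (p l) / \<sigma> * mon z (p(l := p l - 1)) - gauss_ind \<kappa> / \<sigma> * (z l * mon z p)\<bar>
        \<le> R * (2 * R) ^ sum p UNIV / \<sigma> + R * (2 * R) ^ sum p UNIV / \<sigma>"
      by (rule order_trans[OF abs_triangle_ineq4 add_mono])
    also have "\<dots> = 2 * R * (2 * R) ^ sum p UNIV / \<sigma>" by simp
    finally have "\<bar>real (p l) / \<sigma> * mon z (p(l := p l - 1)) - gauss_ind \<kappa> / \<sigma> * (z l * mon z p)\<bar>
        \<le> 2 * R * (2 * R) ^ sum p UNIV / \<sigma>" .
    then have "weight \<kappa> \<sigma> x0 y * \<bar>real (p l) / \<sigma> * mon z (p(l := p l - 1)) - gauss_ind \<kappa> / \<sigma> * (z l * mon z p)\<bar>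
        \<le> 1 * (2 * R * (2 * R) ^ sum p UNIV / \<sigma>)"
      using weight_pos[of \<kappa> \<sigma> x0 y] weight_le_1[of \<kappa> \<sigma> x0 y] by (intro mult_mono) auto
    then show ?thesis
      using weight_pos[of \<kappa> \<sigma> x0 y] by (simp add: partial_deriv_feature[OF \<sigma>] z_def abs_mult)
  qed
  have out_le: "\<bar>output_coeff \<kappa> \<sigma> x0 c \<alpha> l i j y\<bar> \<le> P l i j" if y: "\<And>l. \<bar>zcoord \<sigma> x0 y l\<bar> \<le> R" for l i j y
  proof (cases \<kappa>)
    case Exponential
    then show ?thesis
      using v_le[OF y, of "\<alpha> j"] \<sigma> by (simp add: output_coeff_def P_def q_def i0_def abs_mult mult_left_mono)
  next
    case Gaussian
    have "\<sigma>\<^sup>2 * \<bar>partial_deriv l (feature \<kappa> \<sigma> x0 (\<alpha> i)) y\<bar> \<le> \<sigma>\<^sup>2 * (2 * R * (2 * R) ^ sum (\<alpha> i) UNIV / \<sigma>)"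
      by (intro mult_left_mono pd_le y) auto
    also have "\<dots> = 2 * \<sigma> * R * (2 * R) ^ sum (\<alpha> i) UNIV" using \<sigma> by (simp add: power2_eq_square)
    finally have "\<sigma>\<^sup>2 * \<bar>partial_deriv l (feature \<kappa> \<sigma> x0 (\<alpha> i)) y\<bar> / multi_fact (\<alpha> i) \<le> q l i"
      using multi_fact_pos[of "\<alpha> i"] by (simp add: q_def Gaussian divide_right_mono)
    then have "\<sigma>\<^sup>2 * \<bar>partial_deriv l (feature \<kappa> \<sigma> x0 (\<alpha> i)) y\<bar> / multi_fact (\<alpha> i) * \<bar>feature \<kappa> \<sigma> x0 (\<alpha> j) y\<bar> \<le> P l i j"
      unfolding P_def using v_le[OF y, of "\<alpha> j"] q0 by (intro mult_mono) auto
    then show ?thesis using multi_fact_pos[of "\<alpha> i"] by (simp add: output_coeff_def Gaussian abs_mult)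
  qed
  have summ: "(\<lambda>(i, j). \<bar>a (\<alpha> i) (\<alpha> j)\<bar> * P l i j) summable_on UNIV" for l
  proof -
    define s where "s = (\<lambda>i. q l i * (\<Sum>\<^sub>\<infinity>\<beta>. \<bar>a (\<alpha> i) \<beta>\<bar> * R ^ sum \<beta> UNIV))"
    have "(\<lambda>(i, j). \<bar>a (\<alpha> i) (\<alpha> j)\<bar> * P l i j) summable_on Sigma UNIV (\<lambda>_. UNIV)"
    proof (rule summable_on_SigmaI[where g = s])
      fix i
      have "((\<lambda>\<beta>. \<bar>a (\<alpha> i) \<beta>\<bar> * R ^ sum \<beta> UNIV) has_sum (\<Sum>\<^sub>\<infinity>\<beta>. \<bar>a (\<alpha> i) \<beta>\<bar> * R ^ sum \<beta> UNIV)) UNIV"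
        by (rule has_sum_infsum[OF summable[OF R]])
      then have "((\<lambda>j. \<bar>a (\<alpha> i) (\<alpha> j)\<bar> * R ^ sum (\<alpha> j) UNIV) has_sum (\<Sum>\<^sub>\<infinity>\<beta>. \<bar>a (\<alpha> i) \<beta>\<bar> * R ^ sum \<beta> UNIV)) UNIV"
        by (subst has_sum_reindex_bij_betw[OF bij, of "\<lambda>\<beta>. \<bar>a (\<alpha> i) \<beta>\<bar> * R ^ sum \<beta> UNIV"])
      from has_sum_cmult_right[OF this, of "q l i"]
      show "((\<lambda>j. case (i, j) of (i, j) \<Rightarrow> \<bar>a (\<alpha> i) (\<alpha> j)\<bar> * P l i j) has_sum s i) UNIV"
        by (simp add: s_def P_def mult_ac)
      show "0 \<le> (case (i, j) of (i, j) \<Rightarrow> \<bar>a (\<alpha> i) (\<alpha> j)\<bar> * P l i j)" for j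
        using q0 R by (simp add: P_def)
    next
      show "s summable_on UNIV"
      proof (cases \<kappa>)
        case Exponential
        then have "s i = 0" if "i \<noteq> i0 l" for i using that by (simp add: s_def q_def)
        then have "s summable_on UNIV \<longleftrightarrow> s summable_on {i0 l}"
          by (intro summable_on_cong_neutral) auto
        then show ?thesis by simp
      next
        case Gaussian
        \<comment> \<open>One geometric factor in \<open>2 * R\<close> comes from the differentiated
          feature of the output, the other from the growth of the coefficients of the image of the
          feature. Their product is geometric in \<open>4 * R\<^sup>2\<close>, and the factorial
          makes it summable.\<close>
        define t where "t = (\<lambda>\<beta>::'n \<Rightarrow> nat. 2 * \<sigma> * R * B R * (mon (\<lambda>_. 4 * R\<^sup>2) \<beta> / multi_fact \<beta>))"
        have "t summable_on UNIV"
          unfolding t_def by (intro summable_on_cmult_right has_sum_imp_summable[OF has_sum_multi_exp])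
        then have t: "(\<lambda>i. t (\<alpha> i)) summable_on UNIV"
          by (subst summable_on_reindex_bij_betw[OF bij])
        have "0 \<le> (\<Sum>\<^sub>\<infinity>\<beta>. \<bar>a p \<beta>\<bar> * R ^ sum \<beta> UNIV)" for p
          using R by (intro infsum_nonneg) auto
        then have s0: "0 \<le> s i" for i using q0 by (simp add: s_def)
        have "s i \<le> t (\<alpha> i)" for i
        proof -
          have "s i \<le> q l i * ((2 * R) ^ sum (\<alpha> i) UNIV * B R)"
            unfolding s_def by (intro mult_left_mono bound R q0)
          also have "\<dots> = t (\<alpha> i)"
          proof -
            have "(2 * R) * (2 * R) = 4 * R\<^sup>2" by (simp add: power2_eq_square)
            then have "(2 * R) ^ sum (\<alpha> i) UNIV * (2 * R) ^ sum (\<alpha> i) UNIV = (4 * R\<^sup>2) ^ sum (\<alpha> i) UNIV"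
              by (simp only: power_mult_distrib[symmetric])
            then have "q l i * ((2 * R) ^ sum (\<alpha> i) UNIV * B R)
                = 2 * \<sigma> * R * B R * ((4 * R\<^sup>2) ^ sum (\<alpha> i) UNIV / multi_fact (\<alpha> i))"
              by (simp add: q_def Gaussian flip: times_divide_eq_right) (simp add: mult_ac)
            then show ?thesis by (simp add: t_def mon_const)
          qed
          finally show ?thesis .
        qed
        then show ?thesis using s0 by (rule summable_on_comparison_test[OF t])
      qed
    qed
    then show ?thesis by simp
  qed
  have total: "((\<lambda>(i, j). a (\<alpha> i) (\<alpha> j) * output_coeff \<kappa> \<sigma> x0 c \<alpha> l i j y) has_sum F y $ l) UNIV"
    if y: "\<And>l. \<bar>zcoord \<sigma> x0 y l\<bar> \<le> R" for l y
  proof -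
    define o1 where "o1 = (\<lambda>i. case \<kappa> of Exponential \<Rightarrow> if i = i0 l then \<sigma> else 0
      | Gaussian \<Rightarrow> \<sigma>\<^sup>2 * (partial_deriv l (feature \<kappa> \<sigma> x0 (\<alpha> i)) y / multi_fact (\<alpha> i)))"
    have oc: "output_coeff \<kappa> \<sigma> x0 c \<alpha> l i j y = o1 i * feature \<kappa> \<sigma> x0 (\<alpha> j) y" for i j
      by (cases \<kappa>) (simp_all add: output_coeff_def o1_def i0_def)
    have "((\<lambda>(i, j). a (\<alpha> i) (\<alpha> j) * output_coeff \<kappa> \<sigma> x0 c \<alpha> l i j y) has_sum F y $ l) (Sigma UNIV (\<lambda>_. UNIV))"
    proof (rule has_sum_SigmaI[where g = "\<lambda>i. o1 i * A_op F (feature \<kappa> \<sigma> x0 (\<alpha> i)) y"])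
      fix i
      have "((\<lambda>j. a (\<alpha> i) (\<alpha> j) * mon (zcoord \<sigma> x0 y) (\<alpha> j)) has_sum
          A_op F (feature \<kappa> \<sigma> x0 (\<alpha> i)) y / weight \<kappa> \<sigma> x0 y) UNIV"
        using expansion[of "\<alpha> i" y]
        by (subst has_sum_reindex_bij_betw[OF bij, of "\<lambda>\<beta>. a (\<alpha> i) \<beta> * mon (zcoord \<sigma> x0 y) \<beta>"])
      from has_sum_cmult_right[OF this, of "o1 i * weight \<kappa> \<sigma> x0 y"]
      show "((\<lambda>j. case (i, j) of (i, j) \<Rightarrow> a (\<alpha> i) (\<alpha> j) * output_coeff \<kappa> \<sigma> x0 c \<alpha> l i j y)
          has_sum o1 i * A_op F (feature \<kappa> \<sigma> x0 (\<alpha> i)) y) UNIV"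
        using weight_pos[of \<kappa> \<sigma> x0 y] by (simp add: oc feature_eq mult_ac)
    next
      \<comment> \<open>The majorant \<open>P\<close> gives absolute summability, which is what
        permits summing row by row.\<close>
      show "(\<lambda>(i, j). a (\<alpha> i) (\<alpha> j) * output_coeff \<kappa> \<sigma> x0 c \<alpha> l i j y) summable_on Sigma UNIV (\<lambda>_. UNIV)"
      proof (rule abs_summable_summable, rule summable_on_comparison_test)
        show "(\<lambda>(i, j). \<bar>a (\<alpha> i) (\<alpha> j)\<bar> * P l i j) summable_on Sigma UNIV (\<lambda>_. UNIV)" using summ[of l] by simp
      qed (auto simp: abs_mult intro!: mult_left_mono out_le y)
    next
      show "((\<lambda>i. o1 i * A_op F (feature \<kappa> \<sigma> x0 (\<alpha> i)) y) has_sum F y $ l) UNIV"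
      proof (cases \<kappa>)
        case Exponential
        have "A_op F (feature \<kappa> \<sigma> x0 (unit_index l)) y = F y $ l / \<sigma>"
        proof -
          have "partial_deriv l' (feature \<kappa> \<sigma> x0 (unit_index l)) y = (if l' = l then 1 / \<sigma> else 0)" for l'
          proof (cases "l' = l")
            case True
            have "(unit_index l)(l := 0) = (\<lambda>_. 0)" by auto
            then show ?thesis
              unfolding partial_deriv_feature[OF \<sigma>]
              by (simp add: Exponential True gauss_ind_def weight_def mon_zero_index)
          next
            case False
            then show ?thesis
              unfolding partial_deriv_feature[OF \<sigma>] by (simp add: Exponential gauss_ind_def)
          qed
          then show ?thesis by (simp add: A_op_def if_distrib[of "(*) _"] cong: if_cong)
        qed
        then have "((\<lambda>i. o1 i * A_op F (feature \<kappa> \<sigma> x0 (\<alpha> i)) y) has_sum F y $ l) {i0 l}"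
          using \<sigma> by (intro has_sum_finiteI) (simp_all add: o1_def Exponential \<alpha>_i0)
        moreover have "((\<lambda>i. o1 i * A_op F (feature \<kappa> \<sigma> x0 (\<alpha> i)) y) has_sum F y $ l) {i0 l} \<longleftrightarrow>
            ((\<lambda>i. o1 i * A_op F (feature \<kappa> \<sigma> x0 (\<alpha> i)) y) has_sum F y $ l) UNIV"
          by (rule has_sum_cong_neutral) (auto simp: o1_def Exponential)
        ultimately show ?thesis by blast
      next
        case Gaussian
        define d where "d = (\<lambda>l p. partial_deriv l (feature Gaussian \<sigma> x0 p) y)"
        have "((\<lambda>p. \<Sum>l'\<in>UNIV. \<sigma>\<^sup>2 * F y $ l' * (d l p * d l' p / multi_fact p)) has_sum
            (\<Sum>l'\<in>UNIV. \<sigma>\<^sup>2 * F y $ l' * (if l = l' then 1 / \<sigma>\<^sup>2 else 0))) UNIV"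
          unfolding d_def by (intro has_sum_sum has_sum_cmult_right gaussian_derivative_orthogonality \<sigma>) simp
        moreover have "(\<Sum>l'\<in>UNIV. \<sigma>\<^sup>2 * F y $ l' * (if l = l' then 1 / \<sigma>\<^sup>2 else 0)) = F y $ l"
          using \<sigma> by (simp add: if_distrib[of "(*) _"] cong: if_cong)
        moreover have "(\<Sum>l'\<in>UNIV. \<sigma>\<^sup>2 * F y $ l' * (d l p * d l' p / multi_fact p))
            = \<sigma>\<^sup>2 * (d l p / multi_fact p) * A_op F (feature \<kappa> \<sigma> x0 p) y" for p
          unfolding A_op_def sum_distrib_left by (intro sum.cong refl) (simp add: d_def Gaussian)
        ultimately have "((\<lambda>p. \<sigma>\<^sup>2 * (d l p / multi_fact p) * A_op F (feature \<kappa> \<sigma> x0 p) y) has_sum F y $ l) UNIV"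
          by (simp only:)
        then have "((\<lambda>i. \<sigma>\<^sup>2 * (d l (\<alpha> i) / multi_fact (\<alpha> i)) * A_op F (feature \<kappa> \<sigma> x0 (\<alpha> i)) y) has_sum F y $ l) UNIV"
          by (rule has_sum_reindex_bij_betw[OF bij, THEN iffD2])
        then show ?thesis by (simp add: o1_def d_def Gaussian)
      qed
    qed
    then show ?thesis by simp
  qed
  show ?thesis
  proof (rule exI[of _ P], intro conjI allI impI)
    fix l i j y
    assume "\<forall>l. \<bar>zcoord \<sigma> x0 y l\<bar> \<le> R"
    then have y: "\<And>l. \<bar>zcoord \<sigma> x0 y l\<bar> \<le> R" by (rule spec)
    show "\<bar>output_coeff \<kappa> \<sigma> x0 c \<alpha> l i j y\<bar> \<le> P l i j" using y by (rule out_le)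
  next
    fix l y
    assume "\<forall>l. \<bar>zcoord \<sigma> x0 y l\<bar> \<le> R"
    then have y: "\<And>l. \<bar>zcoord \<sigma> x0 y l\<bar> \<le> R" by (rule spec)
    show "((\<lambda>(i, j). a (\<alpha> i) (\<alpha> j) * output_coeff \<kappa> \<sigma> x0 c \<alpha> l i j y) has_sum F y $ l) UNIV"
      using y by (rule total)
  qed (rule summ)
qed

theorem theorem7p6:
  fixes \<kappa> :: kernel_kind and \<sigma> :: real
    and F :: "real ^ 'n::finite \<Rightarrow> real ^ 'n" and x0 :: "real ^ 'n"
    and H :: "(real ^ 'n \<Rightarrow> real) set"
    and ip :: "(real ^ 'n \<Rightarrow> real) \<Rightarrow> (real ^ 'n \<Rightarrow> real) \<Rightarrow> real"
    and c :: "nat \<Rightarrow> 'n" and \<alpha> :: "nat \<Rightarrow> 'n \<Rightarrow> nat"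
    and M :: "'w measure" and X :: "nat \<Rightarrow> 'w \<Rightarrow> real ^ 'n"
    and \<rho> :: "real ^ 'n \<Rightarrow> real" and U K :: "(real ^ 'n) set"
  assumes "\<sigma> > 0"
    and "\<And>l. C_infinity (\<lambda>x. F x $ l)"
    and "F x0 = 0"
    and "rkhs (kernel_fun \<kappa> \<sigma> x0) H ip"
    and "bij_betw c {..<CARD('n)} UNIV"
    and "jet_span c (kernel_fun \<kappa> \<sigma> x0) x0 \<subseteq> A_dom H F"
    and "graded_enumeration c \<alpha>"
    and "prob_space M"
    and "prob_space.indep_vars M (\<lambda>_. borel) X UNIV"
    and "\<And>x. 0 \<le> \<rho> x"
    and "\<And>j. distributed M lborel (X j) (\<lambda>x. ennreal (\<rho> x))"
    and "compact (closure {x. \<rho> x \<noteq> 0})"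
    and "open U" and "U \<noteq> {}" and "ess_inf_on U \<rho> > 0"
    and "compact K"
  shows "AE \<omega> in M.
    \<exists>(L :: nat \<Rightarrow> nat \<Rightarrow> ennreal) (L' :: nat \<Rightarrow> ennreal).
      (\<forall>m n. 1 \<le> m \<longrightarrow> m \<le> n \<longrightarrow> L m n < \<top> \<and>
        (\<lambda>N. sup_dist_on K F
               (F_hat \<kappa> \<sigma> x0 c \<alpha> m n N (\<lambda>j. X j \<omega>) (\<lambda>j. F (X j \<omega>)))) \<longlonglongrightarrow> L m n) \<and>
      (\<forall>m. 1 \<le> m \<longrightarrow> L' m < \<top> \<and> (\<lambda>n. L m n) \<longlonglongrightarrow> L' m) \<and>
      L' \<longlonglongrightarrow> 0"
proof -
  have \<sigma>: "0 < \<sigma>" using assms(1) by simp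
  have F_cont: "continuous_on UNIV (\<lambda>x. F x $ l)" for l
  proof -
    have "continuous_on UNIV (iter_partial [] (\<lambda>x. F x $ l))"
      using assms(2)[of l] unfolding C_infinity_def by blast
    then show ?thesis by (simp add: iter_partial_def)
  qed
  have \<alpha>: "bij_betw \<alpha> UNIV UNIV" "\<And>i j. i \<le> j \<Longrightarrow> sum (\<alpha> i) UNIV \<le> sum (\<alpha> j) UNIV"
    using assms(7) by (simp_all add: graded_enumeration_def)
  have inj: "inj \<alpha>" using \<alpha>(1) by (simp add: bij_betw_def)
  obtain T where T: "\<And>p. entire_bd \<sigma> x0 (\<lambda>x. A_op F (feature \<kappa> \<sigma> x0 p) x / weight \<kappa> \<sigma> x0 x)
      (\<lambda>R. (2 * R) ^ sum p UNIV * T R)"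
    using A_op_feature_entire[OF \<sigma> assms(4,5,6)] by blast
  from choice[OF allI[OF T[unfolded entire_bd_def]]] obtain a where
    a: "\<forall>p. (\<forall>R\<ge>1. (\<lambda>\<beta>. \<bar>a p \<beta>\<bar> * R ^ sum \<beta> UNIV) summable_on UNIV \<and>
          (\<Sum>\<^sub>\<infinity>\<beta>. \<bar>a p \<beta>\<bar> * R ^ sum \<beta> UNIV) \<le> (2 * R) ^ sum p UNIV * T R) \<and>
        (\<forall>x. ((\<lambda>\<beta>. a p \<beta> * mon (zcoord \<sigma> x0 x) \<beta>) has_sum
          A_op F (feature \<kappa> \<sigma> x0 p) x / weight \<kappa> \<sigma> x0 x) UNIV)" ..
  have a_sum: "(\<lambda>\<beta>. \<bar>a p \<beta>\<bar> * R ^ sum \<beta> UNIV) summable_on UNIV"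
    and a_bound: "(\<Sum>\<^sub>\<infinity>\<beta>. \<bar>a p \<beta>\<bar> * R ^ sum \<beta> UNIV) \<le> (2 * R) ^ sum p UNIV * T R" if "R \<ge> 1" for p R
    using a that by auto
  have a_exp: "((\<lambda>\<beta>. a p \<beta> * mon (zcoord \<sigma> x0 x) \<beta>) has_sum
      A_op F (feature \<kappa> \<sigma> x0 p) x / weight \<kappa> \<sigma> x0 x) UNIV" for p x
    using a by blast
  \<comment> \<open>This radius belongs to \<open>K\<close> and is unrelated to the radius
    \<open>R'\<close> of the support of the samples obtained below: \<open>K\<close> may lie
    anywhere.\<close>
  obtain R where R: "R \<ge> 1" and RK: "\<And>y l. y \<in> K \<Longrightarrow> \<bar>zcoord \<sigma> x0 y l\<bar> \<le> R"
    using compact_zcoord_bounded[OF \<sigma> compact_imp_bounded[OF assms(16)]] by blast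
  obtain P where P: "\<And>l i j y. (\<forall>l. \<bar>zcoord \<sigma> x0 y l\<bar> \<le> R) \<Longrightarrow> \<bar>output_coeff \<kappa> \<sigma> x0 c \<alpha> l i j y\<bar> \<le> P l i j"
    and P_sum: "\<And>l. (\<lambda>(i, j). \<bar>a (\<alpha> i) (\<alpha> j)\<bar> * P l i j) summable_on UNIV"
    and total: "\<And>l y. (\<forall>l. \<bar>zcoord \<sigma> x0 y l\<bar> \<le> R) \<Longrightarrow>
       ((\<lambda>(i, j). a (\<alpha> i) (\<alpha> j) * output_coeff \<kappa> \<sigma> x0 c \<alpha> l i j y) has_sum F y $ l) UNIV"
    using output_series[OF \<sigma> assms(5,7) a_sum a_bound a_exp R] by blast
  interpret M: prob_space M by (rule assms(8))
  define \<mu> where "\<mu> = density lborel (\<lambda>x. ennreal (\<rho> x))"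
  have X_meas: "X i \<in> measurable M borel" for i
    using distributed_measurable[OF assms(11)[of i]] by simp
  have X_distr: "distr M borel (X i) = \<mu>" for i
  proof -
    have "distr M borel (X i) = distr M lborel (X i)" by (rule distr_cong) auto
    also have "\<dots> = \<mu>" using assms(11)[of i] by (simp add: distributed_def \<mu>_def)
    finally show ?thesis .
  qed
  have \<mu>_prob: "prob_space \<mu>" unfolding X_distr[of 0, symmetric] by (rule M.prob_space_distr[OF X_meas])
  have \<rho>_meas: "(\<lambda>x. ennreal (\<rho> x)) \<in> borel_measurable lborel"
    using assms(11)[of 0] by (simp add: distributed_def)
  obtain y0 h R' \<delta> where "sampling \<mu> \<sigma> x0 y0 h R' \<delta>"
    using sampling_density[OF \<sigma> assms(10) \<rho>_meas \<mu>_prob[unfolded \<mu>_def] assms(12,13,14,15)]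
    unfolding \<mu>_def by blast
  then interpret S: sampling \<mu> \<kappa> \<sigma> x0 y0 h R' \<delta> .
  have A_meas: "A_op F (feature \<kappa> \<sigma> x0 p) \<in> borel_measurable borel" for p
    by (rule borel_measurable_A_op_feature[OF \<sigma> F_cont])
  have A_bm: "S.bounded_measurable (A_op F (feature \<kappa> \<sigma> x0 p))" for p
    by (rule S.entire_bounded_measurable[OF A_meas a_sum a_exp])
  have lln: "AE \<omega> in M. (\<lambda>N. (\<Sum>t<N. g (X t \<omega>)) / real N) \<longlonglongrightarrow> (\<integral>x. g x \<partial>\<mu>)"
    if g: "S.bounded_measurable g" for g
  proof -
    obtain B where "g \<in> borel_measurable borel" "AE x in \<mu>. \<bar>g x\<bar> \<le> B"
      using g unfolding S.bounded_measurable_def by blast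
    then show ?thesis by (rule M.empirical_means_converge[OF assms(9) X_distr])
  qed
  \<comment> \<open>Only countably many pairs of indices occur, so one null set serves all m and n
    simultaneously.\<close>
  have VV: "AE \<omega> in M. \<forall>i j. (\<lambda>N. (\<Sum>t<N. feature \<kappa> \<sigma> x0 (\<alpha> i) (X t \<omega>) * feature \<kappa> \<sigma> x0 (\<alpha> j) (X t \<omega>)) / real N)
      \<longlonglongrightarrow> (\<integral>x. feature \<kappa> \<sigma> x0 (\<alpha> i) x * feature \<kappa> \<sigma> x0 (\<alpha> j) x \<partial>\<mu>)"
    unfolding AE_all_countable by (intro allI lln S.bounded_measurable_intros)
  have WV: "AE \<omega> in M. \<forall>i j. (\<lambda>N. (\<Sum>t<N. A_op F (feature \<kappa> \<sigma> x0 (\<alpha> i)) (X t \<omega>) * feature \<kappa> \<sigma> x0 (\<alpha> j) (X t \<omega>)) / real N)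
      \<longlonglongrightarrow> (\<integral>x. A_op F (feature \<kappa> \<sigma> x0 (\<alpha> i)) x * feature \<kappa> \<sigma> x0 (\<alpha> j) x \<partial>\<mu>)"
    unfolding AE_all_countable by (intro allI lln S.bounded_measurable_intros A_bm)
  show ?thesis
    using VV WV
  proof eventually_elim
    case (elim \<omega>)
    show ?case
    \<comment> \<open>From here on \<open>\<omega>\<close> is fixed and the argument is
      deterministic: the empirical matrices converge to the projection coefficients, and these to
      the Taylor coefficients.\<close>
    proof (rule iterated_sup_limits[where a = "\<lambda>i j. a (\<alpha> i) (\<alpha> j)" and \<psi> = "output_coeff \<kappa> \<sigma> x0 c \<alpha>" and P = P
          and r = "r_dim CARD('n)" and B = "\<lambda>n. S.regression \<alpha> F (r_dim CARD('n) n)"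
          and A = "\<lambda>m n N i j. (W_mat \<kappa> \<sigma> x0 \<alpha> m N (\<lambda>t. X t \<omega>) (\<lambda>t. F (X t \<omega>)) * pinv (V_mat \<kappa> \<sigma> x0 \<alpha> n N (\<lambda>t. X t \<omega>))) $$ (i, j)"])
      show "\<bar>output_coeff \<kappa> \<sigma> x0 c \<alpha> l i j y\<bar> \<le> P l i j" if "y \<in> K" for l i j y
        using RK[OF that] by (intro P allI)
      show "(\<lambda>(i, j). \<bar>a (\<alpha> i) (\<alpha> j)\<bar> * P l i j) summable_on UNIV" for l by (rule P_sum)
      show "((\<lambda>(i, j). a (\<alpha> i) (\<alpha> j) * output_coeff \<kappa> \<sigma> x0 c \<alpha> l i j y) has_sum F y $ l) UNIV" if "y \<in> K" for l y
        using RK[OF that] by (intro total allI)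
      show r: "filterlim (r_dim CARD('n)) at_top sequentially"
        by (rule filterlim_r_dim) (simp add: Suc_le_eq)
      show "(\<lambda>n. S.regression \<alpha> F (r_dim CARD('n) n) i j) \<longlonglongrightarrow> a (\<alpha> i) (\<alpha> j)" for i j
        by (rule filterlim_compose[OF S.regression_tendsto[OF A_meas a_sum a_exp \<alpha>] r])
      show "(\<lambda>N. (W_mat \<kappa> \<sigma> x0 \<alpha> m N (\<lambda>t. X t \<omega>) (\<lambda>t. F (X t \<omega>)) * pinv (V_mat \<kappa> \<sigma> x0 \<alpha> n N (\<lambda>t. X t \<omega>))) $$ (i, j))
          \<longlonglongrightarrow> S.regression \<alpha> F (r_dim CARD('n) n) i j"
        if "m \<le> n" "i < r_dim CARD('n) m" "j < r_dim CARD('n) m" for m n i j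
      proof (rule S.least_squares_tendsto_regression[OF inj _ _ that(2)])
        show "j < r_dim CARD('n) n" using that r_dim_mono[OF that(1), of "CARD('n)"] by simp
      qed (use elim in blast)+
      show "F_hat \<kappa> \<sigma> x0 c \<alpha> m n N (\<lambda>t. X t \<omega>) (\<lambda>t. F (X t \<omega>)) y $ l =
          (\<Sum>i<r_dim CARD('n) m. \<Sum>j<r_dim CARD('n) m.
            (W_mat \<kappa> \<sigma> x0 \<alpha> m N (\<lambda>t. X t \<omega>) (\<lambda>t. F (X t \<omega>)) * pinv (V_mat \<kappa> \<sigma> x0 \<alpha> n N (\<lambda>t. X t \<omega>))) $$ (i, j)
              * output_coeff \<kappa> \<sigma> x0 c \<alpha> l i j y)" if "1 \<le> m" for m n N y l
        by (rule F_hat_eq[OF that assms(5)])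
    qed
  qed
qed

end
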